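(* Let $\alpha>0$ and $0<p,q\le\infty$. There exists $\delta_0=\delta_0(\alpha,p,q)\in(0,\frac12]$ such that for every $\delta\in(0,\delta_0)$ and every $\delta$-pocket tiling $\mathcal P_\delta$ of $\mathbb C$ with centers $\{\zeta_Q\}_{Q\in\mathcal P_\delta}$ (as defined in the context) the following hold, with all constants depending only on $\alpha,p,q,\delta$. (i) (Synthesis.) The operator $$S_\delta^{\ker}c(z):=\sum_{Q\in\mathcal P_\delta}c_Q\,\kappa_{\zeta_Q}(z),\qquad c=(c_Q)_{Q\in\mathcal P_\delta},$$ is a bounded linear operator from $\ell_w^{p,q}$ to $\mathcal F_\alpha^{p,q}$: there is a constant $C$ with $\|S_\delta^{\ker}c\|_{\mathcal F_\alpha^{p,q}}\le C\|c\|_{\ell_w^{p,q}}$ for all $c\in\ell_w^{p,q}$. (ii) (Coefficient recovery and optimality.) For every $f\in\mathcal F_\alpha^{p,q}$ there exists $c\in\ell_w^{p,q}$ with $f=S_\delta^{\ker}c$, and there is a constant $C\ge1$ such that for every $f\in\mathcal F_\alpha^{p,q}$ $$C^{-1}\|f\|_{\mathcal F_\alpha^{p,q}}\le\inf\left\{\|c\|_{\ell_w^{p,q}}:\ c\in\ell_w^{p,q},\ f=S_\delta^{\ker}c\right\}\le C\|f\|_{\mathcal F_\alpha^{p,q}}.$$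
   Context: Convention: $\frac1\infty=0$. Mixed-norm Fock spaces. For an entire function $f$ and $r\ge0$, $M_p(f,r):=\left(\frac1{2\pi}\int_0^{2\pi}|f(re^{i\theta})|^p\,d\theta\right)^{1/p}$ for $0<p<\infty$, and $M_\infty(f,r):=\sup_{\theta}|f(re^{i\theta})|$. Put $\|f\|_{\mathcal F_\alpha^{p,q}}:=\left(\int_0^\infty M_p(f,r)^q\,\alpha q\,e^{-\frac{\alpha q}{2}r^2}r\,dr\right)^{1/q}$ for $0<q<\infty$ and $\|f\|_{\mathcal F_\alpha^{p,\infty}}:=\sup_{r\ge0}M_p(f,r)e^{-\frac{\alpha}{2}r^2}$. $\mathcal F_\alpha^{p,q}$ is the set of entire $f$ with $\|f\|_{\mathcal F_\alpha^{p,q}}<\infty$. Normalized Fock kernels: $\kappa_w(z):=e^{\alpha\overline w z-\frac{\alpha}{2}|w|^2}$, $z,w\in\mathbb C$. $\delta$-pocket tiling. Let $\delta\in(0,\frac12]$, $N_\delta:=\lceil\delta^{-1}\rceil$, $A_k:=\{z\in\mathbb C:k\le|z|<k+1\}$ for $k\in\{0,1,2,\dots\}$. For $k\ge0$, $0\le\nu\le N_\delta-1$ let $N_{\delta,0,\nu}:=2\nu+1$ and $N_{\delta,k,\nu}:=(2k+1)N_\delta$ if $k\ge1$; $\theta_{k,\nu,\mu}:=2\pi\mu/N_{\delta,k,\nu}$ for $0\le\mu\le N_{\delta,k,\nu}$. For $0\le\nu\le N_\delta$ let $r_{0,\nu}:=\nu/N_\delta$ and $r_{k,\nu}:=\left(k^2+\frac{\nu}{N_\delta}(2k+1)\right)^{1/2}$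 if $k\ge1$. The pockets are $Q_{k,\nu,\mu}:=\{re^{i\theta}:r\in[r_{k,\nu},r_{k,\nu+1}),\ \theta\in[\theta_{k,\nu,\mu},\theta_{k,\nu,\mu+1})\}$ ($k\ge0$, $0\le\nu\le N_\delta-1$, $0\le\mu\le N_{\delta,k,\nu}-1$), with centers $\zeta_{k,\nu,\mu}:=\frac{r_{k,\nu}+r_{k,\nu+1}}2\exp\left(i\,\frac{\theta_{k,\nu,\mu}+\theta_{k,\nu,\mu+1}}2\right)$. $\mathcal P_\delta$ is the family of all these pockets; its elements are written $Q$ with center $\zeta_Q$, and $\mathcal P_{\delta,k}:=\{Q\in\mathcal P_\delta:Q\subset A_k\}$. Coefficient space. For a complex sequence $c=(c_Q)_{Q\in\mathcal P_\delta}$ let $c_k:=(c_Q)_{Q\in\mathcal P_{\delta,k}}$, $\|c_k\|_{\ell^p}:=\left(\sum_{Q\in\mathcal P_{\delta,k}}|c_Q|^p\right)^{1/p}$ (supremum if $p=\infty$), and $w_k:=(1+k)^{\frac1q-\frac1p}$. Then $\ell_w^{p,q}$ is the space of $c$ with $\|c\|_{\ell_w^{p,q}}:=\left(\sum_{k\ge0}[w_k\|c_k\|_{\ell^p}]^q\right)^{1/q}<\infty$ (with $\sup_{k\ge0}w_k\|c_k\|_{\ell^p}$ if $q=\infty$). The series defining $S_\delta^{\ker}c$ is understood in the sense of absolute, locally uniform convergence on $\mathbb C$. *)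

theory Defs
  imports "HOL-Complex_Analysis.Complex_Analysis"
begin

section \<open>Exponents and powers\<close>

text \<open>
  Exponents \<open>p, q\<close> in \<open>(0, \<infinity>]\<close> are elements of \<^typ>\<open>ennreal\<close>, so that
  \<open>inverse \<infinity> = 0\<close> is the convention \<open>1 / \<infinity> = 0\<close>.
  Norms take values in \<^typ>\<open>ennreal\<close>.  The power below is only used with exponents \<open>a > 0\<close>.
\<close>

definition epowr :: "ennreal \<Rightarrow> real \<Rightarrow> ennreal" where
  "epowr x a = (if x = \<infinity> then \<infinity> else ennreal (enn2real x powr a))"


section \<open>Mixed-norm Fock spaces\<close>

definition M_mean :: "ennreal \<Rightarrow> (complex \<Rightarrow> complex) \<Rightarrow> real \<Rightarrow> ennreal" where
  "M_mean p f r =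
     (if p = \<infinity> then (SUP \<theta>::real. ennreal (cmod (f (of_real r * cis \<theta>))))
      else epowr (ennreal (1 / (2 * pi)) *
             (\<integral>\<^sup>+ \<theta> \<in> {0..2 * pi}. ennreal (cmod (f (of_real r * cis \<theta>)) powr enn2real p) \<partial>lborel))
             (1 / enn2real p))"

definition fock_norm :: "real \<Rightarrow> ennreal \<Rightarrow> ennreal \<Rightarrow> (complex \<Rightarrow> complex) \<Rightarrow> ennreal" where
  "fock_norm \<alpha> p q f =
     (if q = \<infinity> then (SUP r\<in>{0..}. M_mean p f r * ennreal (exp (- (\<alpha> / 2) * r\<^sup>2)))
      else epowr
             (\<integral>\<^sup>+ r \<in> {0..}. epowr (M_mean p f r) (enn2real q) *
                ennreal (\<alpha> * enn2real q * exp (- (\<alpha> * enn2real q / 2) * r\<^sup>2) * r) \<partial>lborel)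
             (1 / enn2real q))"

definition fock_space :: "real \<Rightarrow> ennreal \<Rightarrow> ennreal \<Rightarrow> (complex \<Rightarrow> complex) set" where
  "fock_space \<alpha> p q = {f. f holomorphic_on UNIV \<and> fock_norm \<alpha> p q f < \<infinity>}"

definition fock_kernel :: "real \<Rightarrow> complex \<Rightarrow> complex \<Rightarrow> complex" where
  "fock_kernel \<alpha> w z = exp (of_real \<alpha> * cnj w * z - of_real (\<alpha> / 2 * (cmod w)\<^sup>2))"


section \<open>The pocket tiling\<close>

definition N_rad :: "real \<Rightarrow> nat" where
  "N_rad \<delta> = nat \<lceil>1 / \<delta>\<rceil>"

definition N_ang :: "real \<Rightarrow> nat \<Rightarrow> nat \<Rightarrow> nat" where
  "N_ang \<delta> k \<nu> = (if k = 0 then 2 * \<nu> + 1 else (2 * k + 1) * N_rad \<delta>)"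

definition pocket_angle :: "real \<Rightarrow> nat \<Rightarrow> nat \<Rightarrow> nat \<Rightarrow> real" where
  "pocket_angle \<delta> k \<nu> \<mu> = 2 * pi * real \<mu> / real (N_ang \<delta> k \<nu>)"

definition pocket_radius :: "real \<Rightarrow> nat \<Rightarrow> nat \<Rightarrow> real" where
  "pocket_radius \<delta> k \<nu> =
     (if k = 0 then real \<nu> / real (N_rad \<delta>)
      else sqrt ((real k)\<^sup>2 + real \<nu> / real (N_rad \<delta>) * (2 * real k + 1)))"

definition annulus :: "nat \<Rightarrow> complex set" where
  "annulus k = {z. real k \<le> cmod z \<and> cmod z < real k + 1}"

definition pocket_indices :: "real \<Rightarrow> (nat \<times> nat \<times> nat) set" where
  "pocket_indices \<delta> = {(k, \<nu>, \<mu>). \<nu> < N_rad \<delta> \<and> \<mu> < N_ang \<delta> k \<nu>}"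

definition pocket :: "real \<Rightarrow> nat \<Rightarrow> nat \<Rightarrow> nat \<Rightarrow> complex set" where
  "pocket \<delta> k \<nu> \<mu> = {of_real r * cis \<theta> | r \<theta>.
     r \<in> {pocket_radius \<delta> k \<nu> ..< pocket_radius \<delta> k (\<nu> + 1)} \<and>
     \<theta> \<in> {pocket_angle \<delta> k \<nu> \<mu> ..< pocket_angle \<delta> k \<nu> (\<mu> + 1)}}"

definition pocket_center :: "real \<Rightarrow> nat \<Rightarrow> nat \<Rightarrow> nat \<Rightarrow> complex" where
  "pocket_center \<delta> k \<nu> \<mu> =
     of_real ((pocket_radius \<delta> k \<nu> + pocket_radius \<delta> k (\<nu> + 1)) / 2) *
     cis ((pocket_angle \<delta> k \<nu> \<mu> + pocket_angle \<delta> k \<nu> (\<mu> + 1)) / 2)"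

definition pockets :: "real \<Rightarrow> complex set set" where
  "pockets \<delta> = {pocket \<delta> k \<nu> \<mu> | k \<nu> \<mu>. (k, \<nu>, \<mu>) \<in> pocket_indices \<delta>}"

text \<open>
  The center as a function of the pocket itself; distinct indices give distinct pockets, see
  \<open>center_pocket\<close> below.
\<close>

definition center :: "real \<Rightarrow> complex set \<Rightarrow> complex" where
  "center \<delta> Q = (THE \<zeta>. \<exists>k \<nu> \<mu>. (k, \<nu>, \<mu>) \<in> pocket_indices \<delta> \<and>
                    Q = pocket \<delta> k \<nu> \<mu> \<and> \<zeta> = pocket_center \<delta> k \<nu> \<mu>)"

definition pockets_in :: "real \<Rightarrow> nat \<Rightarrow> complex set set" where
  "pockets_in \<delta> k = {Q \<in> pockets \<delta>. Q \<subseteq> annulus k}"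


section \<open>The coefficient space\<close>

text \<open>
  A family \<open>(c\<^sub>Q)\<close> indexed by the pockets is a function on sets of which only the
  values on \<^term>\<open>pockets \<delta>\<close> are ever used.  The sum over \<^term>\<open>pockets_in \<delta> k\<close> is finite, see
  \<open>finite_pockets_in\<close> below.
\<close>

definition block_norm :: "real \<Rightarrow> ennreal \<Rightarrow> (complex set \<Rightarrow> complex) \<Rightarrow> nat \<Rightarrow> ennreal" where
  "block_norm \<delta> p c k =
     (if p = \<infinity> then (SUP Q\<in>pockets_in \<delta> k. ennreal (cmod (c Q)))
      else epowr (\<Sum>Q\<in>pockets_in \<delta> k. ennreal (cmod (c Q) powr enn2real p)) (1 / enn2real p))"

definition weight :: "ennreal \<Rightarrow> ennreal \<Rightarrow> nat \<Rightarrow> real" where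
  "weight p q k = (1 + real k) powr (enn2real (inverse q) - enn2real (inverse p))"

definition seq_norm :: "real \<Rightarrow> ennreal \<Rightarrow> ennreal \<Rightarrow> (complex set \<Rightarrow> complex) \<Rightarrow> ennreal" where
  "seq_norm \<delta> p q c =
     (if q = \<infinity> then (SUP k. ennreal (weight p q k) * block_norm \<delta> p c k)
      else epowr (\<Sum>k. epowr (ennreal (weight p q k) * block_norm \<delta> p c k) (enn2real q))
             (1 / enn2real q))"

definition seq_space :: "real \<Rightarrow> ennreal \<Rightarrow> ennreal \<Rightarrow> (complex set \<Rightarrow> complex) set" where
  "seq_space \<delta> p q = {c. seq_norm \<delta> p q c < \<infinity>}"


section \<open>The synthesis operator\<close>

text \<open>
  Uniformity refers to the net of all finite partial sums, so no enumeration of the index set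
  is chosen.
\<close>

definition abs_loc_unif_summable :: "('i \<Rightarrow> complex \<Rightarrow> complex) \<Rightarrow> 'i set \<Rightarrow> bool" where
  "abs_loc_unif_summable g I \<longleftrightarrow>
     (\<forall>z. (\<lambda>i. cmod (g i z)) summable_on I) \<and>
     (\<forall>K. compact K \<longrightarrow>
        uniform_limit K (\<lambda>F z. \<Sum>i\<in>F. g i z) (\<lambda>z. \<Sum>\<^sub>\<infinity>i\<in>I. g i z) (finite_subsets_at_top I))"

definition synth_term ::
    "real \<Rightarrow> real \<Rightarrow> (complex set \<Rightarrow> complex) \<Rightarrow> complex set \<Rightarrow> complex \<Rightarrow> complex" where
  "synth_term \<alpha> \<delta> c Q z = c Q * fock_kernel \<alpha> (center \<delta> Q) z"

definition synth :: "real \<Rightarrow> real \<Rightarrow> (complex set \<Rightarrow> complex) \<Rightarrow> complex \<Rightarrow> complex" where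
  "synth \<alpha> \<delta> c z = (\<Sum>\<^sub>\<infinity>Q\<in>pockets \<delta>. synth_term \<alpha> \<delta> c Q z)"


section \<open>Well-definedness of the encoding\<close>

lemma N_rad_pos: "0 < \<delta> \<Longrightarrow> 0 < N_rad \<delta>"
  by (simp add: N_rad_def)

lemma N_ang_pos: "0 < \<delta> \<Longrightarrow> 0 < N_ang \<delta> k \<nu>"
  using N_rad_pos[of \<delta>] by (simp add: N_ang_def)

lemma pocket_radius_bounds:
  assumes "0 < \<delta>" "\<nu> \<le> N_rad \<delta>"
  shows "real k \<le> pocket_radius \<delta> k \<nu>" "pocket_radius \<delta> k \<nu> \<le> real k + 1"
proof -
  have N: "0 < real (N_rad \<delta>)" using N_rad_pos assms by simp
  have a: "0 \<le> real \<nu> / real (N_rad \<delta>)" "real \<nu> / real (N_rad \<delta>) \<le> 1" using assms N by auto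
  have b: "0 \<le> real \<nu> / real (N_rad \<delta>) * (2 * real k + 1)"
    by (intro mult_nonneg_nonneg a) simp
  have d: "real \<nu> / real (N_rad \<delta>) * (2 * real k + 1) \<le> 1 * (2 * real k + 1)"
    by (intro mult_right_mono a) simp
  show "real k \<le> pocket_radius \<delta> k \<nu>"
    using a b by (auto simp: pocket_radius_def intro!: real_le_rsqrt)
  show "pocket_radius \<delta> k \<nu> \<le> real k + 1"
    using a d by (auto simp: pocket_radius_def power2_eq_square algebra_simps intro!: real_le_lsqrt)
qed

lemma pocket_radius_less:
  assumes "0 < \<delta>" shows "pocket_radius \<delta> k \<nu> < pocket_radius \<delta> k (\<nu> + 1)"
  using N_rad_pos[OF assms]
  by (auto simp: pocket_radius_def divide_simps algebra_simps intro!: add_pos_nonneg)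

lemma pocket_radius_nonneg: "0 \<le> pocket_radius \<delta> k \<nu>"
  by (simp add: pocket_radius_def)

lemma pocket_radius_mono:
  assumes "0 < \<delta>" "\<nu> \<le> \<nu>'" shows "pocket_radius \<delta> k \<nu> \<le> pocket_radius \<delta> k \<nu>'"
  using lift_Suc_mono_le[of "pocket_radius \<delta> k"] pocket_radius_less[OF assms(1)] assms(2)
  by (simp add: less_imp_le)

lemma pocket_angle_less:
  assumes "0 < \<delta>" shows "pocket_angle \<delta> k \<nu> \<mu> < pocket_angle \<delta> k \<nu> (\<mu> + 1)"
  using N_ang_pos[OF assms, of k \<nu>] by (simp add: pocket_angle_def divide_simps)

lemma pocket_angle_mono:
  "\<mu> \<le> \<mu>' \<Longrightarrow> pocket_angle \<delta> k \<nu> \<mu> \<le> pocket_angle \<delta> k \<nu> \<mu>'"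
  by (simp add: pocket_angle_def divide_right_mono)

lemma pocket_angle_bounds:
  assumes "0 < \<delta>" "\<mu> \<le> N_ang \<delta> k \<nu>"
  shows "0 \<le> pocket_angle \<delta> k \<nu> \<mu>" "pocket_angle \<delta> k \<nu> \<mu> \<le> 2 * pi"
  using N_ang_pos[OF assms(1), of k \<nu>] assms(2)
  by (auto simp: pocket_angle_def divide_simps)

lemma pocket_center_in_pocket:
  assumes "0 < \<delta>"
  shows "pocket_center \<delta> k \<nu> \<mu> \<in> pocket \<delta> k \<nu> \<mu>" "pocket_center \<delta> k \<nu> \<mu> \<noteq> 0"
proof -
  note r = pocket_radius_less[OF assms, of k \<nu>] pocket_radius_nonneg[of \<delta> k \<nu>]
  note t = pocket_angle_less[OF assms, of k \<nu> \<mu>]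
  show "pocket_center \<delta> k \<nu> \<mu> \<in> pocket \<delta> k \<nu> \<mu>"
    unfolding pocket_def pocket_center_def mem_Collect_eq using r t
    by (intro exI conjI) (rule refl, auto)
  have "(pocket_radius \<delta> k \<nu> + pocket_radius \<delta> k (\<nu> + 1)) / 2 \<noteq> 0" using r by simp
  then show "pocket_center \<delta> k \<nu> \<mu> \<noteq> 0"
    unfolding pocket_center_def by (metis cis_neq_zero mult_eq_0_iff of_real_eq_0_iff)
qed

lemma pocket_subset_annulus:
  assumes "0 < \<delta>" "\<nu> < N_rad \<delta>"
  shows "pocket \<delta> k \<nu> \<mu> \<subseteq> annulus k"
proof
  fix z assume "z \<in> pocket \<delta> k \<nu> \<mu>"
  then obtain r \<theta> where z: "z = of_real r * cis \<theta>"
    "pocket_radius \<delta> k \<nu> \<le> r" "r < pocket_radius \<delta> k (\<nu> + 1)"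
    by (auto simp: pocket_def)
  moreover have "real k \<le> pocket_radius \<delta> k \<nu>" "pocket_radius \<delta> k (\<nu> + 1) \<le> real k + 1"
    using assms by (auto intro!: pocket_radius_bounds)
  ultimately show "z \<in> annulus k" by (simp add: annulus_def norm_mult)
qed

lemma pocket_index_unique:
  assumes \<delta>: "0 < \<delta>" and z: "z \<noteq> 0" "z \<in> pocket \<delta> k \<nu> \<mu>" "z \<in> pocket \<delta> k' \<nu>' \<mu>'"
    and i: "(k, \<nu>, \<mu>) \<in> pocket_indices \<delta>" "(k', \<nu>', \<mu>') \<in> pocket_indices \<delta>"
  shows "k' = k \<and> \<nu>' = \<nu> \<and> \<mu>' = \<mu>"
proof -
  from i have i': "\<nu> < N_rad \<delta>" "\<mu> < N_ang \<delta> k \<nu>" "\<nu>' < N_rad \<delta>" "\<mu>' < N_ang \<delta> k' \<nu>'"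
    by (auto simp: pocket_indices_def)
  have "z \<in> annulus k" "z \<in> annulus k'" using z pocket_subset_annulus[OF \<delta>] i' by blast+
  then have k: "k' = k" by (auto simp: annulus_def)
  obtain r \<theta> where 1: "z = of_real r * cis \<theta>"
      "pocket_radius \<delta> k \<nu> \<le> r" "r < pocket_radius \<delta> k (\<nu> + 1)"
      "pocket_angle \<delta> k \<nu> \<mu> \<le> \<theta>" "\<theta> < pocket_angle \<delta> k \<nu> (\<mu> + 1)"
    using z by (auto simp: pocket_def)
  obtain r' \<theta>' where 2: "z = of_real r' * cis \<theta>'"
      "pocket_radius \<delta> k \<nu>' \<le> r'" "r' < pocket_radius \<delta> k (\<nu>' + 1)"
      "pocket_angle \<delta> k \<nu>' \<mu>' \<le> \<theta>'" "\<theta>' < pocket_angle \<delta> k \<nu>' (\<mu>' + 1)"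
    using z k by (auto simp: pocket_def)
  have "r \<ge> 0" "r' \<ge> 0" using 1 2 pocket_radius_nonneg order_trans by blast+
  then have rr: "r = cmod z" "r' = cmod z" by (simp add: 1(1) norm_mult, simp add: 2(1) norm_mult)
  have \<nu>: "\<nu>' = \<nu>"
    using 1(2,3) 2(2,3) rr pocket_radius_mono[OF \<delta>, of "\<nu> + 1" \<nu>' k]
      pocket_radius_mono[OF \<delta>, of "\<nu>' + 1" \<nu> k]
    by (cases \<nu> \<nu>' rule: linorder_cases) auto
  have "cis \<theta> = cis \<theta>'" by (metis 1(1) 2(1) rr z(1) mult_cancel_left mult_zero_left)
  moreover have "0 \<le> \<theta>" "\<theta> < 2 * pi" "0 \<le> \<theta>'" "\<theta>' < 2 * pi"
    using 1(4,5) 2(4,5) i' k \<nu> pocket_angle_bounds[OF \<delta>, of \<mu> k \<nu>] pocket_angle_bounds[OF \<delta>, of \<mu>' k \<nu>]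
      pocket_angle_bounds[OF \<delta>, of "\<mu> + 1" k \<nu>] pocket_angle_bounds[OF \<delta>, of "\<mu>' + 1" k \<nu>]
    by auto
  ultimately have "\<theta> = \<theta>'"
    by (metis Arg2pi_unique cis_conv_exp mult.left_neutral of_real_1 zero_less_one)
  then have "\<mu>' = \<mu>"
    using 1(4,5) 2(4,5) \<open>\<theta> = \<theta>'\<close> \<nu> pocket_angle_mono[of "\<mu> + 1" \<mu>' \<delta> k \<nu>] pocket_angle_mono[of "\<mu>' + 1" \<mu> \<delta> k \<nu>]
    by (cases \<mu> \<mu>' rule: linorder_cases) auto
  with k \<nu> show ?thesis by simp
qed

lemma center_pocket:
  assumes "0 < \<delta>" "(k, \<nu>, \<mu>) \<in> pocket_indices \<delta>"
  shows "center \<delta> (pocket \<delta> k \<nu> \<mu>) = pocket_center \<delta> k \<nu> \<mu>"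
  unfolding center_def
proof (rule the_equality)
  fix \<zeta> assume "\<exists>k' \<nu>' \<mu>'. (k', \<nu>', \<mu>') \<in> pocket_indices \<delta> \<and>
      pocket \<delta> k \<nu> \<mu> = pocket \<delta> k' \<nu>' \<mu>' \<and> \<zeta> = pocket_center \<delta> k' \<nu>' \<mu>'"
  then obtain k' \<nu>' \<mu>' where *: "(k', \<nu>', \<mu>') \<in> pocket_indices \<delta>"
      "pocket \<delta> k \<nu> \<mu> = pocket \<delta> k' \<nu>' \<mu>'" "\<zeta> = pocket_center \<delta> k' \<nu>' \<mu>'" by blast
  have "k' = k \<and> \<nu>' = \<nu> \<and> \<mu>' = \<mu>"
    by (rule pocket_index_unique[of \<delta> "pocket_center \<delta> k \<nu> \<mu>"])
      (use assms * pocket_center_in_pocket[OF assms(1), of k \<nu> \<mu>] in simp_all)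
  with * show "\<zeta> = pocket_center \<delta> k \<nu> \<mu>" by simp
qed (use assms in blast)

lemma pockets_in_eq:
  assumes "0 < \<delta>"
  shows "pockets_in \<delta> k = (\<lambda>(\<nu>, \<mu>). pocket \<delta> k \<nu> \<mu>) ` (SIGMA \<nu>:{..<N_rad \<delta>}. {..<N_ang \<delta> k \<nu>})"
proof (intro equalityI subsetI)
  fix Q assume "Q \<in> pockets_in \<delta> k"
  then obtain k' \<nu> \<mu> where Q: "Q = pocket \<delta> k' \<nu> \<mu>" "\<nu> < N_rad \<delta>" "\<mu> < N_ang \<delta> k' \<nu>" "Q \<subseteq> annulus k"
    by (auto simp: pockets_in_def pockets_def pocket_indices_def)
  have "pocket_center \<delta> k' \<nu> \<mu> \<in> annulus k" "pocket_center \<delta> k' \<nu> \<mu> \<in> annulus k'"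
    using pocket_center_in_pocket(1)[OF assms, of k' \<nu> \<mu>] pocket_subset_annulus[OF assms] Q by blast+
  then have "k' = k" by (auto simp: annulus_def)
  with Q show "Q \<in> (\<lambda>(\<nu>, \<mu>). pocket \<delta> k \<nu> \<mu>) ` (SIGMA \<nu>:{..<N_rad \<delta>}. {..<N_ang \<delta> k \<nu>})"
    by force
qed (use pocket_subset_annulus[OF assms] in
      \<open>fastforce simp: pockets_in_def pockets_def pocket_indices_def\<close>)

lemma finite_pockets_in: "0 < \<delta> \<Longrightarrow> finite (pockets_in \<delta> k)"
  by (simp add: pockets_in_eq)

end

theory Submission
  imports Defs "HOL-Probability.Distributions"
begin

text \<open>
  Write \<open>F z = |f z| exp (- \<alpha>/2 |z|\<^sup>2)\<close>.  Let \<open>s \<le> min 1 (min p q)\<close>.  Subadditivity of \<open>t\<^sup>s\<close> for synthesis and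
  the mean value inequality for \<open>|f|\<^sup>s\<close> for recovery bound everything by the integral operator \<open>kern s\<close> with kernel
  \<open>exp (- s |z - u|)\<close>.  As \<open>p/s, q/s \<ge> 1\<close>, it is bounded in the mixed norm by Minkowski's inequality on circles (the
  kernel is rotation invariant) and Jensen's inequality in the radial variable.

  For recovery, discretising the reproducing formula over the pockets gives sampling coefficients whose
  synthesis differs from \<open>f\<close> by an error \<open>E f\<close>.  If \<open>F x \<le> A exp |z\<^sub>0 - x|\<close> for all \<open>x\<close>, the weighted error satisfies the
  same bound with \<open>A\<close> replaced by \<open>O(\<delta>) A\<close>.  Hence for small \<open>\<delta>\<close> the coefficients obtained by iterating \<open>E\<close> converge
  pointwise and are controlled at each centre \<open>z\<^sub>0\<close> by the best such \<open>A\<close>; no completeness of the quasi-normed spaces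
  is needed.
\<close>

section \<open>Lebesgue measure on the complex plane\<close>

lemma measurable_Complex [measurable]:
  assumes "f \<in> borel_measurable M" "g \<in> borel_measurable M"
  shows "(\<lambda>x. Complex (f x) (g x)) \<in> borel_measurable M"
proof -
  have "(\<lambda>x. Complex (f x) (g x)) = (\<lambda>x. of_real (f x) + \<i> * of_real (g x))"
    by (auto simp: complex_eq_iff)
  then show ?thesis using assms by simp
qed

text \<open>Lebesgue measure is determined by its values on boxes, and boxes pull back to products
  of intervals. This gives access to Tonelli in both orders.\<close>

lemma lborel_complex_eq:
  "(lborel :: complex measure) = distr (lborel \<Otimes>\<^sub>M lborel) borel (\<lambda>(x, y). Complex x y)"
proof (rule lborel_eqI)
  fix l u :: complex
  assume le: "\<And>b. b \<in> Basis \<Longrightarrow> l \<bullet> b \<le> u \<bullet> b"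
  have [measurable]: "(\<lambda>(x, y). Complex x y) \<in> borel_measurable (lborel \<Otimes>\<^sub>M lborel)"
    unfolding split_beta by measurable
  have vim: "(\<lambda>(x, y). Complex x y) -` box l u \<inter> space (lborel \<Otimes>\<^sub>M lborel) =
      {Re l <..< Re u} \<times> {Im l <..< Im u}"
    by (auto simp: box_def Basis_complex_def space_pair_measure)
  have le': "Re l \<le> Re u" "Im l \<le> Im u"
    using le[of 1] le[of \<i>] by (auto simp: Basis_complex_def)
  have "emeasure (distr (lborel \<Otimes>\<^sub>M lborel) borel (\<lambda>(x, y). Complex x y)) (box l u)
      = emeasure (lborel \<Otimes>\<^sub>M lborel) ({Re l <..< Re u} \<times> {Im l <..< Im u})"
    by (subst emeasure_distr) (auto simp: vim)
  also have "\<dots> = ennreal (Re u - Re l) * ennreal (Im u - Im l)"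
    using le' by (subst lborel.emeasure_pair_measure_Times) auto
  also have "\<dots> = ennreal (\<Prod>b\<in>Basis. (u - l) \<bullet> b)"
    using le' by (simp add: Basis_complex_def ennreal_mult)
  finally show "emeasure (distr (lborel \<Otimes>\<^sub>M lborel) borel (\<lambda>(x, y). Complex x y)) (box l u) =
    ennreal (\<Prod>b\<in>Basis. (u - l) \<bullet> b)" .
qed simp

lemma nn_integral_lborel_complex:
  fixes h :: "complex \<Rightarrow> ennreal"
  assumes [measurable]: "h \<in> borel_measurable borel"
  shows "(\<integral>\<^sup>+z. h z \<partial>lborel) = (\<integral>\<^sup>+x. \<integral>\<^sup>+y. h (Complex x y) \<partial>lborel \<partial>lborel)"
    and "(\<integral>\<^sup>+z. h z \<partial>lborel) = (\<integral>\<^sup>+y. \<integral>\<^sup>+x. h (Complex x y) \<partial>lborel \<partial>lborel)"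
proof -
  have [measurable]: "(\<lambda>(x, y). Complex x y) \<in> borel_measurable (lborel \<Otimes>\<^sub>M lborel)"
    unfolding split_beta by measurable
  have "(\<integral>\<^sup>+z. h z \<partial>lborel) = (\<integral>\<^sup>+w. h (Complex (fst w) (snd w)) \<partial>(lborel \<Otimes>\<^sub>M lborel))"
    by (subst lborel_complex_eq, subst nn_integral_distr) (auto simp: split_beta)
  also have "\<dots> = (\<integral>\<^sup>+x. \<integral>\<^sup>+y. h (Complex x y) \<partial>lborel \<partial>lborel)"
    by (subst lborel.nn_integral_fst[symmetric]) auto
  finally show 1: "(\<integral>\<^sup>+z. h z \<partial>lborel) = (\<integral>\<^sup>+x. \<integral>\<^sup>+y. h (Complex x y) \<partial>lborel \<partial>lborel)" .
  show "(\<integral>\<^sup>+z. h z \<partial>lborel) = (\<integral>\<^sup>+y. \<integral>\<^sup>+x. h (Complex x y) \<partial>lborel \<partial>lborel)"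
    unfolding 1 by (subst lborel_pair.Fubini') auto
qed

lemma nn_integral_real_shift:
  fixes f :: "real \<Rightarrow> ennreal"
  assumes "f \<in> borel_measurable borel"
  shows "(\<integral>\<^sup>+x. f (x + t) \<partial>lborel) = (\<integral>\<^sup>+x. f x \<partial>lborel)"
  using nn_integral_real_affine[OF assms, of 1 t] by (simp add: add.commute)

text \<open>With the other coordinate frozen, a shear is a translation of a line.\<close>

lemma nn_integral_shear:
  fixes h :: "complex \<Rightarrow> ennreal"
  assumes [measurable]: "h \<in> borel_measurable borel"
  shows "(\<integral>\<^sup>+z. h (Complex (Re z + a * Im z) (Im z)) \<partial>lborel) = (\<integral>\<^sup>+z. h z \<partial>lborel)"
    and "(\<integral>\<^sup>+z. h (Complex (Re z) (Im z + a * Re z)) \<partial>lborel) = (\<integral>\<^sup>+z. h z \<partial>lborel)"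
proof -
  show "(\<integral>\<^sup>+z. h (Complex (Re z + a * Im z) (Im z)) \<partial>lborel) = (\<integral>\<^sup>+z. h z \<partial>lborel)"
    by (subst (1 2) nn_integral_lborel_complex(2)) (auto intro!: nn_integral_cong nn_integral_real_shift)
  show "(\<integral>\<^sup>+z. h (Complex (Re z) (Im z + a * Re z)) \<partial>lborel) = (\<integral>\<^sup>+z. h z \<partial>lborel)"
    by (subst (1 2) nn_integral_lborel_complex(1)) (auto intro!: nn_integral_cong nn_integral_real_shift)
qed

text \<open>A rotation with \<open>sin t \<noteq> 0\<close> is a product of three shears.\<close>

lemma nn_integral_rotate:
  fixes h :: "complex \<Rightarrow> ennreal"
  assumes h [measurable]: "h \<in> borel_measurable borel"
  shows "(\<integral>\<^sup>+z. h (cis t * z) \<partial>lborel) = (\<integral>\<^sup>+z. h z \<partial>lborel)"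
proof -
  have gen: "(\<integral>\<^sup>+z. h (cis t * z) \<partial>lborel) = (\<integral>\<^sup>+z. h z \<partial>lborel)"
    if s: "sin t \<noteq> 0" and [measurable]: "h \<in> borel_measurable borel"
    for t and h :: "complex \<Rightarrow> ennreal"
  proof -
    \<comment> \<open>The outer two shears use this factor, the middle one \<open>sin t\<close>: it
      solves 1 + a sin t = cos t, and then a (1 + cos t) = - sin t gives the remaining matrix
      entry.\<close>
    define a where "a = (cos t - 1) / sin t"
    define X where "X = (\<lambda>z. Complex (Re z + a * Im z) (Im z))"
    define Y where "Y = (\<lambda>z. Complex (Re z) (Im z + sin t * Re z))"
    have [measurable]: "X \<in> borel_measurable borel" "Y \<in> borel_measurable borel"
      unfolding X_def Y_def by measurable
    have as: "1 + a * sin t = cos t" using s by (simp add: a_def)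
    have ac: "a * (1 + cos t) = - sin t"
      using s sin_squared_eq[of t] by (simp add: a_def field_simps power2_eq_square)
    have "cis t * z = X (Y (X z))" for z
    proof (rule complex_eqI)
      have "Re (X (Y (X z))) = (1 + a * sin t) * Re z + a * (1 + (1 + a * sin t)) * Im z"
        by (simp add: X_def Y_def algebra_simps)
      then show "Re (cis t * z) = Re (X (Y (X z)))"
        unfolding as ac by simp
      have "Im (X (Y (X z))) = sin t * Re z + (1 + a * sin t) * Im z"
        by (simp add: X_def Y_def algebra_simps)
      then show "Im (cis t * z) = Im (X (Y (X z)))"
        unfolding as by simp
    qed
    then have "(\<integral>\<^sup>+z. h (cis t * z) \<partial>lborel) = (\<integral>\<^sup>+z. (h \<circ> X \<circ> Y) (X z) \<partial>lborel)" by simp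
    also have "\<dots> = (\<integral>\<^sup>+z. (h \<circ> X \<circ> Y) z \<partial>lborel)"
      unfolding X_def[of] by (subst nn_integral_shear(1)) (auto simp: X_def[symmetric])
    also have "\<dots> = (\<integral>\<^sup>+z. (h \<circ> X) (Y z) \<partial>lborel)" by simp
    also have "\<dots> = (\<integral>\<^sup>+z. (h \<circ> X) z \<partial>lborel)"
      unfolding Y_def by (subst nn_integral_shear(2)) auto
    also have "\<dots> = (\<integral>\<^sup>+z. h (X z) \<partial>lborel)" by simp
    also have "\<dots> = (\<integral>\<^sup>+z. h z \<partial>lborel)"
      unfolding X_def by (subst nn_integral_shear(1)) auto
    finally show ?thesis .
  qed
  consider "sin t \<noteq> 0" | "cis t = 1" | "cis t = - 1"
    using sin_zero_abs_cos_one[of t] by (force simp: complex_eq_iff abs_if split: if_splits)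
  then show ?thesis
  proof cases
    case 1 then show ?thesis using gen h by blast
  next
    case 2 then show ?thesis by simp
  next
    \<comment> \<open>The half turn is the square of the quarter turn, whose sine is 1.\<close>
    case 3
    have "(\<integral>\<^sup>+z. h (cis t * z) \<partial>lborel) = (\<integral>\<^sup>+z. h (cis (pi/2) * (cis (pi/2) * z)) \<partial>lborel)"
      unfolding 3 by (simp add: cis_mult mult.assoc[symmetric])
    also have "\<dots> = (\<integral>\<^sup>+z. h (cis (pi/2) * z) \<partial>lborel)"
      by (rule gen[of "pi/2" "\<lambda>z. h (cis (pi/2) * z)"]) auto
    also have "\<dots> = (\<integral>\<^sup>+z. h z \<partial>lborel)" by (rule gen) auto
    finally show ?thesis .
  qed
qed

lemma distr_lborel_rotate: "distr lborel borel (\<lambda>z. cis t * z) = (lborel :: complex measure)"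
proof (rule measure_eqI)
  fix A assume "A \<in> sets (distr lborel borel (\<lambda>z. cis t * z))"
  then have A [measurable]: "A \<in> sets borel" by simp
  have "emeasure (distr lborel borel (\<lambda>z. cis t * z)) A
      = (\<integral>\<^sup>+z. indicator A z \<partial>distr lborel borel (\<lambda>z. cis t * z))" by simp
  also have "\<dots> = (\<integral>\<^sup>+z. indicator A (cis t * z) \<partial>lborel)"
    by (subst nn_integral_distr) auto
  also have "\<dots> = emeasure lborel A" by (subst nn_integral_rotate) auto
  finally show "emeasure (distr lborel borel (\<lambda>z. cis t * z)) A = emeasure lborel A" .
qed simp

lemma nn_integral_lborel_shift:
  fixes h :: "complex \<Rightarrow> ennreal"
  assumes [measurable]: "h \<in> borel_measurable borel"
  shows "(\<integral>\<^sup>+u. h (z + u) \<partial>lborel) = (\<integral>\<^sup>+u. h u \<partial>lborel)"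
  by (subst (2) lborel_distr_plus[symmetric, of z]) (subst nn_integral_distr, auto)

text \<open>Both sides are the integral of \<open>h\<close> against the distribution of the modulus, which is
  determined by the areas of discs.\<close>

lemma nn_integral_radial:
  fixes h :: "real \<Rightarrow> ennreal"
  assumes [measurable]: "h \<in> borel_measurable borel"
  shows "(\<integral>\<^sup>+z. h (cmod z) \<partial>lborel) = (\<integral>\<^sup>+ r \<in> {0..}. h r * ennreal (2 * pi * r) \<partial>lborel)"
proof -
  let ?D = "density lborel (\<lambda>r. ennreal (2 * pi * r) * indicator {0..} r)"
  have D: "emeasure ?D {..<a} = ennreal (pi * a\<^sup>2) * indicator {0..} a" for a :: real
  proof (cases "a \<ge> 0")
    case True
    have "emeasure ?D {..<a} = (\<integral>\<^sup>+r. ennreal (2 * pi * r) * indicator {0..a} r \<partial>lborel)"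
      by (subst emeasure_density)
        (auto intro!: nn_integral_cong_AE AE_I[where N="{a}"] simp: indicator_def of_bool_def split: if_splits)
    also have "\<dots> = ennreal (pi * a\<^sup>2 - pi * 0\<^sup>2)"
      using True by (intro nn_integral_FTC_Icc) (auto intro!: derivative_eq_intros)
    finally show ?thesis using True by simp
  next
    case False
    then have "emeasure ?D {..<a} = (\<integral>\<^sup>+(r::real). 0 \<partial>lborel)"
      by (subst emeasure_density, simp, simp, intro nn_integral_cong) (auto simp: indicator_def)
    with False show ?thesis by simp
  qed
  have C: "emeasure (distr lborel borel cmod) {..<a} = ennreal (pi * a\<^sup>2) * indicator {0..} a" for a :: real
  proof -
    have "emeasure (distr lborel borel cmod) {..<a} = emeasure lborel (ball (0::complex) a)"
      by (subst emeasure_distr) (auto intro!: arg_cong2[where f=emeasure])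
    also have "\<dots> = ennreal (pi * a\<^sup>2) * indicator {0..} a"
      by (cases "a \<ge> 0") (auto simp: ball_empty emeasure_ball unit_ball_vol_2)
    finally show ?thesis .
  qed
  have eq: "distr lborel borel cmod = ?D"
  proof (rule measure_eqI_generator_eq[where E="range lessThan" and \<Omega>=UNIV and A="\<lambda>n. {..< real n}"])
    show "Int_stable (range (lessThan :: real \<Rightarrow> _))"
    proof -
      have "{..<a} \<inter> {..<b} = {..<min a b}" for a b :: real by auto
      then show ?thesis by (auto simp: Int_stable_def)
    qed
    show "sets (distr lborel borel cmod) = sigma_sets UNIV (range lessThan)"
      by (simp add: borel_eq_lessThan eucl_lessThan)
    show "sets ?D = sigma_sets UNIV (range lessThan)"
      by (simp add: borel_eq_lessThan eucl_lessThan)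
    show "(\<Union>n. {..< real n}) = (UNIV :: real set)"
      by (auto intro: reals_Archimedean2)
    show "emeasure (distr lborel borel cmod) {..< real n} \<noteq> \<infinity>" for n
      by (simp add: C ennreal_mult_eq_top_iff)
  qed (auto simp: C D)
  have "(\<integral>\<^sup>+z. h (cmod z) \<partial>lborel) = (\<integral>\<^sup>+r. h r \<partial>distr lborel borel cmod)"
    by (subst nn_integral_distr) auto
  also have "\<dots> = (\<integral>\<^sup>+ r \<in> {0..}. h r * ennreal (2 * pi * r) \<partial>lborel)"
    unfolding eq by (subst nn_integral_density) (auto intro!: nn_integral_cong simp: mult_ac)
  finally show ?thesis .
qed

text \<open>In polar coordinates and after the substitution t = s r, this is the Gamma integral of t
  exp(- t), whose value is 1.\<close>

lemma nn_integral_exp_norm_finite: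
  assumes "s > 0"
  shows "(\<integral>\<^sup>+(u::complex). ennreal (exp (- s * cmod u)) \<partial>lborel) < \<infinity>"
proof -
  have "(\<integral>\<^sup>+(u::complex). ennreal (exp (- s * cmod u)) \<partial>lborel)
     = (\<integral>\<^sup>+ r \<in> {0..}. ennreal (exp (- s * r)) * ennreal (2 * pi * r) \<partial>lborel)"
    by (rule nn_integral_radial[of "\<lambda>r. ennreal (exp (- s * r))"]) simp
  also have "\<dots> = (\<integral>\<^sup>+ r. ennreal (2 * pi / s) *
      (ennreal ((s * r) ^ 1 * exp (- (s * r))) * indicator {0..} (0 + s * r)) \<partial>lborel)"
    using assms by (intro nn_integral_cong)
      (auto simp: indicator_def ennreal_mult'[symmetric] zero_le_mult_iff field_simps split: if_splits)
  also have "\<dots> = ennreal (2 * pi / s) * (\<integral>\<^sup>+ r.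
      (ennreal ((0 + s * r) ^ 1 * exp (- (0 + s * r))) * indicator {0..} (0 + s * r)) \<partial>lborel)"
    by (subst nn_integral_cmult) auto
  also have "(\<integral>\<^sup>+ r. (ennreal ((0 + s * r) ^ 1 * exp (- (0 + s * r))) * indicator {0..} (0 + s * r)) \<partial>lborel)
      \<le> ennreal (1 / s)"
  proof -
    have "ennreal \<bar>s\<bar> * (\<integral>\<^sup>+ r. (ennreal ((0 + s * r) ^ 1 * exp (- (0 + s * r))) * indicator {0..} (0 + s * r)) \<partial>lborel) = 1"
      using nn_intergal_power_times_exp_Ici[of 1] assms
      by (subst nn_integral_real_affine[symmetric]) auto
    then show ?thesis
      by (smt (verit, best) assms divide_ennreal ennreal_1 ennreal_eq_0_iff
          ennreal_mult_divide_eq ennreal_neq_top mult.commute order_refl zero_less_one_class.zero_le_one)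
  qed
  finally show ?thesis
    by (metis (no_types, lifting) ennreal_mult_less_top ennreal_less_top infinity_ennreal_def le_less_trans mult_left_mono zero_le)
qed

section \<open>Mean value inequalities\<close>

lemma sets_borel_ball [measurable]: "ball (a :: 'a :: metric_space) r \<in> sets borel"
  by simp

section \<open>Mean values of entire functions and of powers of their modulus\<close>

text \<open>Cauchy's formula on the unit circle, applied to u \<mapsto> g (u w). Putting w into the
  function instead of the contour covers all radii at once, including w = 0.\<close>

lemma circle_mean:
  assumes g: "g holomorphic_on UNIV"
  shows "((\<lambda>x. g (cis (2 * pi * x) * w)) has_integral g 0) {0..1}"
proof -
  define G where "G = (\<lambda>u. g (u * w))"
  have "G holomorphic_on UNIV"
    unfolding G_def by (rule holomorphic_on_compose_gen[of "\<lambda>u. u * w" UNIV g UNIV, unfolded o_def]) (auto intro!: holomorphic_intros g)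
  then have "G holomorphic_on cball 0 1" by (rule holomorphic_on_subset) auto
  then have "((\<lambda>u. G u / (u - 0)) has_contour_integral (2 * of_real pi * \<i> * G 0)) (circlepath 0 1)"
    by (rule Cauchy_integral_circlepath_simple) auto
  then have "((\<lambda>x. G (circlepath 0 1 x) / (circlepath 0 1 x - 0) *
      vector_derivative (circlepath 0 1) (at x within {0..1})) has_integral (2 * of_real pi * \<i> * G 0)) {0..1}"
    by (simp add: has_contour_integral_def)
  then have "((\<lambda>x. (2 * of_real pi * \<i>) * g (cis (2 * pi * x) * w)) has_integral (2 * of_real pi * \<i> * G 0)) {0..1}"
  proof (rule has_integral_eq[rotated])
    fix x :: real assume "x \<in> {0..1}"
    then have vd: "vector_derivative (circlepath 0 1) (at x within {0..1}) =
        2 * of_real pi * \<i> * exp (2 * of_real pi * \<i> * of_real x)"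
      using vector_derivative_circlepath01[of x 0 1] by simp
    show "G (circlepath 0 1 x) / (circlepath 0 1 x - 0) * vector_derivative (circlepath 0 1) (at x within {0..1}) =
        2 * of_real pi * \<i> * g (cis (2 * pi * x) * w)"
      unfolding vd by (simp add: circlepath G_def cis_conv_exp mult_ac)
  qed
  then have "((\<lambda>x. inverse (2 * of_real pi * \<i>) * ((2 * of_real pi * \<i>) * g (cis (2 * pi * x) * w)))
       has_integral (inverse (2 * of_real pi * \<i>) * (2 * of_real pi * \<i> * G 0))) {0..1}"
    by (rule has_integral_mult_right)
  then show ?thesis
    by (simp add: G_def field_simps)
qed

lemma holomorphic_on_UNIV_shift:
  assumes "f holomorphic_on UNIV"
  shows "(\<lambda>u. f (a + u)) holomorphic_on UNIV"
  by (rule holomorphic_on_compose_gen[of "\<lambda>u. a + u" UNIV f UNIV, unfolded o_def])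
    (auto intro!: holomorphic_intros assms)

lemma borel_measurable_holomorphic_UNIV:
  "g holomorphic_on UNIV \<Longrightarrow> g \<in> borel_measurable (borel :: complex measure)"
  by (intro borel_measurable_continuous_onI holomorphic_on_imp_continuous_on)

text \<open>Averaging the left-hand side over all rotations turns \<open>g u\<close> into its circular mean.\<close>

lemma plane_mean:
  fixes g :: "complex \<Rightarrow> complex" and wt :: "real \<Rightarrow> real"
  assumes g: "g holomorphic_on UNIV" and wt [measurable]: "wt \<in> borel_measurable borel"
    and int: "integrable lborel (\<lambda>u. wt (cmod u) *\<^sub>R g u)"
    and int0: "integrable lborel (\<lambda>u::complex. wt (cmod u))"
  shows "(\<integral>u. wt (cmod u) *\<^sub>R g u \<partial>lborel) = (\<integral>(u::complex). wt (cmod u) \<partial>lborel) *\<^sub>R g 0"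
proof -
  note [measurable] = borel_measurable_holomorphic_UNIV[OF g]
  let ?h = "\<lambda>u. wt (cmod u) *\<^sub>R g u"
  define F where "F = (\<lambda>(x::real, u). indicator {0..1} x *\<^sub>R (wt (cmod u) *\<^sub>R g (cis (2 * pi * x) * u)))"
  have [measurable]: "(\<lambda>x. cis (2 * pi * x)) \<in> borel_measurable borel"
    by (intro borel_measurable_continuous_onI continuous_intros)
  have F [measurable]: "F \<in> borel_measurable (lborel \<Otimes>\<^sub>M lborel)"
    unfolding F_def by measurable
  have rot: "(\<integral>u. ?h (cis t * u) \<partial>lborel) = (\<integral>u. ?h u \<partial>lborel)" for t
    by (subst (2) distr_lborel_rotate[symmetric, of t]) (subst integral_distr, auto)
  have "(\<integral>\<^sup>+w. ennreal (norm (F w)) \<partial>(lborel \<Otimes>\<^sub>M lborel)) =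
      (\<integral>\<^sup>+x. \<integral>\<^sup>+u. ennreal (norm (F (x, u))) \<partial>lborel \<partial>lborel)"
    by (subst lborel.nn_integral_fst[symmetric]) auto
  also have "\<dots> = (\<integral>\<^sup>+x. indicator {0..1} x * (\<integral>\<^sup>+u. ennreal (norm (?h (cis (2 * pi * x) * u))) \<partial>lborel) \<partial>lborel)"
    by (intro nn_integral_cong, subst nn_integral_cmult[symmetric])
      (auto simp: F_def norm_mult indicator_def intro!: nn_integral_cong)
  also have "\<dots> = (\<integral>\<^sup>+(x::real). indicator {0..1} x * (\<integral>\<^sup>+u. ennreal (norm (?h u)) \<partial>lborel) \<partial>lborel)"
    by (subst nn_integral_rotate[of "\<lambda>u. ennreal (norm (?h u))"]) auto
  also have "\<dots> = (\<integral>\<^sup>+u. ennreal (norm (?h u)) \<partial>lborel)"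
    by (subst nn_integral_multc) auto
  also have "\<dots> < \<infinity>" using int by (simp add: integrable_iff_bounded)
  finally have Fint: "integrable (lborel \<Otimes>\<^sub>M lborel) F"
    by (intro integrableI_bounded F)
  have "(\<integral>x. (\<integral>u. F (x, u) \<partial>lborel) \<partial>lborel) = (\<integral>(x::real). indicator {0..1} x *\<^sub>R (\<integral>u. ?h u \<partial>lborel) \<partial>lborel)"
  proof (rule Bochner_Integration.integral_cong[OF refl])
    fix x :: real
    have "(\<integral>u. F (x, u) \<partial>lborel) = indicator {0..1} x *\<^sub>R (\<integral>u. ?h (cis (2 * pi * x) * u) \<partial>lborel)"
      unfolding F_def split by (simp only: integral_scaleR_right norm_mult norm_cis mult_1)
    then show "(\<integral>u. F (x, u) \<partial>lborel) = indicator {0..1} x *\<^sub>R (\<integral>u. ?h u \<partial>lborel)"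
      unfolding rot .
  qed
  also have "\<dots> = (\<integral>u. ?h u \<partial>lborel)" by simp
  finally have 1: "(\<integral>x. (\<integral>u. F (x, u) \<partial>lborel) \<partial>lborel) = (\<integral>u. ?h u \<partial>lborel)" .
  have "(\<integral>x. F (x, u) \<partial>lborel) = wt (cmod u) *\<^sub>R g 0" for u
  proof -
    have "set_integrable lborel {0..1} (\<lambda>x. g (cis (2 * pi * x) * u))"
      by (intro borel_integrable_atLeastAtMost' continuous_on_compose2[OF holomorphic_on_imp_continuous_on[OF g]])
        (auto intro!: continuous_intros)
    then have "(LINT x:{0..1}|lborel. g (cis (2 * pi * x) * u)) = integral {0..1} (\<lambda>x. g (cis (2 * pi * x) * u))"
      by (rule set_borel_integral_eq_integral)
    also have "\<dots> = g 0" by (rule integral_unique[OF circle_mean[OF g]])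
    finally have "(\<integral>x. indicator {0..1} x *\<^sub>R g (cis (2 * pi * x) * u) \<partial>lborel) = g 0"
      by (simp add: set_lebesgue_integral_def)
    then have "(\<integral>x. wt (cmod u) *\<^sub>R (indicator {0..1} x *\<^sub>R g (cis (2 * pi * x) * u)) \<partial>lborel) = wt (cmod u) *\<^sub>R g 0"
      by (metis integral_scaleR_right)
    then show ?thesis by (simp add: F_def mult_ac)
  qed
  then have "(\<integral>u. (\<integral>x. F (x, u) \<partial>lborel) \<partial>lborel) = (\<integral>(u::complex). wt (cmod u) \<partial>lborel) *\<^sub>R g 0"
    using int0 by simp
  moreover have "(\<integral>u. (\<integral>x. F (x, u) \<partial>lborel) \<partial>lborel) = (\<integral>x. (\<integral>u. F (x, u) \<partial>lborel) \<partial>lborel)"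
    using Fint by (intro lborel_pair.Fubini_integral) (simp add: case_prod_beta')
  ultimately show ?thesis using 1 by simp
qed

text \<open>The planar mean value formula with the indicator of a disc as radial weight. This is
  exponent 1, from which the smaller powers are derived.\<close>

lemma submean_disc:
  fixes g :: "complex \<Rightarrow> complex"
  assumes g: "g holomorphic_on UNIV" and r: "r > 0"
  shows "ennreal (pi * r\<^sup>2 * cmod (g a)) \<le> (\<integral>\<^sup>+ u \<in> ball a r. ennreal (cmod (g u)) \<partial>lborel)"
proof -
  define G where "G = (\<lambda>u. g (a + u))"
  have G: "G holomorphic_on UNIV"
    unfolding G_def by (rule holomorphic_on_UNIV_shift[OF g])
  note [measurable] = borel_measurable_holomorphic_UNIV[OF G] borel_measurable_holomorphic_UNIV[OF g]
  define wt :: "real \<Rightarrow> real" where "wt = indicator {..<r}"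
  have [measurable]: "wt \<in> borel_measurable borel" unfolding wt_def by measurable
  have "set_integrable lborel (cball 0 r) G"
    unfolding set_integrable_def
    by (intro borel_integrable_compact) (auto intro!: continuous_on_subset[OF holomorphic_on_imp_continuous_on[OF G]])
  then have int: "integrable lborel (\<lambda>u. wt (cmod u) *\<^sub>R G u)"
    unfolding set_integrable_def by (rule Bochner_Integration.integrable_bound) (auto simp: wt_def indicator_def)
  have ball: "(\<lambda>u::complex. wt (cmod u)) = indicator (ball 0 r)"
    by (auto simp: wt_def indicator_def fun_eq_iff)
  have int0: "integrable lborel (\<lambda>u::complex. wt (cmod u))"
    unfolding ball using r by (intro integrable_real_indicator) (auto simp: emeasure_ball)
  have I: "(\<integral>(u::complex). wt (cmod u) \<partial>lborel) = pi * r\<^sup>2"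
    unfolding ball using r by (simp add: content_ball unit_ball_vol_2)
  have "pi * r\<^sup>2 * cmod (g a) = cmod (\<integral>u. wt (cmod u) *\<^sub>R G u \<partial>lborel)"
    using plane_mean[OF G _ int int0] I r by (simp add: G_def norm_mult)
  also have "ennreal \<dots> \<le> (\<integral>\<^sup>+ u. ennreal (norm (wt (cmod u) *\<^sub>R G u)) \<partial>lborel)"
    by (rule integral_norm_bound_ennreal[OF int])
  also have "\<dots> = (\<integral>\<^sup>+ u. (\<lambda>v. ennreal (cmod (g v)) * indicator (ball a r) v) (a + u) \<partial>lborel)"
    by (intro nn_integral_cong) (auto simp: G_def wt_def indicator_def dist_norm)
  also have "\<dots> = (\<integral>\<^sup>+ u \<in> ball a r. ennreal (cmod (g u)) \<partial>lborel)"
    by (rule nn_integral_lborel_shift) (intro borel_measurable_times_ennreal borel_measurable_indicator, auto)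
  finally show ?thesis .
qed

text \<open>Maximise \<open>(1 - |z|)\<^sup>2\<^sup>/\<^sup>s |g z|\<close>; around a maximum point \<open>z\<^sub>0\<close>, the function \<open>|g|\<close> is at most
  a multiple of \<open>|g z\<^sub>0|\<close>, so that \<open>|g| \<le> |g|\<^sup>s (C |g z\<^sub>0|)\<^sup>1\<^sup>-\<^sup>s\<close> there.\<close>

lemma submean_powr:
  fixes g :: "complex \<Rightarrow> complex"
  assumes g: "g holomorphic_on UNIV" and s: "0 < s" "s \<le> 1"
  shows "ennreal (cmod (g 0) powr s) \<le> ennreal (2 powr (2 * (1 - s) / s) * 4 / pi) *
           (\<integral>\<^sup>+ u \<in> ball 0 1. ennreal (cmod (g u) powr s) \<partial>lborel)"
proof -
  note [measurable] = borel_measurable_holomorphic_UNIV[OF g]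
  \<comment> \<open>The exponent 2/s makes the s-th power of \<phi> carry the factor d^2, where d =
    1 - |z0|. The disc of radius d/2 used below has area of the same order, so d cancels from the
    final constant.\<close>
  define \<phi> where "\<phi> = (\<lambda>z. (1 - cmod z) powr (2 / s) * cmod (g z))"
  have "continuous_on (cball 0 1) \<phi>"
    unfolding \<phi>_def using s
    by (intro continuous_intros continuous_on_powr' continuous_on_subset[OF holomorphic_on_imp_continuous_on[OF g]]) auto
  then obtain z0 where z0: "cmod z0 \<le> 1" and max: "\<And>z. cmod z \<le> 1 \<Longrightarrow> \<phi> z \<le> \<phi> z0"
    using continuous_attains_sup[of "cball 0 1" \<phi>] by (auto simp: dist_norm)
  show ?thesis
  proof (cases "g 0 = 0")
    case False
    then have "\<phi> 0 > 0" by (simp add: \<phi>_def)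
    then have "\<phi> z0 > 0" using max[of 0] by simp
    then have gz0: "g z0 \<noteq> 0" and "1 - cmod z0 \<noteq> 0" by (auto simp: \<phi>_def)
    then have lt: "cmod z0 < 1" using z0 by simp
    define d where "d = 1 - cmod z0"
    have d: "0 < d" "d \<le> 1" using lt by (auto simp: d_def)
    \<comment> \<open>On the disc of radius d/2 about \<open>z0\<close> the distance to the unit
      circle is still at least d/2; this loss of a factor 2 becomes 2^(2/s).\<close>
    define G where "G = 2 powr (2 / s) * cmod (g z0)"
    have G: "G > 0" using gz0 by (simp add: G_def)
    have gu: "cmod (g u) \<le> G" "u \<in> ball 0 1" if u: "u \<in> ball z0 (d / 2)" for u
    proof -
      have "cmod u \<le> cmod z0 + cmod (z0 - u)" by (metis norm_triangle_sub norm_minus_commute)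
      then have u1: "d / 2 \<le> 1 - cmod u" using u by (auto simp: d_def dist_norm)
      then show "u \<in> ball 0 1" using d by simp
      have "(d / 2) powr (2 / s) * cmod (g u) \<le> \<phi> u"
        unfolding \<phi>_def using d s u1 by (intro mult_right_mono powr_mono2) auto
      also have "\<dots> \<le> d powr (2 / s) * cmod (g z0)"
        using max[of u] u1 d by (simp add: \<phi>_def d_def)
      also have "\<dots> = (d / 2) powr (2 / s) * G"
        using d by (simp add: G_def powr_divide)
      finally show "cmod (g u) \<le> G" using d by simp
    qed
    have le: "cmod (g u) \<le> G powr (1 - s) * cmod (g u) powr s" if "u \<in> ball z0 (d / 2)" for u
    proof (cases "g u = 0")
      case False
      then have "cmod (g u) = cmod (g u) powr (1 - s) * cmod (g u) powr s"
        by (simp add: powr_add[symmetric])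
      also have "\<dots> \<le> G powr (1 - s) * cmod (g u) powr s"
        using gu[OF that] s by (intro mult_right_mono powr_mono2) auto
      finally show ?thesis .
    qed simp
    define I where "I = (\<integral>\<^sup>+ u \<in> ball 0 1. ennreal (cmod (g u) powr s) \<partial>lborel)"
    have "ennreal (pi * (d / 2)\<^sup>2 * cmod (g z0)) \<le> (\<integral>\<^sup>+ u \<in> ball z0 (d / 2). ennreal (cmod (g u)) \<partial>lborel)"
      using d by (intro submean_disc g) auto
    also have "\<dots> \<le> (\<integral>\<^sup>+ u. ennreal (G powr (1 - s)) * (ennreal (cmod (g u) powr s) * indicator (ball 0 1) u) \<partial>lborel)"
    proof (rule nn_integral_mono)
      fix u
      show "ennreal (cmod (g u)) * indicator (ball z0 (d / 2)) u \<le>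
        ennreal (G powr (1 - s)) * (ennreal (cmod (g u) powr s) * indicator (ball 0 1) u)"
        using le[of u] gu(2)[of u]
        by (cases "u \<in> ball z0 (d / 2)") (auto simp: ennreal_mult[symmetric] intro!: ennreal_leI)
    qed
    also have "\<dots> = ennreal (G powr (1 - s)) * I"
      unfolding I_def by (rule nn_integral_cmult) simp
    finally have A: "ennreal (pi * (d / 2)\<^sup>2 * cmod (g z0)) \<le> ennreal (G powr (1 - s)) * I" .
    show ?thesis
    proof (cases "I = \<infinity>")
      case True
      then show ?thesis by (simp add: I_def ennreal_mult_top)
    next
      case False
      then obtain i where i: "I = ennreal i" "i \<ge> 0" by (cases I) auto
      have "pi * (d / 2)\<^sup>2 * cmod (g z0) \<le> G powr (1 - s) * i"
        using A i by (simp add: ennreal_mult[symmetric])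
      also have "G powr (1 - s) = 2 powr (2 * (1 - s) / s) * cmod (g z0) powr (1 - s)"
        by (simp add: G_def powr_mult powr_powr)
      finally have "cmod (g z0) powr (1 - s) * (pi * (d / 2)\<^sup>2 * cmod (g z0) powr s) \<le>
           cmod (g z0) powr (1 - s) * (2 powr (2 * (1 - s) / s) * i)"
        using gz0 by (simp add: powr_diff field_simps)
      then have *: "pi * (d / 2)\<^sup>2 * cmod (g z0) powr s \<le> 2 powr (2 * (1 - s) / s) * i"
        using gz0 by simp
      have "cmod (g 0) powr s = \<phi> 0 powr s" by (simp add: \<phi>_def)
      also have "\<dots> \<le> \<phi> z0 powr s"
        using s max[of 0] by (intro powr_mono2) (auto simp: \<phi>_def)
      also have "\<dots> = d\<^sup>2 * cmod (g z0) powr s"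
        using d s by (simp add: \<phi>_def d_def[symmetric] powr_mult powr_powr)
      also have "\<dots> \<le> 2 powr (2 * (1 - s) / s) * 4 / pi * i"
        using * by (simp add: field_simps power2_eq_square)
      finally show ?thesis
        unfolding I_def[symmetric] i(1) using i(2) by (simp add: ennreal_mult[symmetric])
    qed
  qed simp
qed

section \<open>The weighted modulus and its mean value inequality\<close>

definition fock_mod :: "real \<Rightarrow> (complex \<Rightarrow> complex) \<Rightarrow> complex \<Rightarrow> real" where
  "fock_mod \<alpha> f z = cmod (f z) * exp (- (\<alpha> / 2) * (cmod z)\<^sup>2)"

definition kern :: "real \<Rightarrow> (complex \<Rightarrow> ennreal) \<Rightarrow> complex \<Rightarrow> ennreal" where
  "kern s b z = (\<integral>\<^sup>+ u. b u * ennreal (exp (- s * cmod (z - u))) \<partial>lborel)"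

lemma fock_mod_nonneg [simp]: "fock_mod \<alpha> f z \<ge> 0"
  by (simp add: fock_mod_def)

lemma borel_measurable_fock_mod [measurable]:
  assumes [measurable]: "f \<in> borel_measurable borel"
  shows "fock_mod \<alpha> f \<in> borel_measurable borel"
  unfolding fock_mod_def[abs_def] by (intro borel_measurable_times) simp_all

lemma cmod_add_squared: "(cmod (v + x))\<^sup>2 = (cmod v)\<^sup>2 + 2 * Re (cnj v * x) + (cmod x)\<^sup>2"
  unfolding cmod_power2 by (simp add: power2_eq_square algebra_simps)

text \<open>The Weyl translation: the exponential cancels the cross term of |v + x|^2. Up to a
  constant depending on v, the weighted modulus near v is then the modulus of an entire function
  near 0 times a Gaussian in x, so estimates at the origin hold at every v with the same
  constants.\<close>

lemma fock_mod_translate: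
  "cmod (f (v + x) * exp (- of_real \<alpha> * cnj v * x)) =
     fock_mod \<alpha> f (v + x) * exp (\<alpha> / 2 * ((cmod v)\<^sup>2 + (cmod x)\<^sup>2))"
proof -
  have "exp (- (\<alpha> / 2) * (cmod (v + x))\<^sup>2) * exp (\<alpha> / 2 * ((cmod v)\<^sup>2 + (cmod x)\<^sup>2)) =
      exp (Re (- of_real \<alpha> * cnj v * x))"
    unfolding cmod_add_squared exp_add[symmetric] by (simp add: algebra_simps)
  then show ?thesis by (simp add: fock_mod_def norm_mult mult.assoc)
qed

text \<open>After translation to the origin both sides carry the factor exp(\<alpha> s |v|^2 / 2),
  which cancels. The constant exp(\<alpha> s / 2) bounds the remaining Gaussian factor on the unit
  disc.\<close>

lemma fock_mod_submean:
  assumes f: "f holomorphic_on UNIV" and s: "0 < s" "s \<le> 1" and \<alpha>: "\<alpha> > 0"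
  shows "ennreal (fock_mod \<alpha> f v powr s) \<le> ennreal (2 powr (2 * (1 - s) / s) * 4 / pi * exp (\<alpha> * s / 2)) *
           (\<integral>\<^sup>+ u \<in> ball v 1. ennreal (fock_mod \<alpha> f u powr s) \<partial>lborel)"
proof -
  let ?I = "(\<integral>\<^sup>+ u \<in> ball v 1. ennreal (fock_mod \<alpha> f u powr s) \<partial>lborel)"
  note [measurable] = borel_measurable_holomorphic_UNIV[OF f]
  define g where "g = (\<lambda>x. f (v + x) * exp (- of_real \<alpha> * cnj v * x))"
  define c where "c = 2 powr (2 * (1 - s) / s) * 4 / pi"
  define e where "e = exp (\<alpha> * s / 2 * (cmod v)\<^sup>2)"
  have e0: "0 \<le> e" and c0: "0 \<le> c" by (simp_all add: e_def c_def)
  have "(\<lambda>x. f (v + x)) holomorphic_on UNIV"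
    by (rule holomorphic_on_UNIV_shift[OF f])
  then have g: "g holomorphic_on UNIV" unfolding g_def by (intro holomorphic_intros)
  have gx: "cmod (g x) powr s = fock_mod \<alpha> f (v + x) powr s * (e * exp (\<alpha> * s / 2 * (cmod x)\<^sup>2))" for x
    unfolding g_def fock_mod_translate e_def
    by (simp add: powr_mult exp_powr_real exp_add[symmetric] algebra_simps)
  have "ennreal (e * fock_mod \<alpha> f v powr s) = ennreal (cmod (g 0) powr s)"
    using gx[of 0] by (simp add: mult_ac)
  also have "\<dots> \<le> ennreal c * (\<integral>\<^sup>+ u \<in> ball 0 1. ennreal (cmod (g u) powr s) \<partial>lborel)"
    unfolding c_def by (rule submean_powr[OF g s])
  also have "(\<integral>\<^sup>+ u \<in> ball 0 1. ennreal (cmod (g u) powr s) \<partial>lborel) \<le>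
     (\<integral>\<^sup>+ u. ennreal (e * exp (\<alpha> * s / 2)) * (ennreal (fock_mod \<alpha> f (v + u) powr s) * indicator (ball v 1) (v + u)) \<partial>lborel)"
  proof (rule nn_integral_mono)
    fix u
    have "e * exp (\<alpha> * s / 2 * (cmod u)\<^sup>2) \<le> e * exp (\<alpha> * s / 2)" if "cmod u < 1"
      using that s \<alpha> by (auto simp: e_def abs_square_le_1 mult_le_cancel_left1)
    then have "fock_mod \<alpha> f (v + u) powr s * (e * exp (\<alpha> * s / 2 * (cmod u)\<^sup>2)) \<le>
       (e * exp (\<alpha> * s / 2)) * fock_mod \<alpha> f (v + u) powr s" if "cmod u < 1"
      using that by (metis mult.commute mult_left_mono powr_ge_zero)
    then show "ennreal (cmod (g u) powr s) * indicator (ball 0 1) u \<le>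
      ennreal (e * exp (\<alpha> * s / 2)) * (ennreal (fock_mod \<alpha> f (v + u) powr s) * indicator (ball v 1) (v + u))"
      by (auto simp: indicator_def gx dist_norm e_def ennreal_mult'[symmetric] intro!: ennreal_leI)
  qed
  also have "\<dots> = ennreal (e * exp (\<alpha> * s / 2)) * (\<integral>\<^sup>+ u. (ennreal (fock_mod \<alpha> f (v + u) powr s) * indicator (ball v 1) (v + u)) \<partial>lborel)"
    by (rule nn_integral_cmult) simp
  also have "(\<integral>\<^sup>+ u. (ennreal (fock_mod \<alpha> f (v + u) powr s) * indicator (ball v 1) (v + u)) \<partial>lborel) =
     ?I"
    by (rule nn_integral_lborel_shift[of "\<lambda>u. ennreal (fock_mod \<alpha> f u powr s) * indicator (ball v 1) u"]) simp
  also have "ennreal c * (ennreal (e * exp (\<alpha> * s / 2)) * ?I)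
     = ennreal e * (ennreal (c * exp (\<alpha> * s / 2)) * ?I)"
    by (simp add: e0 c0 ennreal_mult mult_ac)
  finally have le: "ennreal e * ennreal (fock_mod \<alpha> f v powr s) \<le>
      ennreal e * (ennreal (c * exp (\<alpha> * s / 2)) * ?I)"
    by (simp add: ennreal_mult' mult_left_mono e0)
  have e: "ennreal e \<noteq> 0" "ennreal e \<noteq> top" by (simp_all add: e_def)
  show ?thesis
    using ennreal_mult_le_mult_iff[THEN iffD1, OF e le] unfolding c_def .
qed

text \<open>On the unit disc about v the weights exp(- s |z - u|) and exp(- s |z - v|) differ by at
  most exp s. Since v is arbitrary, this bounds f in the whole plane by one value of
  \<open>kern\<close> at z and so provides the admissible A for the base point z.\<close>

lemma kern_growth:
  assumes f: "f holomorphic_on UNIV" and s: "0 < s" "s \<le> 1" and \<alpha>: "\<alpha> > 0"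
  defines "C \<equiv> 2 powr (2 * (1 - s) / s) * 4 / pi * exp (\<alpha> * s / 2) * exp s"
  shows "ennreal ((fock_mod \<alpha> f v * exp (- cmod (z - v))) powr s) \<le>
           ennreal C * kern s (\<lambda>u. ennreal (fock_mod \<alpha> f u powr s)) z"
proof -
  note [measurable] = borel_measurable_holomorphic_UNIV[OF f]
  define c where "c = 2 powr (2 * (1 - s) / s) * 4 / pi * exp (\<alpha> * s / 2)"
  have c: "c \<ge> 0" by (simp add: c_def)
  define k where "k = exp (- s * cmod (z - v))"
  have "ennreal ((fock_mod \<alpha> f v * exp (- cmod (z - v))) powr s) = ennreal k * ennreal (fock_mod \<alpha> f v powr s)"
    by (simp add: powr_mult exp_powr_real ennreal_mult' k_def mult_ac)
  also have "\<dots> \<le> ennreal k * (ennreal c * (\<integral>\<^sup>+ u \<in> ball v 1. ennreal (fock_mod \<alpha> f u powr s) \<partial>lborel))"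
    unfolding c_def by (intro mult_left_mono fock_mod_submean f s \<alpha>) simp
  also have "\<dots> = ennreal c * (\<integral>\<^sup>+ u. ennreal k * (ennreal (fock_mod \<alpha> f u powr s) * indicator (ball v 1) u) \<partial>lborel)"
    by (subst nn_integral_cmult) (auto simp: mult_ac)
  also have "(\<integral>\<^sup>+ u. ennreal k * (ennreal (fock_mod \<alpha> f u powr s) * indicator (ball v 1) u) \<partial>lborel) \<le>
      (\<integral>\<^sup>+ u. ennreal (exp s) * (ennreal (fock_mod \<alpha> f u powr s) * ennreal (exp (- s * cmod (z - u)))) \<partial>lborel)"
  proof (rule nn_integral_mono)
    fix u
    have "k \<le> exp s * exp (- s * cmod (z - u))" if "u \<in> ball v 1"
    proof -
      have "cmod (z - u) \<le> cmod (z - v) + cmod (v - u)" using dist_triangle[of z u v] by (simp add: dist_norm)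
      then have "cmod (z - u) \<le> cmod (z - v) + 1" using that by (simp add: dist_norm)
      then have "s * cmod (z - u) \<le> s * cmod (z - v) + s"
        using s by (metis distrib_left less_imp_le mult.right_neutral mult_left_mono)
      then show ?thesis by (simp add: k_def exp_add[symmetric])
    qed
    then have "fock_mod \<alpha> f u powr s * k \<le> fock_mod \<alpha> f u powr s * (exp s * exp (- s * cmod (z - u)))" if "u \<in> ball v 1"
      using that by (intro mult_left_mono) auto
    then show "ennreal k * (ennreal (fock_mod \<alpha> f u powr s) * indicator (ball v 1) u) \<le>
       ennreal (exp s) * (ennreal (fock_mod \<alpha> f u powr s) * ennreal (exp (- s * cmod (z - u))))"
      by (cases "u \<in> ball v 1") (auto simp: k_def ennreal_mult'[symmetric] mult_ac intro!: ennreal_leI)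
  qed
  also have "\<dots> = ennreal (exp s) * kern s (\<lambda>u. ennreal (fock_mod \<alpha> f u powr s)) z"
    unfolding kern_def by (rule nn_integral_cmult) simp
  finally show ?thesis
    using c unfolding C_def c_def[symmetric] by (simp add: ennreal_mult mult_left_mono mult.assoc)
qed

section \<open>Jensen and Minkowski inequalities\<close>

lemma epowr_ennreal [simp]: "0 \<le> x \<Longrightarrow> epowr (ennreal x) a = ennreal (x powr a)"
  by (simp add: epowr_def)

lemma epowr_top [simp]: "epowr top a = top"
  by (simp add: epowr_def)

lemma epowr_0 [simp]: "epowr 0 a = 0"
  by (simp add: epowr_def)

lemma epowr_1 [simp]: "epowr 1 a = 1"
  by (simp add: epowr_def)

lemma epowr_one [simp]: "epowr x 1 = x"
  by (cases x) auto

lemma epowr_mono: "x \<le> y \<Longrightarrow> 0 \<le> a \<Longrightarrow> epowr x a \<le> epowr y a"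
  by (cases x; cases y) (auto simp: top_unique intro!: ennreal_leI powr_mono2)

lemma epowr_mult: "0 < a \<Longrightarrow> epowr (x * y) a = epowr x a * epowr y a"
proof (cases x; cases y)
  assume "0 < a" "x = top" "y = top" then show ?thesis by (simp add: ennreal_top_mult)
next
  fix r assume "0 < a" "0 \<le> r" "x = ennreal r" "y = top"
  then show ?thesis by (cases "r = 0") (auto simp: ennreal_mult_top)
next
  fix r assume "0 < a" "0 \<le> r" "y = ennreal r" "x = top"
  then show ?thesis by (cases "r = 0") (auto simp: ennreal_top_mult)
qed (auto simp: ennreal_mult[symmetric] powr_mult)

lemma epowr_epowr: "epowr (epowr x a) b = epowr x (a * b)"
  by (cases x) (auto simp: powr_powr)

lemma epowr_inverse: "a \<noteq> 0 \<Longrightarrow> epowr (epowr x a) (1 / a) = x" "a \<noteq> 0 \<Longrightarrow> epowr (epowr x (1 / a)) a = x"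
  by (simp_all add: epowr_epowr)

lemma epowr_le_iff: "0 < a \<Longrightarrow> epowr x a \<le> epowr y a \<longleftrightarrow> x \<le> y"
  by (metis epowr_inverse(1) epowr_mono less_imp_le less_numeral_extra(3) zero_le_divide_1_iff)

lemma epowr_le_swap: "0 < a \<Longrightarrow> x \<le> epowr y (1 / a) \<longleftrightarrow> epowr x a \<le> y"
  by (metis epowr_inverse(2) epowr_le_iff less_numeral_extra(3))

lemma epowr_le_swap': "0 < a \<Longrightarrow> epowr x (1 / a) \<le> y \<longleftrightarrow> x \<le> epowr y a"
  by (metis epowr_inverse(2) epowr_le_iff less_numeral_extra(3))

lemma epowr_eq_top [simp]: "epowr x a = top \<longleftrightarrow> x = top"
  by (cases x) auto

lemma epowr_less_top [simp]: "epowr x a < top \<longleftrightarrow> x < top"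
  by (simp add: less_top[symmetric])

lemma borel_measurable_epowr [measurable (raw)]:
  assumes [measurable]: "f \<in> borel_measurable M"
  shows "(\<lambda>x. epowr (f x) a) \<in> borel_measurable M"
  unfolding epowr_def by measurable

text \<open>The tangent to the convex function x^P at t, solved for x. It bounds x by an affine
  function of x^P with a free point of contact, so integral inequalities follow by integrating it
  and choosing t.\<close>

lemma young_tangent:
  fixes x t P :: real
  assumes "P \<ge> 1" "x \<ge> 0" "t > 0"
  shows "x \<le> (1 - 1 / P) * t + 1 / P * t powr (1 - P) * x powr P"
proof (cases "x = 0")
  case False
  then have "(t powr (1 - P) * x powr P) powr (1 / P) * t powr (1 - 1 / P) \<le>
     1 / P * (t powr (1 - P) * x powr P) + (1 - 1 / P) * t"
    using assms by (intro Youngs_inequality_0) auto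
  also have "(t powr (1 - P) * x powr P) powr (1 / P) * t powr (1 - 1 / P) =
      x * (t powr ((1 - P) / P) * t powr (1 - 1 / P))"
    using assms False by (simp add: powr_mult powr_powr)
  also have "t powr ((1 - P) / P) * t powr (1 - 1 / P) = 1"
    using assms by (simp add: powr_add[symmetric] diff_divide_distrib)
  finally show ?thesis by simp
qed (use assms in auto)

text \<open>The measure with density k has mass at most A, not necessarily 1, so the tangent
  inequality is integrated directly and no normalisation by the exact mass occurs.\<close>

lemma jensen_powr:
  fixes k g :: "'a \<Rightarrow> ennreal"
  assumes [measurable]: "k \<in> borel_measurable M" "g \<in> borel_measurable M"
    and P: "P \<ge> 1" and A: "A > 0" and k: "(\<integral>\<^sup>+x. k x \<partial>M) \<le> ennreal A"
  shows "epowr (\<integral>\<^sup>+x. k x * g x \<partial>M) P \<le> ennreal (A powr (P - 1)) * (\<integral>\<^sup>+x. k x * epowr (g x) P \<partial>M)"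
proof (cases "(\<integral>\<^sup>+x. k x * epowr (g x) P \<partial>M)")
  case top
  then show ?thesis using A by (simp add: ennreal_mult_top)
next
  case (real B)
  define I where "I = (\<integral>\<^sup>+x. k x * g x \<partial>M)"
  have main: "epowr I P \<le> ennreal (A powr (P - 1) * (B + e))" if e: "e > 0" for e
  proof -
    \<comment> \<open>The P-mean of g against mass A, where the two terms of the tangent inequality
      add up to t A. The e keeps t positive when B = 0 and is removed at the end.\<close>
    define t where "t = ((B + e) / A) powr (1 / P)"
    have t: "t > 0" using A e real by (simp add: t_def)
    have pt: "g x \<le> ennreal ((1 - 1 / P) * t) + ennreal (1 / P * t powr (1 - P)) * epowr (g x) P" for x
    proof (cases "g x")
      case (real y)
      then show ?thesis
        using young_tangent[OF P real(1) t] P t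
        by (simp add: ennreal_mult[symmetric] ennreal_plus[symmetric] del: ennreal_plus)
    next
      case top
      then show ?thesis using P t by (simp add: ennreal_mult_top)
    qed
    have "I \<le> (\<integral>\<^sup>+x. ennreal ((1 - 1 / P) * t) * k x + ennreal (1 / P * t powr (1 - P)) * (k x * epowr (g x) P) \<partial>M)"
      unfolding I_def
    proof (rule nn_integral_mono)
      fix x
      have "k x * g x \<le> k x * (ennreal ((1 - 1 / P) * t) + ennreal (1 / P * t powr (1 - P)) * epowr (g x) P)"
        by (rule mult_left_mono[OF pt]) simp
      then show "k x * g x \<le> ennreal ((1 - 1 / P) * t) * k x + ennreal (1 / P * t powr (1 - P)) * (k x * epowr (g x) P)"
        by (simp add: distrib_left mult_ac)
    qed
    also have "\<dots> = ennreal ((1 - 1 / P) * t) * (\<integral>\<^sup>+x. k x \<partial>M) +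
        ennreal (1 / P * t powr (1 - P)) * (\<integral>\<^sup>+x. k x * epowr (g x) P \<partial>M)"
      by (subst nn_integral_add) (auto simp: nn_integral_cmult)
    also have "\<dots> \<le> ennreal ((1 - 1 / P) * t) * ennreal A + ennreal (1 / P * t powr (1 - P)) * ennreal (B + e)"
      using real e by (intro add_mono mult_left_mono k) (auto intro: ennreal_leI)
    also have "\<dots> = ennreal ((1 - 1 / P) * t * A + 1 / P * t powr (1 - P) * (B + e))"
      using P t A real e by (simp add: ennreal_mult[symmetric] ennreal_plus[symmetric] del: ennreal_plus)
    also have "(1 - 1 / P) * t * A + 1 / P * t powr (1 - P) * (B + e) = t * A"
    proof -
      have "t powr P = (B + e) / A" using P A real e by (simp add: t_def powr_powr)
      then have "B + e = A * t powr P" using A by simp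
      then have "t powr (1 - P) * (B + e) = t * A"
        using t by (simp add: powr_diff)
      then show ?thesis by (simp add: algebra_simps)
    qed
    finally have "I \<le> ennreal (t * A)" .
    then have "epowr I P \<le> epowr (ennreal (t * A)) P" using P by (intro epowr_mono) auto
    also have "\<dots> = ennreal ((t * A) powr P)" using t A by simp
    also have "(t * A) powr P = A powr (P - 1) * (B + e)"
      using P A real e by (simp add: t_def powr_mult powr_powr powr_diff)
    finally show ?thesis .
  qed
  show ?thesis
    unfolding I_def[symmetric] real(2)
  proof (rule ennreal_le_epsilon)
    fix e :: real assume e: "e > 0"
    define d where "d = e / A powr (P - 1)"
    have d: "d > 0" using e A by (simp add: d_def)
    have "epowr I P \<le> ennreal (A powr (P - 1) * (B + d))" by (rule main[OF d])
    also have "A powr (P - 1) * (B + d) = A powr (P - 1) * B + e" using A by (simp add: d_def field_simps)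
    finally show "epowr I P \<le> ennreal (A powr (P - 1)) * ennreal B + ennreal e"
      using A e real by (simp add: ennreal_mult ennreal_plus)
  qed
qed

text \<open>Minkowski's integral inequality, for a known bound \<open>H t\<close> of the norm of \<open>g (\<sqdot>, t)\<close>: apply
  Jensen's inequality with the weight \<open>k (H + e)\<close> to \<open>g / (H + e)\<close>.\<close>

lemma minkowski_integral:
  fixes k :: "'b \<Rightarrow> ennreal" and g :: "'a \<Rightarrow> 'b \<Rightarrow> ennreal" and H :: "'b \<Rightarrow> real"
  assumes sf: "sigma_finite_measure M" "sigma_finite_measure N"
    and [measurable]: "k \<in> borel_measurable N" "(\<lambda>(x, t). g x t) \<in> borel_measurable (M \<Otimes>\<^sub>M N)"
      "H \<in> borel_measurable N"
    and P: "P \<ge> 1" and H: "\<And>t. H t \<ge> 0" and c: "c > 0"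
    and k: "(\<integral>\<^sup>+t. k t \<partial>N) < \<infinity>"
    and le: "\<And>t. (\<integral>\<^sup>+x. epowr (g x t) P \<partial>M) \<le> ennreal (c * H t powr P)"
  shows "(\<integral>\<^sup>+x. epowr (\<integral>\<^sup>+t. k t * g x t \<partial>N) P \<partial>M) \<le> ennreal c * epowr (\<integral>\<^sup>+t. k t * ennreal (H t) \<partial>N) P"
proof -
  interpret M: sigma_finite_measure M by fact
  interpret N: sigma_finite_measure N by fact
  interpret MN: pair_sigma_finite M N ..
  let ?L = "(\<integral>\<^sup>+x. epowr (\<integral>\<^sup>+t. k t * g x t \<partial>N) P \<partial>M)"
  define A where "A = (\<integral>\<^sup>+t. k t * ennreal (H t) \<partial>N)"
  obtain K where K: "(\<integral>\<^sup>+t. k t \<partial>N) = ennreal K" "K \<ge> 0" using k by (cases "\<integral>\<^sup>+t. k t \<partial>N") auto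
  have gx: "(\<lambda>t. g x t) \<in> borel_measurable N" if "x \<in> space M" for x
    using measurable_Pair2[OF assms(4) that] by simp
  show ?thesis
  proof (cases A)
    case top
    then show ?thesis unfolding A_def[symmetric] using c by (simp add: ennreal_mult_top)
  next
    case (real a)
    have main: "?L \<le> ennreal (c * (a + e * (K + 1)) powr P)"
      if e: "e > 0" for e
    proof -
      define H' where "H' = (\<lambda>t. H t + e)"
      have [measurable]: "H' \<in> borel_measurable N" unfolding H'_def by measurable
      have H': "H' t > 0" "H t \<le> H' t" for t using H[of t] e by (auto simp: H'_def)
      \<comment> \<open>The term e K is the contribution of the added e; the further e keeps A'
        positive even if a and K vanish.\<close>
      define A' where "A' = a + e * (K + 1)"
      have A': "A' > 0" using real e K by (simp add: A'_def add_nonneg_pos)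
      have "(\<integral>\<^sup>+t. k t * ennreal (H' t) \<partial>N) = A + (\<integral>\<^sup>+t. ennreal e * k t \<partial>N)"
        unfolding A_def H'_def using H e
        by (subst nn_integral_add[symmetric]) (auto simp: distrib_left mult_ac)
      also have "\<dots> = ennreal (a + e * K)"
        using K real e by (simp add: nn_integral_cmult ennreal_mult ennreal_plus)
      also have "\<dots> \<le> ennreal A'" using e by (intro ennreal_leI) (simp add: A'_def)
      finally have kH': "(\<integral>\<^sup>+t. k t * ennreal (H' t) \<partial>N) \<le> ennreal A'" .
      have J: "epowr (\<integral>\<^sup>+t. k t * g x t \<partial>N) P \<le>
          ennreal (A' powr (P - 1)) * (\<integral>\<^sup>+t. (k t * ennreal (H' t powr (1 - P))) * epowr (g x t) P \<partial>N)"
        if x: "x \<in> space M" for x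
      proof -
        note [measurable] = gx[OF x]
        have "(\<integral>\<^sup>+t. k t * g x t \<partial>N) = (\<integral>\<^sup>+t. (k t * ennreal (H' t)) * (ennreal (1 / H' t) * g x t) \<partial>N)"
        proof (rule nn_integral_cong)
          fix t
          have "ennreal (H' t) * ennreal (1 / H' t) = 1" using H'(1)[of t] by (simp add: ennreal_mult[symmetric])
          then show "k t * g x t = (k t * ennreal (H' t)) * (ennreal (1 / H' t) * g x t)"
            by (metis mult.assoc mult.left_neutral)
        qed
        then have "epowr (\<integral>\<^sup>+t. k t * g x t \<partial>N) P \<le> ennreal (A' powr (P - 1)) *
            (\<integral>\<^sup>+t. (k t * ennreal (H' t)) * epowr (ennreal (1 / H' t) * g x t) P \<partial>N)"
          by (simp only:, intro jensen_powr P A' kH') measurable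
        also have "(\<integral>\<^sup>+t. (k t * ennreal (H' t)) * epowr (ennreal (1 / H' t) * g x t) P \<partial>N) =
            (\<integral>\<^sup>+t. (k t * ennreal (H' t powr (1 - P))) * epowr (g x t) P \<partial>N)"
        proof (rule nn_integral_cong)
          fix t
          have "epowr (ennreal (1 / H' t) * g x t) P = ennreal ((1 / H' t) powr P) * epowr (g x t) P"
            using P H'(1)[of t] by (simp add: epowr_mult)
          moreover have "ennreal (H' t) * ennreal ((1 / H' t) powr P) = ennreal (H' t powr (1 - P))"
            using H'(1)[of t] by (simp add: ennreal_mult[symmetric] powr_divide powr_diff)
          ultimately show "(k t * ennreal (H' t)) * epowr (ennreal (1 / H' t) * g x t) P =
              (k t * ennreal (H' t powr (1 - P))) * epowr (g x t) P"
            by (metis mult.assoc)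
        qed
        finally show ?thesis .
      qed
      have "?L \<le>
          (\<integral>\<^sup>+x. ennreal (A' powr (P - 1)) * (\<integral>\<^sup>+t. (k t * ennreal (H' t powr (1 - P))) * epowr (g x t) P \<partial>N) \<partial>M)"
        by (rule nn_integral_mono) (rule J)
      also have "\<dots> = ennreal (A' powr (P - 1)) *
          (\<integral>\<^sup>+x. (\<integral>\<^sup>+t. (k t * ennreal (H' t powr (1 - P))) * epowr (g x t) P \<partial>N) \<partial>M)"
        by (subst nn_integral_cmult) auto
      also have "(\<integral>\<^sup>+x. (\<integral>\<^sup>+t. (k t * ennreal (H' t powr (1 - P))) * epowr (g x t) P \<partial>N) \<partial>M) =
          (\<integral>\<^sup>+t. (\<integral>\<^sup>+x. (k t * ennreal (H' t powr (1 - P))) * epowr (g x t) P \<partial>M) \<partial>N)"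
        by (rule MN.Fubini'[symmetric]) measurable
      also have "\<dots> \<le> (\<integral>\<^sup>+t. ennreal c * (k t * ennreal (H' t)) \<partial>N)"
      proof (rule nn_integral_mono)
        fix t assume t: "t \<in> space N"
        have [measurable]: "(\<lambda>x. g x t) \<in> borel_measurable M"
          using measurable_Pair1[OF assms(4) t] by simp
        have "(\<integral>\<^sup>+x. (k t * ennreal (H' t powr (1 - P))) * epowr (g x t) P \<partial>M) =
           (k t * ennreal (H' t powr (1 - P))) * (\<integral>\<^sup>+x. epowr (g x t) P \<partial>M)"
          by (rule nn_integral_cmult) measurable
        also have "\<dots> \<le> (k t * ennreal (H' t powr (1 - P))) * ennreal (c * H' t powr P)"
          using P H H' c by (intro mult_left_mono order_trans[OF le] ennreal_leI powr_mono2) auto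
        also have "\<dots> = k t * ennreal (c * H' t)"
          using H'(1)[of t] c by (simp add: mult.assoc ennreal_mult[symmetric] powr_diff mult.commute[of c])
        finally show "(\<integral>\<^sup>+x. (k t * ennreal (H' t powr (1 - P))) * epowr (g x t) P \<partial>M) \<le> ennreal c * (k t * ennreal (H' t))"
          using c H'(1)[of t] by (simp add: ennreal_mult mult_ac)
      qed
      also have "\<dots> = ennreal c * (\<integral>\<^sup>+t. k t * ennreal (H' t) \<partial>N)" by (rule nn_integral_cmult) measurable
      also have "\<dots> \<le> ennreal c * ennreal A'" by (intro mult_left_mono kH') simp
      finally have "?L \<le> ennreal (A' powr (P - 1)) * (ennreal c * ennreal A')"
        by (simp add: mult_left_mono)
      also have "\<dots> = ennreal (c * A' powr P)"
        using A' c by (simp add: ennreal_mult[symmetric] powr_diff)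
      finally show ?thesis unfolding A'_def .
    qed
    have "((\<lambda>e. ennreal (c * (a + e * (K + 1)) powr P)) \<longlongrightarrow> ennreal (c * (a + 0 * (K + 1)) powr P)) (at_right 0)"
      using P real K
      by (intro tendsto_ennrealI tendsto_intros tendsto_powr2)
        (auto simp: eventually_at_filter intro!: always_eventually)
    then have "?L \<le> ennreal (c * (a + 0 * (K + 1)) powr P)"
      by (rule tendsto_lowerbound) (auto simp: eventually_at_right_less intro!: main eventually_at_rightI[of 0 1])
    then show ?thesis
      unfolding A_def[symmetric] real(2) using c real by (simp add: ennreal_mult)
  qed
qed

section \<open>Exponential kernels in mixed norms\<close>

text \<open>\<open>M_mean\<close> for extended nonnegative functions, so that it also applies to
  weighted moduli, to step functions and to \<open>kern\<close>.\<close>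

definition mean :: "ennreal \<Rightarrow> (complex \<Rightarrow> ennreal) \<Rightarrow> real \<Rightarrow> ennreal" where
  "mean p G r =
     (if p = \<infinity> then (SUP \<theta>::real. G (of_real r * cis \<theta>))
      else epowr (ennreal (1 / (2 * pi)) *
             (\<integral>\<^sup>+ \<theta> \<in> {0..2 * pi}. epowr (G (of_real r * cis \<theta>)) (enn2real p) \<partial>lborel))
             (1 / enn2real p))"

text \<open>Once the Gaussian is part of the function, the measure left over is r dr, the radial
  part of planar Lebesgue measure. Radial estimates can therefore be carried out in the
  plane.\<close>

definition mixed :: "ennreal \<Rightarrow> (real \<Rightarrow> ennreal) \<Rightarrow> ennreal" where
  "mixed q m =
     (if q = \<infinity> then (SUP r\<in>{0..}. m r)
      else epowr (\<integral>\<^sup>+ r \<in> {0..}. epowr (m r) (enn2real q) * ennreal r \<partial>lborel) (1 / enn2real q))"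

lemma enn2real_pos: "p > 0 \<Longrightarrow> p \<noteq> \<infinity> \<Longrightarrow> enn2real p > 0"
  by (simp add: enn2real_positive_iff less_top)

lemma mixed_mono:
  assumes "\<And>r. r \<ge> 0 \<Longrightarrow> m r \<le> m' r"
  shows "mixed q m \<le> mixed q m'"
proof (cases "q = \<infinity>")
  case True
  then show ?thesis using assms by (auto simp: mixed_def intro!: SUP_mono)
next
  case False
  have "epowr (m r) (enn2real q) * ennreal r * indicator {0..} r \<le> epowr (m' r) (enn2real q) * ennreal r * indicator {0..} r" for r
    using assms[of r] by (cases "r \<ge> 0") (auto intro!: epowr_mono mult_right_mono)
  then show ?thesis using False
    by (auto simp: mixed_def intro!: epowr_mono nn_integral_mono)
qed

lemma mixed_cmult:
  assumes [measurable]: "m \<in> borel_measurable borel" and q: "q > 0"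
  shows "mixed q (\<lambda>r. c * m r) = c * mixed q m"
proof (cases "q = \<infinity>")
  case True
  then show ?thesis by (simp add: mixed_def SUP_mult_left_ennreal)
next
  case False
  then have Q: "enn2real q > 0" using q by (simp add: enn2real_pos)
  have "(\<integral>\<^sup>+ r \<in> {0..}. epowr (c * m r) (enn2real q) * ennreal r \<partial>lborel) =
      (\<integral>\<^sup>+ r. epowr c (enn2real q) * (epowr (m r) (enn2real q) * ennreal r * indicator {0..} r) \<partial>lborel)"
    using Q by (intro nn_integral_cong) (simp add: epowr_mult mult_ac)
  also have "\<dots> = epowr c (enn2real q) * (\<integral>\<^sup>+ r \<in> {0..}. epowr (m r) (enn2real q) * ennreal r \<partial>lborel)"
    by (rule nn_integral_cmult) measurable
  finally show ?thesis using False Q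
    by (simp add: mixed_def epowr_mult epowr_inverse)
qed

text \<open>For p = \<infinity> the supremum runs over uncountably many angles; it is measurable
  because a supremum of continuous functions is lower semicontinuous.\<close>

lemma borel_measurable_mean:
  fixes g :: "complex \<Rightarrow> real"
  assumes g: "continuous_on UNIV g"
  shows "mean p (\<lambda>z. ennreal (g z)) \<in> borel_measurable borel"
proof (cases "p = \<infinity>")
  case True
  have "{r \<in> space borel. y < (SUP \<theta>::real. ennreal (g (of_real r * cis \<theta>)))} \<in> sets borel" for y
  proof -
    have "{r \<in> space borel. y < (SUP \<theta>::real. ennreal (g (of_real r * cis \<theta>)))} =
       (\<Union>\<theta>. {r. y < ennreal (g (of_real r * cis \<theta>))})"
      by (auto simp: less_SUP_iff)
    moreover have "open {r. y < ennreal (g (of_real r * cis \<theta>))}" for \<theta>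
      by (intro open_Collect_less continuous_on_ennreal continuous_intros
        continuous_on_compose2[OF g]) auto
    ultimately show ?thesis by (simp only:) (intro borel_open open_UN, auto)
  qed
  then have "(\<lambda>r. SUP \<theta>::real. ennreal (g (of_real r * cis \<theta>))) \<in> borel_measurable borel"
    by (rule borel_measurableI_greater)
  then show ?thesis using True by (simp add: mean_def[abs_def])
next
  case False
  have "continuous_on UNIV (\<lambda>w::real \<times> real. g (of_real (fst w) * cis (snd w)))"
    by (intro continuous_intros continuous_on_compose2[OF g]) auto
  then have [measurable]: "(\<lambda>w::real \<times> real. g (of_real (fst w) * cis (snd w))) \<in> borel_measurable (borel \<Otimes>\<^sub>M borel)"
    unfolding borel_prod by (rule borel_measurable_continuous_onI)
  show ?thesis using False unfolding mean_def[abs_def] by simp measurable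
qed

lemma mean_finite:
  fixes g :: "complex \<Rightarrow> real"
  assumes g: "continuous_on UNIV g" and p: "p > 0"
  shows "mean p (\<lambda>z. ennreal (g z)) r < \<infinity>"
proof -
  have "compact (g ` cball 0 \<bar>r\<bar>)"
    by (intro compact_continuous_image continuous_on_subset[OF g]) auto
  then obtain B where B: "\<And>z. cmod z \<le> \<bar>r\<bar> \<Longrightarrow> g z \<le> B"
    by (metis (no_types, lifting) bounded_imp_bdd_above bdd_above.E compact_imp_bounded image_eqI mem_cball_0)
  have gB: "ennreal (g (of_real r * cis \<theta>)) \<le> ennreal B" for \<theta>
    by (intro ennreal_leI B) (simp add: norm_mult)
  show ?thesis
  proof (cases "p = \<infinity>")
    case True
    have "mean p (\<lambda>z. ennreal (g z)) r \<le> ennreal B"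
      using True gB by (auto simp: mean_def intro!: SUP_least)
    then show ?thesis by (simp add: le_less_trans)
  next
    case False
    then have P: "enn2real p > 0" using p by (simp add: enn2real_pos)
    have "(\<integral>\<^sup>+ \<theta> \<in> {0..2 * pi}. epowr (ennreal (g (of_real r * cis \<theta>))) (enn2real p) \<partial>lborel)
        \<le> (\<integral>\<^sup>+ \<theta> \<in> {0..2 * pi}. epowr (ennreal B) (enn2real p) \<partial>lborel)"
      using gB P by (intro nn_integral_mono mult_right_mono epowr_mono) auto
    also have "\<dots> < \<infinity>"
      by (subst nn_integral_cmult_indicator) (auto simp: ennreal_mult_less_top ennreal_mult_eq_top_iff less_top[symmetric])
    finally show ?thesis using False
      by (simp add: mean_def ennreal_mult_less_top)
  qed
qed

lemma nn_integral_periodic_shift: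
  fixes h :: "real \<Rightarrow> ennreal"
  assumes [measurable]: "h \<in> borel_measurable borel" and per: "\<And>x. h (x + 2 * pi) = h x"
    and a: "0 \<le> a" "a \<le> 2 * pi"
  shows "(\<integral>\<^sup>+ x \<in> {0..2 * pi}. h (x + a) \<partial>lborel) = (\<integral>\<^sup>+ x \<in> {0..2 * pi}. h x \<partial>lborel)"
proof -
  \<comment> \<open>Half-open intervals can be cut and glued without overlap; the endpoint is a null
    set.\<close>
  have open': "(\<integral>\<^sup>+ x. f x * indicator {0..2 * pi} x \<partial>lborel) = (\<integral>\<^sup>+ x. f x * indicator {0..<2 * pi} x \<partial>lborel)"
    for f :: "real \<Rightarrow> ennreal"
    by (intro nn_integral_cong_AE AE_I[where N="{2 * pi}"]) (auto simp: indicator_def of_bool_def split: if_splits)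
  have "(\<integral>\<^sup>+ x. h (x + a) * indicator {0..<2 * pi} x \<partial>lborel) =
      (\<integral>\<^sup>+ x. (\<lambda>y. h y * indicator {a..<2 * pi + a} y) (x + a) \<partial>lborel)"
    by (intro nn_integral_cong) (auto simp: indicator_def)
  also have "\<dots> = (\<integral>\<^sup>+ y. h y * indicator {a..<2 * pi + a} y \<partial>lborel)"
    by (rule nn_integral_real_shift) measurable
  also have "\<dots> = (\<integral>\<^sup>+ y. h y * indicator {a..<2 * pi} y + h y * indicator {2 * pi..<2 * pi + a} y \<partial>lborel)"
    using a by (intro nn_integral_cong) (auto simp: indicator_def)
  also have "\<dots> = (\<integral>\<^sup>+ y. h y * indicator {a..<2 * pi} y \<partial>lborel) + (\<integral>\<^sup>+ y. h y * indicator {2 * pi..<2 * pi + a} y \<partial>lborel)"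
    by (rule nn_integral_add) measurable
  also have "(\<integral>\<^sup>+ y. h y * indicator {2 * pi..<2 * pi + a} y \<partial>lborel) =
      (\<integral>\<^sup>+ y. (\<lambda>y. h y * indicator {2 * pi..<2 * pi + a} y) (y + 2 * pi) \<partial>lborel)"
    by (rule nn_integral_real_shift[symmetric]) measurable
  also have "\<dots> = (\<integral>\<^sup>+ y. h y * indicator {0..<a} y \<partial>lborel)"
    by (intro nn_integral_cong) (auto simp: indicator_def per)
  also have "(\<integral>\<^sup>+ y. h y * indicator {a..<2 * pi} y \<partial>lborel) + (\<integral>\<^sup>+ y. h y * indicator {0..<a} y \<partial>lborel) =
     (\<integral>\<^sup>+ y. h y * indicator {a..<2 * pi} y + h y * indicator {0..<a} y \<partial>lborel)"
    by (rule nn_integral_add[symmetric]) measurable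
  also have "\<dots> = (\<integral>\<^sup>+ y. h y * indicator {0..<2 * pi} y \<partial>lborel)"
    using a by (intro nn_integral_cong) (auto simp: indicator_def)
  finally show ?thesis unfolding open' .
qed

section \<open>The kernel operator: symmetries and mixed-norm bounds\<close>

lemma kern_mono: "(\<And>u. b u \<le> b' u) \<Longrightarrow> kern s b z \<le> kern s b' z"
  unfolding kern_def by (intro nn_integral_mono mult_right_mono) auto

lemma borel_measurable_kern [measurable]:
  assumes [measurable]: "b \<in> borel_measurable borel"
  shows "kern s b \<in> borel_measurable borel"
  unfolding kern_def[abs_def] by measurable

lemma kern_rotate:
  assumes [measurable]: "b \<in> borel_measurable borel"
  shows "kern s b (cis t * z) = kern s (\<lambda>u. b (cis t * u)) z"
proof -
  have "kern s b (cis t * z) = (\<integral>\<^sup>+ u. (\<lambda>v. b v * ennreal (exp (- s * cmod (cis t * z - v)))) (cis t * u) \<partial>lborel)"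
    unfolding kern_def by (rule nn_integral_rotate[symmetric]) measurable
  also have "\<dots> = kern s (\<lambda>u. b (cis t * u)) z"
    unfolding kern_def right_diff_distrib[symmetric] by (simp add: norm_mult)
  finally show ?thesis .
qed

lemma complex_polar: obtains t where "0 \<le> t" "t \<le> 2 * pi" "z = of_real (cmod z) * cis t"
proof -
  have "z = of_real (cmod z) * cis (Arg2pi z)"
    using Arg2pi[of z] by (simp add: is_Arg_def cis_conv_exp)
  then show thesis using that[of "Arg2pi z"] Arg2pi[of z] by auto
qed

lemma kern_radial:
  assumes [measurable]: "b \<in> borel_measurable borel"
  shows "kern s (\<lambda>u. b (cmod u)) z = kern s (\<lambda>u. b (cmod u)) (of_real (cmod z))"
proof -
  obtain t where "z = of_real (cmod z) * cis t" using complex_polar by blast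
  then have "kern s (\<lambda>u. b (cmod u)) z = kern s (\<lambda>u. b (cmod u)) (cis t * of_real (cmod z))"
    by (simp add: mult.commute)
  also have "\<dots> = kern s (\<lambda>u. b (cmod u)) (of_real (cmod z))"
    by (subst kern_rotate) (auto simp: norm_mult)
  finally show ?thesis .
qed

text \<open>The summand 1 makes this bound for the kernel mass positive without evaluating the
  integral, as \<open>jensen_powr\<close> requires.\<close>

definition kconst :: "real \<Rightarrow> real" where
  "kconst s = enn2real (\<integral>\<^sup>+(u::complex). ennreal (exp (- s * cmod u)) \<partial>lborel) + 1"

lemma kconst_pos: "kconst s > 0"
  by (simp add: kconst_def add_nonneg_pos)

lemma kern_const_le:
  assumes "s > 0"
  shows "(\<integral>\<^sup>+ u. ennreal (exp (- s * cmod (z - u))) \<partial>lborel) \<le> ennreal (kconst s)"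
    and "(\<integral>\<^sup>+ u. ennreal (exp (- s * cmod (u - z))) \<partial>lborel) \<le> ennreal (kconst s)"
proof -
  let ?h = "\<lambda>u. ennreal (exp (- s * cmod u))"
  have "(\<integral>\<^sup>+ u. ennreal (exp (- s * cmod (u - z))) \<partial>lborel) = (\<integral>\<^sup>+ u. ?h (- z + u) \<partial>lborel)"
    by simp
  also have "\<dots> = (\<integral>\<^sup>+ u. ?h u \<partial>lborel)" by (rule nn_integral_lborel_shift) simp
  also have "\<dots> \<le> ennreal (kconst s)"
    using nn_integral_exp_norm_finite[OF assms]
    by (cases "\<integral>\<^sup>+ u. ?h u \<partial>lborel") (auto simp: kconst_def intro!: ennreal_leI)
  finally show 2: "(\<integral>\<^sup>+ u. ennreal (exp (- s * cmod (u - z))) \<partial>lborel) \<le> ennreal (kconst s)" .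
  then show "(\<integral>\<^sup>+ u. ennreal (exp (- s * cmod (z - u))) \<partial>lborel) \<le> ennreal (kconst s)"
    by (simp add: norm_minus_commute)
qed

text \<open>For a majorant m of the circular means, this is the majorant of the circular means after
  the kernel has acted; by rotation invariance it depends on the radius only.\<close>

definition radial_kern :: "real \<Rightarrow> (real \<Rightarrow> real) \<Rightarrow> real \<Rightarrow> ennreal" where
  "radial_kern s m r = epowr (kern s (\<lambda>u. ennreal (m (cmod u) powr s)) (of_real r)) (1 / s)"

lemma borel_measurable_radial_kern [measurable]:
  assumes [measurable]: "m \<in> borel_measurable borel"
  shows "radial_kern s m \<in> borel_measurable borel"
  unfolding radial_kern_def[abs_def] by measurable

text \<open>The angular half of the mixed-norm bound. Rotating the point amounts to rotating b, so
  Minkowski with exponent P/s \<ge> 1 takes the circular mean inside the kernel, where m bounds it.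
  The function G enters only through a pointwise bound by \<open>kern\<close>, so the lemma serves
  synthesis and recovery alike.\<close>

lemma mean_kern_le:
  fixes b :: "complex \<Rightarrow> real" and m :: "real \<Rightarrow> real"
  assumes p: "p > 0" and s: "s > 0" "ennreal s \<le> p"
    and [measurable]: "b \<in> borel_measurable borel" "m \<in> borel_measurable borel"
    and b0: "\<And>z. b z \<ge> 0" and m0: "\<And>r. m r \<ge> 0"
    and le: "\<And>r. r \<ge> 0 \<Longrightarrow> mean p (\<lambda>z. ennreal (b z)) r \<le> ennreal (m r)"
    and G: "\<And>z. epowr (G z) s \<le> C * kern s (\<lambda>u. ennreal (b u powr s)) z"
    and r: "r \<ge> 0"
  shows "mean p G r \<le> epowr C (1 / s) * radial_kern s m r"
proof (cases "p = \<infinity>")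
  case True
  let ?m = "(\<lambda>u. ennreal (m (cmod u) powr s))"
  have bm: "b u \<le> m (cmod u)" for u
  proof -
    obtain t where t: "u = of_real (cmod u) * cis t" using complex_polar by blast
    have "ennreal (b u) \<le> mean p (\<lambda>z. ennreal (b z)) (cmod u)"
      unfolding mean_def using True t by (auto intro: SUP_upper2[where i=t])
    also have "\<dots> \<le> ennreal (m (cmod u))" by (rule le) simp
    finally show ?thesis using m0 by simp
  qed
  have "G (of_real r * cis t) \<le> epowr C (1 / s) * radial_kern s m r" for t
  proof -
    have "epowr (G (of_real r * cis t)) s \<le> C * kern s ?m (of_real r * cis t)"
      using s bm b0 by (intro order_trans[OF G] mult_left_mono kern_mono ennreal_leI powr_mono2) auto
    also have "\<dots> = C * kern s ?m (of_real r)"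
      using r by (subst kern_radial[of "\<lambda>x. ennreal (m x powr s)"]) (auto simp: norm_mult)
    finally have "G (of_real r * cis t) \<le> epowr (C * kern s ?m (of_real r)) (1 / s)"
      using s by (simp add: epowr_le_swap)
    then show ?thesis using s by (simp add: radial_kern_def epowr_mult)
  qed
  then show ?thesis using True by (auto simp: mean_def intro!: SUP_least)
next
  case False
  let ?k = "\<lambda>\<theta>. kern s (\<lambda>u. ennreal (b u powr s)) (of_real r * cis \<theta>)" and ?m = "\<lambda>u. ennreal (m (cmod u) powr s)"
  define P where "P = enn2real p"
  have P: "P > 0" using False p by (simp add: P_def enn2real_pos)
  have pP: "p = ennreal P" using False by (simp add: P_def less_top)
  have sP: "P / s \<ge> 1" using s P pP by simp
  \<comment> \<open>The argument of u only shifts the angle, and periodicity removes the shift: the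
    integral is that of the circular mean at radius |u|.\<close>
  have circ: "(\<integral>\<^sup>+ \<theta> \<in> {0..2 * pi}. ennreal (b (cis \<theta> * u) powr P) \<partial>lborel) \<le> ennreal (2 * pi * m (cmod u) powr P)" for u
  proof -
    obtain a where a: "0 \<le> a" "a \<le> 2 * pi" "u = of_real (cmod u) * cis a" using complex_polar by blast
    have [measurable]: "(\<lambda>x. of_real (cmod u) * cis x) \<in> borel_measurable borel"
      by (intro borel_measurable_continuous_onI continuous_intros)
    let ?h = "\<lambda>x. ennreal (b (of_real (cmod u) * cis x) powr P)"
    let ?I = "\<integral>\<^sup>+ \<theta> \<in> {0..2 * pi}. ?h \<theta> \<partial>lborel"
    have eq: "cis \<theta> * u = of_real (cmod u) * cis (\<theta> + a)" for \<theta>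
      by (subst a(3)) (simp add: cis_mult[symmetric] mult_ac)
    have "(\<integral>\<^sup>+ \<theta> \<in> {0..2 * pi}. ennreal (b (cis \<theta> * u) powr P) \<partial>lborel) =
       (\<integral>\<^sup>+ \<theta> \<in> {0..2 * pi}. ?h (\<theta> + a) \<partial>lborel)"
      unfolding eq ..
    also have "\<dots> = ?I"
      using a by (intro nn_integral_periodic_shift) (auto simp: cis_mult[symmetric])
    finally have 1: "(\<integral>\<^sup>+ \<theta> \<in> {0..2 * pi}. ennreal (b (cis \<theta> * u) powr P) \<partial>lborel) = ?I" .
    have "epowr (ennreal (1 / (2 * pi)) * ?I) (1 / P) \<le> ennreal (m (cmod u))"
      using le[of "cmod u"] False b0 by (simp add: mean_def P_def)
    then have "ennreal (1 / (2 * pi)) * ?I \<le> ennreal (m (cmod u) powr P)"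
      using P m0 by (simp add: epowr_le_swap')
    then have "ennreal (2 * pi) * (ennreal (1 / (2 * pi)) * ?I) \<le> ennreal (2 * pi) * ennreal (m (cmod u) powr P)"
      by (rule mult_left_mono) simp
    also have "ennreal (2 * pi) * (ennreal (1 / (2 * pi)) * ?I) = ?I"
      by (simp add: mult.assoc[symmetric] ennreal_mult[symmetric])
    finally show ?thesis unfolding 1 by (simp add: ennreal_mult)
  qed
  define k where "k = (\<lambda>u. ennreal (exp (- s * cmod (of_real r - u))))"
  \<comment> \<open>The indicator confines the angle to one turn, so that Minkowski applies on the
    whole line. The s-th power raised to P/s gives back the P-th power.\<close>
  define g where "g = (\<lambda>\<theta> u. indicator {0..2 * pi} \<theta> * ennreal (b (cis \<theta> * u) powr s))"
  have [measurable]: "(\<lambda>x::real. cis x) \<in> borel_measurable borel"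
    by (intro borel_measurable_continuous_onI continuous_intros)
  have ind: "epowr (indicator A x * y) c = indicator A x * epowr y c" for A :: "real set" and x y c
    by (simp add: indicator_def)
  have "(\<integral>\<^sup>+\<theta>. epowr (\<integral>\<^sup>+u. k u * g \<theta> u \<partial>lborel) (P / s) \<partial>lborel) \<le>
      ennreal (2 * pi) * epowr (\<integral>\<^sup>+u. k u * ennreal (m (cmod u) powr s) \<partial>lborel) (P / s)"
  proof (rule minkowski_integral)
    show "k \<in> borel_measurable lborel" unfolding k_def by measurable
    show "(\<lambda>(x, t). g x t) \<in> borel_measurable (lborel \<Otimes>\<^sub>M lborel)" unfolding g_def by measurable
    have "(\<integral>\<^sup>+u. k u \<partial>lborel) \<le> ennreal (kconst s)" unfolding k_def by (rule kern_const_le[OF s(1)])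
    then show "(\<integral>\<^sup>+u. k u \<partial>lborel) < \<infinity>" by (simp add: le_less_trans)
    show "(\<integral>\<^sup>+x. epowr (g x t) (P / s) \<partial>lborel) \<le> ennreal (2 * pi * (m (cmod t) powr s) powr (P / s))" for t
      using circ[of t] s by (simp add: g_def ind powr_powr b0) (simp add: mult.commute)
  qed (use sP in \<open>auto intro: lborel.sigma_finite_measure_axioms\<close>)
  also have "(\<integral>\<^sup>+u. k u * ennreal (m (cmod u) powr s) \<partial>lborel) = kern s ?m (of_real r)"
    by (simp add: kern_def k_def mult.commute)
  also have "(\<integral>\<^sup>+\<theta>. epowr (\<integral>\<^sup>+u. k u * g \<theta> u \<partial>lborel) (P / s) \<partial>lborel) =
     (\<integral>\<^sup>+ \<theta> \<in> {0..2 * pi}. epowr (?k \<theta>) (P / s) \<partial>lborel)"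
  proof (rule nn_integral_cong)
    fix \<theta> :: real
    have "(\<integral>\<^sup>+u. k u * g \<theta> u \<partial>lborel) = indicator {0..2 * pi} \<theta> * kern s (\<lambda>u. ennreal (b (cis \<theta> * u) powr s)) (of_real r)"
      unfolding kern_def by (subst nn_integral_cmult[symmetric]) (auto simp: g_def k_def mult_ac intro!: nn_integral_cong)
    also have "\<dots> = indicator {0..2 * pi} \<theta> * kern s (\<lambda>u. ennreal (b u powr s)) (of_real r * cis \<theta>)"
      by (subst mult.commute[of _ "cis \<theta>"], subst kern_rotate) auto
    finally show "epowr (\<integral>\<^sup>+u. k u * g \<theta> u \<partial>lborel) (P / s) =
        epowr (?k \<theta>) (P / s) * indicator {0..2 * pi} \<theta>"
      by (simp add: ind mult.commute)
  qed
  finally have mink: "(\<integral>\<^sup>+ \<theta> \<in> {0..2 * pi}. epowr (?k \<theta>) (P / s) \<partial>lborel)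
     \<le> ennreal (2 * pi) * epowr (kern s ?m (of_real r)) (P / s)" .
  have "(\<integral>\<^sup>+ \<theta> \<in> {0..2 * pi}. epowr (G (of_real r * cis \<theta>)) P \<partial>lborel) \<le>
     (\<integral>\<^sup>+ \<theta>. epowr C (P / s) * (epowr (?k \<theta>) (P / s) * indicator {0..2 * pi} \<theta>) \<partial>lborel)"
  proof (rule nn_integral_mono)
    fix \<theta> :: real
    have "epowr (G (of_real r * cis \<theta>)) P = epowr (epowr (G (of_real r * cis \<theta>)) s) (P / s)"
      using s by (simp add: epowr_epowr)
    also have "\<dots> \<le> epowr (C * kern s (\<lambda>u. ennreal (b u powr s)) (of_real r * cis \<theta>)) (P / s)"
      using s P by (intro epowr_mono G) auto
    also have "\<dots> = epowr C (P / s) * epowr (?k \<theta>) (P / s)"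
      using s P by (simp add: epowr_mult)
    finally show "epowr (G (of_real r * cis \<theta>)) P * indicator {0..2 * pi} \<theta> \<le>
        epowr C (P / s) * (epowr (?k \<theta>) (P / s) * indicator {0..2 * pi} \<theta>)"
      by (simp add: mult.assoc[symmetric] mult_right_mono)
  qed
  also have "\<dots> = epowr C (P / s) *
      (\<integral>\<^sup>+ \<theta> \<in> {0..2 * pi}. epowr (?k \<theta>) (P / s) \<partial>lborel)"
    by (rule nn_integral_cmult) measurable
  also have "\<dots> \<le> epowr C (P / s) * (ennreal (2 * pi) * epowr (kern s ?m (of_real r)) (P / s))"
    by (intro mult_left_mono mink) simp
  finally have "ennreal (1 / (2 * pi)) * (\<integral>\<^sup>+ \<theta> \<in> {0..2 * pi}. epowr (G (of_real r * cis \<theta>)) P \<partial>lborel) \<le>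
      ennreal (1 / (2 * pi)) * (epowr C (P / s) * (ennreal (2 * pi) * epowr (kern s ?m (of_real r)) (P / s)))"
    by (simp add: mult_left_mono)
  also have "\<dots> = (ennreal (1 / (2 * pi)) * ennreal (2 * pi)) * (epowr C (P / s) * epowr (kern s ?m (of_real r)) (P / s))"
    by (simp only: mult_ac)
  also have "ennreal (1 / (2 * pi)) * ennreal (2 * pi) = 1"
    by (simp add: ennreal_mult[symmetric])
  also have "1 * (epowr C (P / s) * epowr (kern s ?m (of_real r)) (P / s)) =
      epowr (epowr C (1 / s) * radial_kern s m r) P"
    using P by (simp add: epowr_mult radial_kern_def epowr_epowr)
  finally show ?thesis using False P
    by (simp add: mean_def P_def[symmetric] epowr_le_swap')
qed

text \<open>The radial half. A radial integral against r dr is a planar integral up to 2 pi, so this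
  becomes a Schur test in the plane: Jensen with exponent Q/s \<ge> 1 uses the mass of the kernel in
  u, and Tonelli then uses its mass in z.\<close>

lemma mixed_radial_kern_le:
  fixes m :: "real \<Rightarrow> real"
  assumes q: "q > 0" and s: "s > 0" "ennreal s \<le> q"
    and [measurable]: "m \<in> borel_measurable borel" and m0: "\<And>r. m r \<ge> 0"
  shows "mixed q (radial_kern s m) \<le> ennreal (kconst s powr (1 / s)) * mixed q (\<lambda>r. ennreal (m r))"
proof (cases "q = \<infinity>")
  case True
  define S where "S = mixed q (\<lambda>r. ennreal (m r))"
  have mS: "ennreal (m r) \<le> S" if "r \<ge> 0" for r
    using True that by (auto simp: S_def mixed_def intro!: SUP_upper)
  have "radial_kern s m r \<le> ennreal (kconst s powr (1 / s)) * S" for r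
  proof -
    have "kern s (\<lambda>u. ennreal (m (cmod u) powr s)) (of_real r) \<le> kern s (\<lambda>u. epowr S s) (of_real r)"
      using s m0 mS by (intro kern_mono) (simp add: epowr_ennreal[symmetric] epowr_mono del: epowr_ennreal)
    also have "\<dots> = epowr S s * (\<integral>\<^sup>+ u. ennreal (exp (- s * cmod (of_real r - u))) \<partial>lborel)"
      unfolding kern_def by (rule nn_integral_cmult) measurable
    also have "\<dots> \<le> epowr S s * ennreal (kconst s)"
      by (intro mult_left_mono kern_const_le s) simp
    finally have "radial_kern s m r \<le> epowr (epowr S s * ennreal (kconst s)) (1 / s)"
      using s unfolding radial_kern_def by (intro epowr_mono) auto
    also have "\<dots> = ennreal (kconst s powr (1 / s)) * S"
      using s kconst_pos[of s] by (simp add: epowr_mult epowr_inverse mult.commute)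
    finally show ?thesis .
  qed
  then show ?thesis using True unfolding S_def[symmetric] by (auto simp: mixed_def intro!: SUP_least)
next
  case False
  define Q where "Q = enn2real q"
  have Q: "Q > 0" using False q by (simp add: Q_def enn2real_pos)
  have qQ: "q = ennreal Q" using False by (simp add: Q_def less_top)
  have sQ: "Q / s \<ge> 1" using s Q qQ by simp
  define \<mu> where "\<mu> = (\<lambda>u::complex. ennreal (m (cmod u) powr s))"
  have [measurable]: "\<mu> \<in> borel_measurable borel" unfolding \<mu>_def by measurable
  define K where "K = kconst s"
  have K: "K > 0" by (simp add: K_def kconst_pos)
  let ?R = "\<lambda>z. \<integral>\<^sup>+u. ennreal (exp (- s * cmod (z - u))) * epowr (\<mu> u) (Q / s) \<partial>lborel"
  let ?I = "\<integral>\<^sup>+ r \<in> {0..}. epowr (radial_kern s m r) Q * ennreal r \<partial>lborel"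
  let ?J = "\<integral>\<^sup>+ r \<in> {0..}. epowr (ennreal (m r)) Q * ennreal r \<partial>lborel"
  have pol: "(\<integral>\<^sup>+z. h (cmod z) \<partial>lborel) = ennreal (2 * pi) * (\<integral>\<^sup>+ r \<in> {0..}. h r * ennreal r \<partial>lborel)"
    if [measurable]: "h \<in> borel_measurable borel" for h
  proof -
    have "(\<integral>\<^sup>+z. h (cmod z) \<partial>lborel) = (\<integral>\<^sup>+ r. ennreal (2 * pi) * (h r * ennreal r * indicator {0..} r) \<partial>lborel)"
    proof (subst nn_integral_radial[OF that], rule nn_integral_cong)
      fix r :: real
      have "ennreal (2 * pi * r) = ennreal (2 * pi) * ennreal r" by (rule ennreal_mult') simp
      then show "h r * ennreal (2 * pi * r) * indicator {0..} r = ennreal (2 * pi) * (h r * ennreal r * indicator {0..} r)"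
        by (simp only: mult_ac)
    qed
    also have "\<dots> = ennreal (2 * pi) * (\<integral>\<^sup>+ r \<in> {0..}. h r * ennreal r \<partial>lborel)"
      by (rule nn_integral_cmult) measurable
    finally show ?thesis .
  qed
  have rk: "epowr (radial_kern s m (cmod z)) Q = epowr (kern s \<mu> z) (Q / s)" for z
    unfolding radial_kern_def \<mu>_def
    by (subst (2) kern_radial[of "\<lambda>x. ennreal (m x powr s)"]) (auto simp: epowr_epowr)
  have "ennreal (2 * pi) * ?I = (\<integral>\<^sup>+z. epowr (kern s \<mu> z) (Q / s) \<partial>lborel)"
    by (subst pol[symmetric]) (auto simp: rk)
  also have "\<dots> \<le> (\<integral>\<^sup>+z. ennreal (K powr (Q / s - 1)) * ?R z \<partial>lborel)"
  proof (rule nn_integral_mono)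
    fix z
    have "epowr (\<integral>\<^sup>+u. ennreal (exp (- s * cmod (z - u))) * \<mu> u \<partial>lborel) (Q / s) \<le>
        ennreal (K powr (Q / s - 1)) * ?R z"
      unfolding K_def by (intro jensen_powr sQ kconst_pos kern_const_le s) measurable
    then show "epowr (kern s \<mu> z) (Q / s) \<le>
        ennreal (K powr (Q / s - 1)) * ?R z"
      by (simp add: kern_def mult.commute)
  qed
  also have "\<dots> = ennreal (K powr (Q / s - 1)) *
      (\<integral>\<^sup>+z. ?R z \<partial>lborel)"
    by (rule nn_integral_cmult) measurable
  also have "(\<integral>\<^sup>+z. ?R z \<partial>lborel) =
      (\<integral>\<^sup>+u. (\<integral>\<^sup>+z. ennreal (exp (- s * cmod (z - u))) * epowr (\<mu> u) (Q / s) \<partial>lborel) \<partial>lborel)"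
    by (rule lborel_pair.Fubini'[symmetric]) measurable
  also have "\<dots> \<le> (\<integral>\<^sup>+u. ennreal K * epowr (\<mu> u) (Q / s) \<partial>lborel)"
  proof (rule nn_integral_mono)
    fix u
    have "(\<integral>\<^sup>+z. ennreal (exp (- s * cmod (z - u))) * epowr (\<mu> u) (Q / s) \<partial>lborel) =
        (\<integral>\<^sup>+z. ennreal (exp (- s * cmod (z - u))) \<partial>lborel) * epowr (\<mu> u) (Q / s)"
      by (rule nn_integral_multc) measurable
    also have "\<dots> \<le> ennreal K * epowr (\<mu> u) (Q / s)"
      unfolding K_def by (intro mult_right_mono kern_const_le s) simp
    finally show "(\<integral>\<^sup>+z. ennreal (exp (- s * cmod (z - u))) * epowr (\<mu> u) (Q / s) \<partial>lborel) \<le> ennreal K * epowr (\<mu> u) (Q / s)" .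
  qed
  also have "\<dots> = ennreal K * (\<integral>\<^sup>+u. (\<lambda>r. epowr (ennreal (m r)) Q) (cmod u) \<partial>lborel)"
    using s m0 by (subst nn_integral_cmult) (auto simp: \<mu>_def powr_powr)
  also have "(\<integral>\<^sup>+(u::complex). (\<lambda>r. epowr (ennreal (m r)) Q) (cmod u) \<partial>lborel) = ennreal (2 * pi) * ?J"
    by (rule pol) measurable
  finally have "ennreal (2 * pi) * ?I \<le> ennreal (K powr (Q / s - 1)) * (ennreal K * (ennreal (2 * pi) * ?J))"
    by (simp add: mult_left_mono)
  also have "\<dots> = ennreal (2 * pi) * ((ennreal (K powr (Q / s - 1)) * ennreal K) * ?J)"
    by (simp only: mult_ac)
  \<comment> \<open>The first factor comes from Jensen, the second from integrating the kernel in z.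
    The Q-th root turns the product into K^(1/s).\<close>
  also have "ennreal (K powr (Q / s - 1)) * ennreal K = ennreal (K powr (Q / s))"
    using K by (simp add: ennreal_mult[symmetric] powr_diff)
  finally have le2: "ennreal (2 * pi) * ?I \<le> ennreal (2 * pi) * (ennreal (K powr (Q / s)) * ?J)" .
  have "?I \<le> ennreal (K powr (Q / s)) * ?J"
    by (rule ennreal_mult_le_mult_iff[THEN iffD1, OF _ _ le2]) auto
  then have "epowr ?I (1 / Q) \<le> epowr (ennreal (K powr (Q / s)) * ?J) (1 / Q)"
    using Q by (intro epowr_mono) auto
  also have "\<dots> = ennreal (K powr (1 / s)) * epowr ?J (1 / Q)"
    using Q K by (simp add: epowr_mult powr_powr)
  finally show ?thesis using False by (simp add: mixed_def Q_def[symmetric] K_def)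
qed

section \<open>The Fock norm as a mixed norm of the weighted modulus\<close>

lemma continuous_on_fock_mod:
  assumes "f holomorphic_on UNIV"
  shows "continuous_on UNIV (fock_mod \<alpha> f)"
  unfolding fock_mod_def[abs_def]
  by (intro continuous_intros holomorphic_on_imp_continuous_on assms)

lemma mean_fock_mod:
  assumes f: "f holomorphic_on UNIV" and p: "p > 0"
  shows "mean p (\<lambda>z. ennreal (fock_mod \<alpha> f z)) r = M_mean p f r * ennreal (exp (- (\<alpha> / 2) * r\<^sup>2))"
proof (cases "p = \<infinity>")
  case True
  then show ?thesis
    by (simp add: mean_def M_mean_def fock_mod_def norm_mult ennreal_mult SUP_mult_right_ennreal)
next
  case False
  define P where "P = enn2real p"
  have P: "P > 0" using False p by (simp add: P_def enn2real_pos)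
  note [measurable] = borel_measurable_holomorphic_UNIV[OF f]
  have [measurable]: "(\<lambda>x. of_real r * cis x) \<in> borel_measurable borel"
    by (intro borel_measurable_continuous_onI continuous_intros)
  define e where "e = ennreal (exp (- (\<alpha> / 2) * r\<^sup>2))"
  have "(\<integral>\<^sup>+ \<theta> \<in> {0..2 * pi}. epowr (ennreal (fock_mod \<alpha> f (of_real r * cis \<theta>))) P \<partial>lborel) =
    (\<integral>\<^sup>+ \<theta>. epowr e P * (ennreal (cmod (f (of_real r * cis \<theta>)) powr P) * indicator {0..2 * pi} \<theta>) \<partial>lborel)"
  proof (rule nn_integral_cong)
    fix \<theta>
    have "ennreal (fock_mod \<alpha> f (of_real r * cis \<theta>)) = ennreal (cmod (f (of_real r * cis \<theta>))) * e"
      by (simp add: fock_mod_def e_def ennreal_mult norm_mult)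
    then show "epowr (ennreal (fock_mod \<alpha> f (of_real r * cis \<theta>))) P * indicator {0..2 * pi} \<theta> =
        epowr e P * (ennreal (cmod (f (of_real r * cis \<theta>)) powr P) * indicator {0..2 * pi} \<theta>)"
      using P by (simp only: epowr_mult) (simp add: mult_ac)
  qed
  also have "\<dots> = epowr e P * (\<integral>\<^sup>+ \<theta> \<in> {0..2 * pi}. ennreal (cmod (f (of_real r * cis \<theta>)) powr P) \<partial>lborel)"
    by (rule nn_integral_cmult) measurable
  finally have I: "(\<integral>\<^sup>+ \<theta> \<in> {0..2 * pi}. epowr (ennreal (fock_mod \<alpha> f (of_real r * cis \<theta>))) P \<partial>lborel) =
     epowr e P * (\<integral>\<^sup>+ \<theta> \<in> {0..2 * pi}. ennreal (cmod (f (of_real r * cis \<theta>)) powr P) \<partial>lborel)" .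
  show ?thesis
    unfolding mean_def M_mean_def P_def[symmetric] e_def[symmetric] using False P
    by (simp only: I if_False, subst mult.left_commute, subst epowr_mult) (auto simp: epowr_inverse mult.commute)
qed

text \<open>The factor \<alpha> q of the radial density after the outer root; the supremum norm
  carries no such factor.\<close>

definition fock_const :: "real \<Rightarrow> ennreal \<Rightarrow> real" where
  "fock_const \<alpha> q = (if q = \<infinity> then 1 else (\<alpha> * enn2real q) powr (1 / enn2real q))"

lemma fock_const_pos: "\<alpha> > 0 \<Longrightarrow> q > 0 \<Longrightarrow> fock_const \<alpha> q > 0"
  using enn2real_pos[of q] by (auto simp: fock_const_def)

lemma fock_norm_eq_mixed:
  assumes f: "f holomorphic_on UNIV" and p: "p > 0" and q: "q > 0" and \<alpha>: "\<alpha> > 0"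
  shows "fock_norm \<alpha> p q f = ennreal (fock_const \<alpha> q) * mixed q (mean p (\<lambda>z. ennreal (fock_mod \<alpha> f z)))"
proof (cases "q = \<infinity>")
  case True
  then show ?thesis by (simp add: fock_norm_def mixed_def mean_fock_mod[OF f p] fock_const_def)
next
  case False
  define Q where "Q = enn2real q"
  have Q: "Q > 0" using False q by (simp add: Q_def enn2real_pos)
  let ?m = "mean p (\<lambda>z. ennreal (fock_mod \<alpha> f z))"
  have [measurable]: "?m \<in> borel_measurable borel"
    by (rule borel_measurable_mean[OF continuous_on_fock_mod[OF f]])
  have "(\<integral>\<^sup>+ r \<in> {0..}. epowr (M_mean p f r) Q * ennreal (\<alpha> * Q * exp (- (\<alpha> * Q / 2) * r\<^sup>2) * r) \<partial>lborel) =
     (\<integral>\<^sup>+ r. ennreal (\<alpha> * Q) * (epowr (?m r) Q * ennreal r * indicator {0..} r) \<partial>lborel)"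
  proof (rule nn_integral_cong)
    fix r :: real
    have "ennreal (\<alpha> * Q * exp (- (\<alpha> * Q / 2) * r\<^sup>2) * r) =
        ennreal (\<alpha> * Q) * (ennreal (exp (- (\<alpha> / 2) * r\<^sup>2) powr Q) * ennreal r)" if "r \<ge> 0"
      using \<alpha> Q that by (simp add: exp_powr_real ennreal_mult[symmetric] algebra_simps)
    then show "epowr (M_mean p f r) Q * ennreal (\<alpha> * Q * exp (- (\<alpha> * Q / 2) * r\<^sup>2) * r) * indicator {0..} r =
        ennreal (\<alpha> * Q) * (epowr (?m r) Q * ennreal r * indicator {0..} r)"
      using Q by (simp add: mean_fock_mod[OF f p] epowr_mult indicator_def mult_ac)
  qed
  also have "\<dots> = ennreal (\<alpha> * Q) * (\<integral>\<^sup>+ r \<in> {0..}. epowr (?m r) Q * ennreal r \<partial>lborel)"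
    by (rule nn_integral_cmult) measurable
  finally show ?thesis using False Q \<alpha>
    by (simp add: fock_norm_def mixed_def Q_def[symmetric] fock_const_def epowr_mult)
qed

section \<open>Geometry of the pockets\<close>

lemma cmod_cis_diff: "cmod (cis a - cis b) \<le> \<bar>a - b\<bar>"
proof -
  have "(cmod (cis a - cis b))\<^sup>2 = (2 * sin ((a - b) / 2))\<^sup>2"
  proof -
    have "(cmod (cis a - cis b))\<^sup>2 = 2 - 2 * cos (a - b)"
      unfolding cmod_power2 using sin_cos_squared_add3[of a] sin_cos_squared_add3[of b]
      by (simp add: power2_eq_square algebra_simps cos_diff)
    also have "cos (a - b) = 1 - 2 * (sin ((a - b) / 2))\<^sup>2"
      using cos_double_sin[of "(a - b) / 2"] by (simp only: mult_2 field_sum_of_halves)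
    finally show ?thesis by (simp add: power2_eq_square)
  qed
  also have "\<dots> = \<bar>2 * sin ((a - b) / 2)\<bar>\<^sup>2" by simp
  finally have "cmod (cis a - cis b) = \<bar>2 * sin ((a - b) / 2)\<bar>"
    by (rule power2_eq_imp_eq) auto
  then show ?thesis using abs_sin_x_le_abs_x[of "(a - b) / 2"] by simp
qed

lemma cmod_polar_diff: "cmod (of_real r * cis a - of_real r' * cis b) \<le> \<bar>r - r'\<bar> + \<bar>r'\<bar> * \<bar>a - b\<bar>"
proof -
  have "of_real r * cis a - of_real r' * cis b = of_real (r - r') * cis a + of_real r' * (cis a - cis b)"
    by (simp add: algebra_simps)
  then have "cmod (of_real r * cis a - of_real r' * cis b) \<le> cmod (of_real (r - r') * cis a) + cmod (of_real r' * (cis a - cis b))"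
    by (simp only: norm_triangle_ineq)
  also have "\<dots> = \<bar>r - r'\<bar> + \<bar>r'\<bar> * cmod (cis a - cis b)" by (simp only: norm_mult norm_of_real norm_cis mult_1_right)
  also have "\<dots> \<le> \<bar>r - r'\<bar> + \<bar>r'\<bar> * \<bar>a - b\<bar>" by (intro add_left_mono mult_left_mono cmod_cis_diff) simp
  finally show ?thesis .
qed

text \<open>Continuous images of Borel sets need not be Borel. The half-open polar rectangle is
  therefore exhausted by countably many compact ones, whose images are compact.\<close>

lemma sets_pocket [measurable]: "pocket \<delta> k \<nu> \<mu> \<in> sets borel"
proof -
  define F where "F = (\<lambda>w::real \<times> real. of_real (fst w) * cis (snd w))"
  define a b c d where "a = pocket_radius \<delta> k \<nu>" and "b = pocket_radius \<delta> k (\<nu> + 1)"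
    and "c = pocket_angle \<delta> k \<nu> \<mu>" and "d = pocket_angle \<delta> k \<nu> (\<mu> + 1)"
  have half: "x \<in> {u..<v} \<longleftrightarrow> (\<exists>n. x \<in> {u..v - 1 / real (Suc n)})" for x u v :: real
  proof
    assume "x \<in> {u..<v}"
    moreover then obtain n where "1 / real (Suc n) < v - x" using nat_approx_posE[of "v - x"] by auto
    ultimately show "\<exists>n. x \<in> {u..v - 1 / real (Suc n)}" by (auto intro!: exI[of _ n])
  next
    assume "\<exists>n. x \<in> {u..v - 1 / real (Suc n)}"
    then obtain n where "u \<le> x" "x \<le> v - 1 / real (Suc n)" by auto
    moreover have "0 < 1 / real (Suc n)" by simp
    ultimately show "x \<in> {u..<v}" unfolding atLeastLessThan_iff by linarith
  qed
  have "pocket \<delta> k \<nu> \<mu> = (\<Union>n m. F ` ({a..b - 1 / real (Suc n)} \<times> {c..d - 1 / real (Suc m)}))"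
  proof (intro equalityI subsetI)
    fix z assume "z \<in> pocket \<delta> k \<nu> \<mu>"
    then obtain r \<theta> where z: "z = F (r, \<theta>)" and "r \<in> {a..<b}" "\<theta> \<in> {c..<d}"
      unfolding pocket_def F_def a_def b_def c_def d_def by auto
    then obtain n m where "r \<in> {a..b - 1 / real (Suc n)}" "\<theta> \<in> {c..d - 1 / real (Suc m)}"
      unfolding half by blast
    with z show "z \<in> (\<Union>n m. F ` ({a..b - 1 / real (Suc n)} \<times> {c..d - 1 / real (Suc m)}))" by blast
  next
    fix z assume "z \<in> (\<Union>n m. F ` ({a..b - 1 / real (Suc n)} \<times> {c..d - 1 / real (Suc m)}))"
    then obtain n m r \<theta> where z: "z = F (r, \<theta>)" and "r \<in> {a..b - 1 / real (Suc n)}" "\<theta> \<in> {c..d - 1 / real (Suc m)}"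
      by blast
    then have "r \<in> {a..<b}" "\<theta> \<in> {c..<d}" unfolding half by blast+
    with z show "z \<in> pocket \<delta> k \<nu> \<mu>"
      unfolding pocket_def F_def a_def b_def c_def d_def by auto
  qed
  moreover have "compact (F ` ({a..b - 1 / real (Suc n)} \<times> {c..d - 1 / real (Suc m)}))" for n m
    unfolding F_def by (intro compact_continuous_image compact_Times continuous_intros) auto
  ultimately show ?thesis
    by (simp only:) (intro sets.countable_UN'' borel_compact, auto)
qed

section \<open>The pockets partition the plane\<close>

text \<open>The origin has no unique angle, but inner radius 0 occurs only for k = \<nu> = 0, and
  that ring consists of 2 \<nu> + 1 = 1 pocket. This settles the point excluded from
  \<open>pocket_index_unique\<close>.\<close>

lemma pocket_zero_index:
  assumes "0 < \<delta>" "(k, \<nu>, \<mu>) \<in> pocket_indices \<delta>" "0 \<in> pocket \<delta> k \<nu> \<mu>"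
  shows "k = 0 \<and> \<nu> = 0 \<and> \<mu> = 0"
proof -
  from assms(3) obtain r \<theta> where r: "0 = of_real r * cis \<theta>" "pocket_radius \<delta> k \<nu> \<le> r"
    by (auto simp: pocket_def)
  then have "r = 0" by simp
  with r have 0: "pocket_radius \<delta> k \<nu> = 0" using pocket_radius_nonneg[of \<delta> k \<nu>] by simp
  have \<nu>: "\<nu> = 0"
    using 0 pocket_radius_less[OF assms(1), of k "\<nu> - 1"] pocket_radius_nonneg[of \<delta> k "\<nu> - 1"]
    by (cases \<nu>) auto
  have "k = 0" using 0 \<nu> by (auto simp: pocket_radius_def split: if_splits)
  then show ?thesis using \<nu> assms(2) by (simp add: pocket_indices_def N_ang_def)
qed

lemma pocket_index_unique':
  assumes "0 < \<delta>" "(k, \<nu>, \<mu>) \<in> pocket_indices \<delta>" "(k', \<nu>', \<mu>') \<in> pocket_indices \<delta>"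
    and "z \<in> pocket \<delta> k \<nu> \<mu>" "z \<in> pocket \<delta> k' \<nu>' \<mu>'"
  shows "k' = k \<and> \<nu>' = \<nu> \<and> \<mu>' = \<mu>"
  using pocket_index_unique[of \<delta> z k \<nu> \<mu> k' \<nu>' \<mu>'] pocket_zero_index[of \<delta> k \<nu> \<mu>]
    pocket_zero_index[of \<delta> k' \<nu>' \<mu>'] assms by (cases "z = 0") auto

lemma pocket_angle_cover:
  assumes \<delta>: "0 < \<delta>" and t: "0 \<le> t" "t < 2 * pi"
  shows "\<exists>\<mu><N_ang \<delta> k \<nu>. t \<in> {pocket_angle \<delta> k \<nu> \<mu> ..< pocket_angle \<delta> k \<nu> (\<mu> + 1)}"
proof -
  define n where "n = N_ang \<delta> k \<nu>"
  have n: "0 < real n" using N_ang_pos[OF \<delta>] by (simp add: n_def)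
  define \<mu> where "\<mu> = nat \<lfloor>real n * t / (2 * pi)\<rfloor>"
  have "0 \<le> real n * t / (2 * pi)" using n t by simp
  then have 1: "real \<mu> \<le> real n * t / (2 * pi)" "real n * t / (2 * pi) < real \<mu> + 1"
    unfolding \<mu>_def by linarith+
  have "real n * t < real n * (2 * pi)" using t n by (intro mult_strict_left_mono) auto
  then have "real n * t / (2 * pi) < real n" by (simp add: field_simps)
  with 1(1) have "real \<mu> < real n" by (rule le_less_trans)
  moreover have "t \<in> {pocket_angle \<delta> k \<nu> \<mu> ..< pocket_angle \<delta> k \<nu> (\<mu> + 1)}"
    using 1 n by (auto simp: pocket_angle_def n_def[symmetric] field_simps)
  ultimately show ?thesis by (auto simp: n_def)
qed

lemma pocket_cover_angle:
  assumes \<delta>: "0 < \<delta>" and z: "pocket_radius \<delta> k \<nu> \<le> cmod z" "cmod z < pocket_radius \<delta> k (\<nu> + 1)"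
  shows "\<exists>\<mu><N_ang \<delta> k \<nu>. z \<in> pocket \<delta> k \<nu> \<mu>"
proof -
  have t: "0 \<le> Arg2pi z" "Arg2pi z < 2 * pi" "z = of_real (cmod z) * cis (Arg2pi z)"
    using Arg2pi[of z] by (auto simp: is_Arg_def cis_conv_exp)
  obtain \<mu> where \<mu>: "\<mu> < N_ang \<delta> k \<nu>"
    "Arg2pi z \<in> {pocket_angle \<delta> k \<nu> \<mu> ..< pocket_angle \<delta> k \<nu> (\<mu> + 1)}"
    using pocket_angle_cover[OF \<delta> t(1,2)] by blast
  have "z \<in> pocket \<delta> k \<nu> \<mu>"
    unfolding pocket_def mem_Collect_eq using z t(3) \<mu>(2)
    by (intro exI[of _ "cmod z"] exI[of _ "Arg2pi z"]) auto
  with \<mu>(1) show ?thesis by blast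
qed

lemma pocket_radius_0: "pocket_radius \<delta> k 0 = real k"
  by (simp add: pocket_radius_def)

lemma pocket_radius_N: "0 < \<delta> \<Longrightarrow> pocket_radius \<delta> k (N_rad \<delta>) = real k + 1"
  using N_rad_pos[of \<delta>] by (auto simp: pocket_radius_def intro!: real_sqrt_unique) (simp add: power2_eq_square algebra_simps)

lemma pocket_cover:
  assumes \<delta>: "0 < \<delta>"
  shows "\<exists>k \<nu> \<mu>. (k, \<nu>, \<mu>) \<in> pocket_indices \<delta> \<and> z \<in> pocket \<delta> k \<nu> \<mu>"
proof -
  define k where "k = nat \<lfloor>cmod z\<rfloor>"
  have k: "real k \<le> cmod z" "cmod z < real k + 1"
    unfolding k_def by (auto simp: of_nat_floor)
  define A where "A = {\<nu>. \<nu> < N_rad \<delta> \<and> pocket_radius \<delta> k \<nu> \<le> cmod z}"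
  have fin: "finite A" by (simp add: A_def)
  have ne: "0 \<in> A" using k N_rad_pos[OF \<delta>] by (simp add: A_def pocket_radius_0)
  \<comment> \<open>The last ring whose inner radius is at most |z|. If it is the outermost one, its
    outer radius is k + 1, which |z| does not reach.\<close>
  define \<nu> where "\<nu> = Max A"
  have \<nu>: "\<nu> \<in> A" unfolding \<nu>_def using fin ne by (intro Max_in) auto
  have "cmod z < pocket_radius \<delta> k (\<nu> + 1)"
  proof (rule ccontr)
    assume "\<not> ?thesis"
    then have ge: "pocket_radius \<delta> k (\<nu> + 1) \<le> cmod z" by simp
    show False
    proof (cases "\<nu> + 1 < N_rad \<delta>")
      case True
      then have "\<nu> + 1 \<in> A" using ge by (simp add: A_def)
      then have "\<nu> + 1 \<le> \<nu>" using fin unfolding \<nu>_def by (intro Max_ge)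
      then show False by simp
    next
      case False
      then have "\<nu> + 1 = N_rad \<delta>" using \<nu> by (simp add: A_def)
      then show False using ge k pocket_radius_N[OF \<delta>, of k] by simp
    qed
  qed
  with \<nu> obtain \<mu> where "\<mu> < N_ang \<delta> k \<nu>" "z \<in> pocket \<delta> k \<nu> \<mu>"
    using pocket_cover_angle[OF \<delta>, of k \<nu> z] by (auto simp: A_def)
  then show ?thesis using \<nu> by (auto simp: A_def pocket_indices_def)
qed

section \<open>Areas and diameters of pockets\<close>

lemma pocket_rotate:
  "z \<in> pocket \<delta> k \<nu> \<mu> \<longleftrightarrow> cis (- pocket_angle \<delta> k \<nu> \<mu>) * z \<in> pocket \<delta> k \<nu> 0"
proof
  have ang: "pocket_angle \<delta> k \<nu> (Suc \<mu>) = pocket_angle \<delta> k \<nu> \<mu> + pocket_angle \<delta> k \<nu> (Suc 0)"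
    by (simp add: pocket_angle_def algebra_simps add_divide_distrib)
  have ang0: "pocket_angle \<delta> k \<nu> 0 = 0" by (simp add: pocket_angle_def)
  {
    assume "z \<in> pocket \<delta> k \<nu> \<mu>"
    then obtain r \<theta> where "z = of_real r * cis \<theta>" "r \<in> {pocket_radius \<delta> k \<nu> ..< pocket_radius \<delta> k (\<nu> + 1)}"
      "\<theta> \<in> {pocket_angle \<delta> k \<nu> \<mu> ..< pocket_angle \<delta> k \<nu> (\<mu> + 1)}" by (auto simp: pocket_def)
    then show "cis (- pocket_angle \<delta> k \<nu> \<mu>) * z \<in> pocket \<delta> k \<nu> 0"
      unfolding pocket_def mem_Collect_eq
      by (intro exI[of _ r] exI[of _ "\<theta> - pocket_angle \<delta> k \<nu> \<mu>"])
        (auto simp: ang ang0 cis_mult algebra_simps)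
  next
    assume "cis (- pocket_angle \<delta> k \<nu> \<mu>) * z \<in> pocket \<delta> k \<nu> 0"
    then obtain r \<theta> where r: "cis (- pocket_angle \<delta> k \<nu> \<mu>) * z = of_real r * cis \<theta>"
      "r \<in> {pocket_radius \<delta> k \<nu> ..< pocket_radius \<delta> k (\<nu> + 1)}"
      "\<theta> \<in> {0 ..< pocket_angle \<delta> k \<nu> 1}" by (auto simp: pocket_def ang0)
    have "z = cis (pocket_angle \<delta> k \<nu> \<mu>) * (cis (- pocket_angle \<delta> k \<nu> \<mu>) * z)"
      by (simp add: cis_mult mult.assoc[symmetric])
    also have "\<dots> = of_real r * cis (pocket_angle \<delta> k \<nu> \<mu> + \<theta>)"
      unfolding r(1) by (simp add: cis_mult[symmetric] mult_ac)
    finally show "z \<in> pocket \<delta> k \<nu> \<mu>"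
      unfolding pocket_def mem_Collect_eq using r(2,3)
      by (intro exI[of _ r] exI[of _ "pocket_angle \<delta> k \<nu> \<mu> + \<theta>"]) (auto simp: ang)
  }
qed

text \<open>The identity that explains the radii and angular counts of the tiling: it has the same
  form for k = 0 and for k \<ge> 1, so ring area divided by number of pockets is always the
  same.\<close>

lemma pocket_radius_squared_diff:
  assumes "0 < \<delta>"
  shows "(pocket_radius \<delta> k (\<nu> + 1))\<^sup>2 - (pocket_radius \<delta> k \<nu>)\<^sup>2 =
           real (N_ang \<delta> k \<nu>) / (real (N_rad \<delta>))\<^sup>2"
  using N_rad_pos[OF assms]
  by (auto simp: pocket_radius_def N_ang_def field_simps power2_eq_square)

text \<open>A ring \<open>r\<^bsub>k,\<nu>\<^esub> \<le> |z| < r\<^bsub>k,\<nu>+1\<^esub>\<close> is the disjoint union of congruent pockets, and its area is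
  proportional to their number.\<close>

lemma emeasure_pocket:
  assumes \<delta>: "0 < \<delta>" and i: "(k, \<nu>, \<mu>) \<in> pocket_indices \<delta>"
  shows "emeasure lborel (pocket \<delta> k \<nu> \<mu>) = ennreal (pi / (real (N_rad \<delta>))\<^sup>2)"
proof -
  define a b n where "a = pocket_radius \<delta> k \<nu>" and "b = pocket_radius \<delta> k (\<nu> + 1)" and "n = N_ang \<delta> k \<nu>"
  have ab: "0 \<le> a" "a < b" unfolding a_def b_def by (rule pocket_radius_nonneg, rule pocket_radius_less[OF \<delta>])
  have n: "0 < n" by (simp add: n_def N_ang_pos[OF \<delta>])
  define e where "e = emeasure lborel (pocket \<delta> k \<nu> 0)"
  have rot: "emeasure lborel (pocket \<delta> k \<nu> \<mu>) = e" for \<mu>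
  proof -
    let ?t = "- pocket_angle \<delta> k \<nu> \<mu>"
    have "emeasure lborel (pocket \<delta> k \<nu> 0) = emeasure (distr lborel borel (\<lambda>z. cis ?t * z)) (pocket \<delta> k \<nu> 0)"
      by (simp only: distr_lborel_rotate)
    also have "\<dots> = emeasure lborel ((\<lambda>z. cis ?t * z) -` pocket \<delta> k \<nu> 0)"
      by (subst emeasure_distr) auto
    also have "(\<lambda>z. cis ?t * z) -` pocket \<delta> k \<nu> 0 = pocket \<delta> k \<nu> \<mu>"
      using pocket_rotate[of _ \<delta> k \<nu> \<mu>] by auto
    finally show ?thesis by (simp add: e_def)
  qed
  have ring: "ball 0 b - ball 0 a = (\<Union>\<mu><n. pocket \<delta> k \<nu> \<mu>)"
  proof (intro equalityI subsetI)
    fix z assume "z \<in> ball 0 b - ball (0::complex) a"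
    then show "z \<in> (\<Union>\<mu><n. pocket \<delta> k \<nu> \<mu>)"
      using pocket_cover_angle[OF \<delta>, of k \<nu> z] by (auto simp: a_def b_def n_def)
  next
    fix z assume "z \<in> (\<Union>\<mu><n. pocket \<delta> k \<nu> \<mu>)"
    then show "z \<in> ball 0 b - ball 0 a"
      using ab by (auto simp: pocket_def a_def b_def norm_mult)
  qed
  have "ennreal (real n) * e = (\<Sum>\<mu><n. emeasure lborel (pocket \<delta> k \<nu> \<mu>))"
    by (simp add: rot ennreal_of_nat_eq_real_of_nat)
  also have "\<dots> = emeasure lborel (\<Union>\<mu><n. pocket \<delta> k \<nu> \<mu>)"
  proof (rule sum_emeasure)
    show "disjoint_family_on (pocket \<delta> k \<nu>) {..<n}"
      unfolding disjoint_family_on_def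
    proof (intro ballI impI, rule ccontr)
      fix m m' assume m: "m \<in> {..<n}" "m' \<in> {..<n}" "m \<noteq> m'" "pocket \<delta> k \<nu> m \<inter> pocket \<delta> k \<nu> m' \<noteq> {}"
      then obtain z where "z \<in> pocket \<delta> k \<nu> m" "z \<in> pocket \<delta> k \<nu> m'" by blast
      then show False using pocket_index_unique'[OF \<delta>, of k \<nu> m k \<nu> m' z] m i
        by (auto simp: pocket_indices_def n_def)
    qed
  qed auto
  also have "\<dots> = emeasure lborel (ball (0::complex) b) - emeasure lborel (ball (0::complex) a)"
    unfolding ring[symmetric] using ab by (intro emeasure_Diff) (auto simp: emeasure_ball)
  also have "\<dots> = ennreal (pi * b\<^sup>2 - pi * a\<^sup>2)"
    using ab by (simp add: emeasure_ball unit_ball_vol_2 ennreal_minus)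
  also have "pi * b\<^sup>2 - pi * a\<^sup>2 = real n * (pi / (real (N_rad \<delta>))\<^sup>2)"
    using pocket_radius_squared_diff[OF \<delta>, of k \<nu>]
    by (simp add: right_diff_distrib[symmetric] a_def b_def n_def)
  finally have eq: "ennreal (real n) * e = ennreal (real n) * ennreal (pi / (real (N_rad \<delta>))\<^sup>2)"
    by (simp only: ennreal_mult' of_nat_0_le_iff)
  have "e = ennreal (pi / (real (N_rad \<delta>))\<^sup>2)"
    using eq n by (simp only: ennreal_mult_cancel_left) auto
  then show ?thesis by (simp add: rot)
qed

lemma inverse_N_rad_le: "0 < \<delta> \<Longrightarrow> 1 / real (N_rad \<delta>) \<le> \<delta>"
proof -
  assume \<delta>: "0 < \<delta>"
  have "1 / \<delta> \<le> real (N_rad \<delta>)" using \<delta> by (simp add: N_rad_def of_nat_ceiling)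
  then show ?thesis using \<delta> N_rad_pos[OF \<delta>] by (simp add: field_simps)
qed

text \<open>For k \<ge> 1 divide b^2 - a^2 = (2 k + 1) / N by a + b \<ge> 2 k; since 2 k + 1 \<le> 4
  k, the quotient is at most 2/N.\<close>

lemma pocket_radius_diff_le:
  assumes \<delta>: "0 < \<delta>"
  shows "pocket_radius \<delta> k (\<nu> + 1) - pocket_radius \<delta> k \<nu> \<le> 2 * \<delta>"
proof (cases "k = 0")
  case True
  then show ?thesis using inverse_N_rad_le[OF \<delta>] \<delta>
    by (simp add: pocket_radius_def diff_divide_distrib[symmetric])
next
  case False
  define a b where "a = pocket_radius \<delta> k \<nu>" and "b = pocket_radius \<delta> k (\<nu> + 1)"
  have N: "0 < real (N_rad \<delta>)" using N_rad_pos[OF \<delta>] by simp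
  have ka: "real k \<le> a" "real k \<le> b"
    using False pocket_radius_mono[OF \<delta>, of 0 _ k] by (auto simp: a_def b_def pocket_radius_0)
  have "(b - a) * (b + a) = b\<^sup>2 - a\<^sup>2" by (simp add: power2_eq_square algebra_simps)
  also have "\<dots> = real (N_ang \<delta> k \<nu>) / (real (N_rad \<delta>))\<^sup>2"
    unfolding a_def b_def by (rule pocket_radius_squared_diff[OF \<delta>])
  also have "real (N_ang \<delta> k \<nu>) = (2 * real k + 1) * real (N_rad \<delta>)"
    using False by (simp add: N_ang_def algebra_simps)
  also have "(2 * real k + 1) * real (N_rad \<delta>) / (real (N_rad \<delta>))\<^sup>2 = (2 * real k + 1) / real (N_rad \<delta>)"
    using N by (simp only: power2_eq_square) simp
  also have "\<dots> \<le> (2 * real k + 1) * \<delta>"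
    using mult_left_mono[OF inverse_N_rad_le[OF \<delta>], of "2 * real k + 1"] by simp
  also have "\<dots> \<le> 2 * \<delta> * (b + a)"
  proof -
    have "real k \<ge> 1" using False by simp
    then have "2 * real k + 1 \<le> 2 * (real k + real k)" by simp
    also have "\<dots> \<le> 2 * (b + a)" using ka by (intro mult_left_mono add_mono) auto
    finally have "2 * real k + 1 \<le> 2 * (b + a)" .
    then have "(2 * real k + 1) * \<delta> \<le> (2 * (b + a)) * \<delta>" using \<delta> by (intro mult_right_mono) auto
    then show ?thesis by (simp add: mult_ac)
  qed
  finally have "(b - a) * (b + a) \<le> 2 * \<delta> * (b + a)" .
  moreover have "0 < b + a" using ka False by linarith
  ultimately show ?thesis unfolding a_def b_def by (simp add: mult_le_cancel_right)
qed

lemma pocket_angle_diff: "pocket_angle \<delta> k \<nu> (\<mu> + 1) - pocket_angle \<delta> k \<nu> \<mu> = 2 * pi / real (N_ang \<delta> k \<nu>)"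
  by (simp add: pocket_angle_def diff_divide_distrib[symmetric] algebra_simps)

text \<open>Bounds the arc length at the outer radius. For k = 0 the count 2 \<nu> + 1 is at least
  the ring number \<nu> + 1; for k \<ge> 1 the count (2 k + 1) N exceeds (k + 1) N.\<close>

lemma radius_angle_le:
  assumes \<delta>: "0 < \<delta>" and \<nu>: "\<nu> < N_rad \<delta>"
  shows "pocket_radius \<delta> k (\<nu> + 1) * (2 * pi / real (N_ang \<delta> k \<nu>)) \<le> 2 * pi * \<delta>"
proof -
  have N: "0 < real (N_rad \<delta>)" using N_rad_pos[OF \<delta>] by simp
  have "pocket_radius \<delta> k (\<nu> + 1) / real (N_ang \<delta> k \<nu>) \<le> 1 / real (N_rad \<delta>)"
  proof (cases "k = 0")
    case True
    then show ?thesis using N by (simp add: pocket_radius_def N_ang_def divide_simps)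
  next
    case False
    have "pocket_radius \<delta> k (\<nu> + 1) \<le> real k + 1" using \<nu> by (intro pocket_radius_bounds \<delta>) auto
    then have "pocket_radius \<delta> k (\<nu> + 1) / (2 * real k + 1) \<le> 1" by simp
    then have "pocket_radius \<delta> k (\<nu> + 1) / (2 * real k + 1) / real (N_rad \<delta>) \<le> 1 / real (N_rad \<delta>)"
      using N by (intro divide_right_mono) auto
    then show ?thesis using False by (simp add: N_ang_def algebra_simps)
  qed
  also have "\<dots> \<le> \<delta>" by (rule inverse_N_rad_le[OF \<delta>])
  finally have "2 * pi * (pocket_radius \<delta> k (\<nu> + 1) / real (N_ang \<delta> k \<nu>)) \<le> 2 * pi * \<delta>"
    by (intro mult_left_mono) auto
  then show ?thesis by (simp add: mult_ac)
qed

lemma pocket_diam: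
  assumes \<delta>: "0 < \<delta>" and i: "(k, \<nu>, \<mu>) \<in> pocket_indices \<delta>" and z: "z \<in> pocket \<delta> k \<nu> \<mu>"
  shows "cmod (z - pocket_center \<delta> k \<nu> \<mu>) \<le> 9 * \<delta>"
proof -
  define a b where "a = pocket_radius \<delta> k \<nu>" and "b = pocket_radius \<delta> k (\<nu> + 1)"
  define c d where "c = pocket_angle \<delta> k \<nu> \<mu>" and "d = pocket_angle \<delta> k \<nu> (\<mu> + 1)"
  have \<nu>: "\<nu> < N_rad \<delta>" using i by (simp add: pocket_indices_def)
  have ab: "0 \<le> a" "a < b" unfolding a_def b_def by (rule pocket_radius_nonneg, rule pocket_radius_less[OF \<delta>])
  from z obtain r \<theta> where r: "z = of_real r * cis \<theta>" "a \<le> r" "r < b" "c \<le> \<theta>" "\<theta> < d"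
    by (auto simp: pocket_def a_def b_def c_def d_def)
  have "cmod (z - pocket_center \<delta> k \<nu> \<mu>) \<le> \<bar>r - (a + b) / 2\<bar> + \<bar>(a + b) / 2\<bar> * \<bar>\<theta> - (c + d) / 2\<bar>"
    unfolding r(1) pocket_center_def a_def[symmetric] b_def[symmetric] c_def[symmetric] d_def[symmetric]
    by (rule cmod_polar_diff)
  also have "\<dots> \<le> (b - a) + b * (d - c)"
    using r ab by (intro add_mono mult_mono) (auto simp: abs_le_iff field_simps)
  also have "\<dots> \<le> 2 * \<delta> + 2 * pi * \<delta>"
    using pocket_radius_diff_le[OF \<delta>, of k \<nu>] radius_angle_le[OF \<delta> \<nu>, of k] pocket_angle_diff[of \<delta> k \<nu> \<mu>]
    by (simp add: a_def b_def c_def d_def)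
  \<comment> \<open>Origin of the constant 9: 2 + 2 pi < 9.\<close>
  also have "\<dots> \<le> 9 * \<delta>" using pi_less_4 \<delta> pi_approx by (simp add: algebra_simps)
  finally show ?thesis .
qed

text \<open>The point ranges over the whole sector of the annulus above the pocket's angles. A
  coefficient can thus be compared with values on every circle of radius in [k, k + 1), not only on
  circles meeting its pocket.\<close>

lemma pocket_sector_dist:
  assumes \<delta>: "0 < \<delta>" "\<delta> \<le> 1" and i: "(k, \<nu>, \<mu>) \<in> pocket_indices \<delta>"
    and r: "real k \<le> r" "r < real k + 1"
    and t: "pocket_angle \<delta> k \<nu> \<mu> \<le> \<theta>" "\<theta> < pocket_angle \<delta> k \<nu> (\<mu> + 1)"
  shows "cmod (of_real r * cis \<theta> - pocket_center \<delta> k \<nu> \<mu>) \<le> 9"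
proof -
  define a b where "a = pocket_radius \<delta> k \<nu>" and "b = pocket_radius \<delta> k (\<nu> + 1)"
  define c d where "c = pocket_angle \<delta> k \<nu> \<mu>" and "d = pocket_angle \<delta> k \<nu> (\<mu> + 1)"
  have \<nu>: "\<nu> < N_rad \<delta>" using i by (simp add: pocket_indices_def)
  have ab: "0 \<le> a" "a < b" unfolding a_def b_def by (rule pocket_radius_nonneg, rule pocket_radius_less[OF \<delta>(1)])
  have kab: "real k \<le> a" "b \<le> real k + 1"
    using \<nu> unfolding a_def b_def by (auto intro!: pocket_radius_bounds \<delta>)
  have "cmod (of_real r * cis \<theta> - pocket_center \<delta> k \<nu> \<mu>) \<le> \<bar>r - (a + b) / 2\<bar> + \<bar>(a + b) / 2\<bar> * \<bar>\<theta> - (c + d) / 2\<bar>"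
    unfolding pocket_center_def a_def[symmetric] b_def[symmetric] c_def[symmetric] d_def[symmetric]
    by (rule cmod_polar_diff)
  also have "\<dots> \<le> 1 + b * (d - c)"
    using r t ab kab unfolding c_def[symmetric] d_def[symmetric]
    by (intro add_mono mult_mono) (auto simp: abs_le_iff field_simps)
  also have "\<dots> \<le> 1 + 2 * pi * \<delta>"
    using radius_angle_le[OF \<delta>(1) \<nu>, of k] pocket_angle_diff[of \<delta> k \<nu> \<mu>]
    by (simp add: b_def c_def d_def)
  also have "\<dots> \<le> 1 + 2 * pi * 1" using \<delta> by (intro add_left_mono mult_left_mono) auto
  also have "\<dots> \<le> 9" using pi_less_4 by simp
  finally show ?thesis .
qed

section \<open>Convergence of the synthesis operator\<close>

text \<open>After scaling to x + y = 1 this is t \<le> t^s on [0, 1].\<close>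

lemma powr_add_le:
  fixes x y s :: real
  assumes "0 \<le> x" "0 \<le> y" "0 < s" "s \<le> 1"
  shows "(x + y) powr s \<le> x powr s + y powr s"
proof (cases "x + y = 0")
  case False
  then have xy: "x + y > 0" using assms by simp
  have *: "t \<le> t powr s" if "0 \<le> t" "t \<le> 1" for t :: real
    using powr_mono'[of s 1 t] that assms by simp
  have "1 = x / (x + y) + y / (x + y)" using xy by (simp add: add_divide_distrib[symmetric])
  also have "\<dots> \<le> (x / (x + y)) powr s + (y / (x + y)) powr s"
    using assms xy by (intro add_mono *) auto
  also have "\<dots> = (x powr s + y powr s) / (x + y) powr s"
    using assms xy by (simp add: powr_divide add_divide_distrib)
  finally show ?thesis using xy by (simp add: divide_simps)
qed (use assms in auto)

lemma powr_sum_le: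
  fixes f :: "'a \<Rightarrow> real"
  assumes "finite A" "\<And>x. x \<in> A \<Longrightarrow> 0 \<le> f x" "0 < s" "s \<le> 1"
  shows "(\<Sum>x\<in>A. f x) powr s \<le> (\<Sum>x\<in>A. f x powr s)"
  using assms(1,2)
proof (induction A rule: finite_induct)
  case (insert x A)
  have "(\<Sum>x\<in>insert x A. f x) powr s \<le> f x powr s + (\<Sum>x\<in>A. f x) powr s"
    using insert powr_add_le[of "f x" "\<Sum>x\<in>A. f x" s] assms by (auto intro: sum_nonneg)
  also have "\<dots> \<le> f x powr s + (\<Sum>x\<in>A. f x powr s)" using insert by (intro add_left_mono) auto
  finally show ?case using insert by simp
qed simp

lemma fock_mod_kernel: "fock_mod \<alpha> (fock_kernel \<alpha> w) z = exp (- (\<alpha> / 2) * (cmod (z - w))\<^sup>2)"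
proof -
  have *: "(cmod (z - w))\<^sup>2 = (cmod z)\<^sup>2 + (cmod w)\<^sup>2 - 2 * Re (cnj w * z)"
    unfolding cmod_power2 by (simp add: power2_eq_square algebra_simps)
  show ?thesis
    unfolding * by (simp add: fock_mod_def fock_kernel_def exp_add[symmetric] algebra_simps)
qed

lemma cmod_fock_kernel_le:
  assumes "\<alpha> > 0"
  shows "cmod (fock_kernel \<alpha> w z) \<le> exp (\<alpha> * cmod z * cmod w - \<alpha> / 2 * (cmod w)\<^sup>2)"
proof -
  have "Re (cnj w * z) \<le> cmod w * cmod z"
    using complex_Re_le_cmod[of "cnj w * z"] by (simp add: norm_mult)
  then have "\<alpha> * Re (cnj w * z) \<le> \<alpha> * (cmod w * cmod z)" using assms by (intro mult_left_mono) auto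
  then show ?thesis by (simp add: fock_kernel_def algebra_simps)
qed

text \<open>Completing the square. It trades a Gaussian for exp(- t) and at the same time absorbs a
  factor exp(B t); all constants with denominator 2 \<alpha> below come from here.\<close>

lemma gauss_le_exp:
  fixes \<alpha> B t :: real
  assumes "\<alpha> > 0"
  shows "B * t - \<alpha> / 2 * t\<^sup>2 \<le> (B + 1)\<^sup>2 / (2 * \<alpha>) - t"
proof -
  have "0 \<le> (\<alpha> * t - (B + 1))\<^sup>2 / (2 * \<alpha>)" using assms by simp
  also have "\<dots> = \<alpha> / 2 * t\<^sup>2 - (B + 1) * t + (B + 1)\<^sup>2 / (2 * \<alpha>)"
    using assms by (simp add: power2_eq_square field_simps)
  finally show ?thesis by (simp add: algebra_simps)
qed

lemma fock_mod_kernel_le: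
  assumes "\<alpha> > 0"
  shows "fock_mod \<alpha> (fock_kernel \<alpha> w) z \<le> exp (1 / (2 * \<alpha>)) * exp (- cmod (z - w))"
  unfolding fock_mod_kernel exp_add[symmetric] using gauss_le_exp[OF assms, of 0 "cmod (z - w)"] by simp

text \<open>By \<open>pocket_diam\<close> the bound puts every pocket within distance 1 of its
  centre, as needed for comparing exponential weights over a pocket and for
  \<open>repr_oscillation\<close>.\<close>

locale small_tiling =
  fixes \<delta> :: real
  assumes \<delta>_pos: "0 < \<delta>" and \<delta>_small: "9 * \<delta> \<le> 1"
begin

abbreviation N :: real where "N \<equiv> real (N_rad \<delta>)"

lemma N_pos: "0 < N" using N_rad_pos[OF \<delta>_pos] by simp

lemma pocketsE:
  assumes "Q \<in> pockets \<delta>"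
  obtains k \<nu> \<mu> where "(k, \<nu>, \<mu>) \<in> pocket_indices \<delta>" "Q = pocket \<delta> k \<nu> \<mu>"
    "center \<delta> Q = pocket_center \<delta> k \<nu> \<mu>"
  using assms center_pocket[OF \<delta>_pos] by (auto simp: pockets_def)

lemma sets_pockets: "Q \<in> pockets \<delta> \<Longrightarrow> Q \<in> sets borel"
  by (auto elim!: pocketsE)

lemma emeasure_pockets: "Q \<in> pockets \<delta> \<Longrightarrow> emeasure lborel Q = ennreal (pi / N\<^sup>2)"
  by (auto elim!: pocketsE simp: emeasure_pocket[OF \<delta>_pos])

lemma pockets_disjoint: "Q \<in> pockets \<delta> \<Longrightarrow> Q' \<in> pockets \<delta> \<Longrightarrow> z \<in> Q \<Longrightarrow> z \<in> Q' \<Longrightarrow> Q = Q'"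
  using pocket_index_unique'[OF \<delta>_pos] by (elim pocketsE) blast

lemma pockets_cover: "\<exists>Q\<in>pockets \<delta>. z \<in> Q"
  using pocket_cover[OF \<delta>_pos, of z] by (auto simp: pockets_def)

lemma countable_pockets: "countable (pockets \<delta>)"
proof -
  have "pockets \<delta> = (\<lambda>(k, \<nu>, \<mu>). pocket \<delta> k \<nu> \<mu>) ` pocket_indices \<delta>"
    by (auto simp: pockets_def)
  then show ?thesis by simp
qed

lemma pockets_diam: "Q \<in> pockets \<delta> \<Longrightarrow> z \<in> Q \<Longrightarrow> cmod (z - center \<delta> Q) \<le> 9 * \<delta>"
  by (auto elim!: pocketsE simp: pocket_diam[OF \<delta>_pos])

lemma pockets_diam1: "Q \<in> pockets \<delta> \<Longrightarrow> z \<in> Q \<Longrightarrow> cmod (z - center \<delta> Q) \<le> 1"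
  using pockets_diam \<delta>_small by fastforce

lemma pockets_eq_UN: "pockets \<delta> = (\<Union>k. pockets_in \<delta> k)"
proof -
  have "Q \<in> (\<Union>k. pockets_in \<delta> k)" if "Q \<in> pockets \<delta>" for Q
  proof -
    from that obtain k \<nu> \<mu> where i: "(k, \<nu>, \<mu>) \<in> pocket_indices \<delta>" "Q = pocket \<delta> k \<nu> \<mu>" by (rule pocketsE)
    then have "Q \<subseteq> annulus k" using pocket_subset_annulus[OF \<delta>_pos] by (simp add: pocket_indices_def)
    with that show ?thesis by (auto simp: pockets_in_def)
  qed
  then show ?thesis by (auto simp: pockets_in_def)
qed

lemma center_annulus:
  assumes "Q \<in> pockets_in \<delta> k" shows "real k \<le> cmod (center \<delta> Q)"
proof -
  have "Q \<in> pockets \<delta>" "Q \<subseteq> annulus k" using assms by (auto simp: pockets_in_def)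
  then have "center \<delta> Q \<in> annulus k"
    using pocket_center_in_pocket(1)[OF \<delta>_pos] by (elim pocketsE) auto
  then show ?thesis by (simp add: annulus_def)
qed

lemma sum_nn_integral_pockets_le:
  assumes [measurable]: "h \<in> borel_measurable borel" and F: "finite F" "F \<subseteq> pockets \<delta>"
  shows "(\<Sum>Q\<in>F. \<integral>\<^sup>+ w \<in> Q. h w \<partial>lborel) \<le> (\<integral>\<^sup>+ w. h w \<partial>lborel)"
proof -
  have "(\<Sum>Q\<in>F. \<integral>\<^sup>+ w \<in> Q. h w \<partial>lborel) = (\<integral>\<^sup>+ w. (\<Sum>Q\<in>F. h w * indicator Q w) \<partial>lborel)"
    using F sets_pockets by (intro nn_integral_sum[symmetric]) auto
  also have "\<dots> = (\<integral>\<^sup>+ w. h w * indicator (\<Union>F) w \<partial>lborel)"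
  proof (rule nn_integral_cong)
    fix w
    have "(\<Sum>Q\<in>F. indicator Q w) = (indicator (\<Union>Q\<in>F. Q) w :: ennreal)"
      using F pockets_disjoint unfolding disjoint_family_on_def
      by (intro indicator_UN_disjoint[symmetric]) (simp, unfold disjoint_family_on_def, blast)
    then show "(\<Sum>Q\<in>F. h w * indicator Q w) = h w * indicator (\<Union>F) w"
      by (simp add: sum_distrib_left[symmetric])
  qed
  also have "\<dots> \<le> (\<integral>\<^sup>+ w. h w \<partial>lborel)" by (intro nn_integral_mono) (simp add: indicator_def)
  finally show ?thesis .
qed

text \<open>The value at the centre is replaced by an average over the pocket, of area pi / N^2, at
  the cost of a factor exp s. This turns sums over centres into planar integrals against the
  kernel.\<close>

lemma exp_center_le:
  assumes Q: "Q \<in> pockets \<delta>" and s: "0 \<le> s"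
  shows "ennreal (exp (- s * cmod (z - center \<delta> Q))) \<le>
    ennreal (N\<^sup>2 / pi * exp s) * (\<integral>\<^sup>+ w \<in> Q. ennreal (exp (- s * cmod (z - w))) \<partial>lborel)"
proof -
  note [measurable] = sets_pockets[OF Q]
  let ?c = "ennreal (N\<^sup>2 / pi)"
  have "ennreal (exp (- s * cmod (z - center \<delta> Q))) =
      ?c * (ennreal (exp (- s * cmod (z - center \<delta> Q))) * emeasure lborel Q)"
    using N_pos by (simp add: emeasure_pockets[OF Q] ennreal_mult[symmetric])
  also have "\<dots> = ?c * (\<integral>\<^sup>+ w \<in> Q. ennreal (exp (- s * cmod (z - center \<delta> Q))) \<partial>lborel)"
    by (subst nn_integral_cmult_indicator) auto
  also have "\<dots> \<le> ?c * (\<integral>\<^sup>+ w. ennreal (exp s) * (ennreal (exp (- s * cmod (z - w))) * indicator Q w) \<partial>lborel)"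
  proof (intro mult_left_mono nn_integral_mono)
    fix w
    have "exp (- s * cmod (z - center \<delta> Q)) \<le> exp s * exp (- s * cmod (z - w))" if "w \<in> Q"
    proof -
      have "cmod (z - w) \<le> cmod (z - center \<delta> Q) + cmod (w - center \<delta> Q)"
        using norm_triangle_ineq4[of "z - center \<delta> Q" "w - center \<delta> Q"] by simp
      then have "cmod (z - w) \<le> cmod (z - center \<delta> Q) + 1" using pockets_diam1[OF Q that] by simp
      then have "s * cmod (z - w) \<le> s * (cmod (z - center \<delta> Q) + 1)" using s by (rule mult_left_mono)
      then show ?thesis unfolding exp_add[symmetric] by (simp add: algebra_simps)
    qed
    then show "ennreal (exp (- s * cmod (z - center \<delta> Q))) * indicator Q w \<le>
        ennreal (exp s) * (ennreal (exp (- s * cmod (z - w))) * indicator Q w)"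
      by (auto simp: indicator_def ennreal_mult[symmetric] intro!: ennreal_leI)
  qed simp
  also have "(\<integral>\<^sup>+ w. ennreal (exp s) * (ennreal (exp (- s * cmod (z - w))) * indicator Q w) \<partial>lborel) =
      ennreal (exp s) * (\<integral>\<^sup>+ w \<in> Q. ennreal (exp (- s * cmod (z - w))) \<partial>lborel)"
    by (rule nn_integral_cmult) measurable
  finally have "ennreal (exp (- s * cmod (z - center \<delta> Q))) \<le>
      (?c * ennreal (exp s)) * (\<integral>\<^sup>+ w \<in> Q. ennreal (exp (- s * cmod (z - w))) \<partial>lborel)"
    by (simp only: mult.assoc)
  also have "?c * ennreal (exp s) = ennreal (N\<^sup>2 / pi * exp s)" by (rule ennreal_mult[symmetric]) auto
  finally show ?thesis .
qed

text \<open>The bound is uniform in z and in the finite set, hence gives unconditional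
  summability.\<close>

lemma sum_exp_center_le:
  assumes F: "finite F" "F \<subseteq> pockets \<delta>"
  shows "(\<Sum>Q\<in>F. exp (- cmod (z - center \<delta> Q))) \<le> N\<^sup>2 / pi * exp 1 * kconst 1"
proof -
  have "ennreal (\<Sum>Q\<in>F. exp (- cmod (z - center \<delta> Q))) = (\<Sum>Q\<in>F. ennreal (exp (- 1 * cmod (z - center \<delta> Q))))"
    by (simp add: sum_ennreal)
  also have "\<dots> \<le> (\<Sum>Q\<in>F. ennreal (N\<^sup>2 / pi * exp 1) * (\<integral>\<^sup>+ w \<in> Q. ennreal (exp (- 1 * cmod (z - w))) \<partial>lborel))"
    using F by (intro sum_mono exp_center_le) auto
  also have "\<dots> \<le> ennreal (N\<^sup>2 / pi * exp 1) * (\<integral>\<^sup>+ w. ennreal (exp (- 1 * cmod (z - w))) \<partial>lborel)"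
    unfolding sum_distrib_left[symmetric] using F
    by (intro mult_left_mono sum_nn_integral_pockets_le) auto
  also have "\<dots> \<le> ennreal (N\<^sup>2 / pi * exp 1) * ennreal (kconst 1)"
    by (intro mult_left_mono kern_const_le) auto
  also have "\<dots> = ennreal (N\<^sup>2 / pi * exp 1 * kconst 1)"
    using kconst_pos[of 1] by (intro ennreal_mult[symmetric]) auto
  finally show ?thesis
    using kconst_pos[of 1] by (subst (asm) ennreal_le_iff) auto
qed

lemma summable_exp_center: "(\<lambda>Q. exp (- cmod (z - center \<delta> Q))) summable_on pockets \<delta>"
  by (rule nonneg_bdd_above_summable_on) (auto intro!: bdd_aboveI2 sum_exp_center_le)

text \<open>For |z| \<le> R and t the modulus of the centre, the term grows at most like exp((B +
  \<alpha> R) t) against exp(- \<alpha> t^2 / 2). What remains is independent of z, as the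
  Weierstrass test demands.\<close>

lemma synth_term_le:
  assumes \<alpha>: "\<alpha> > 0" and c: "cmod (c Q) \<le> A * exp (B * cmod (center \<delta> Q))" and A: "A \<ge> 0" and z: "cmod z \<le> R"
  shows "cmod (synth_term \<alpha> \<delta> c Q z) \<le> A * exp ((B + \<alpha> * R + 1)\<^sup>2 / (2 * \<alpha>)) * exp (- cmod (0 - center \<delta> Q))"
proof -
  let ?w = "cmod (center \<delta> Q)"
  define X where "X = (B + \<alpha> * R + 1)\<^sup>2 / (2 * \<alpha>)"
  have "cmod (synth_term \<alpha> \<delta> c Q z) \<le> (A * exp (B * ?w)) * exp (\<alpha> * cmod z * ?w - \<alpha> / 2 * ?w\<^sup>2)"
    unfolding synth_term_def norm_mult using A by (intro mult_mono c cmod_fock_kernel_le \<alpha>) auto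
  also have "\<dots> = A * exp (B * ?w + \<alpha> * cmod z * ?w - \<alpha> / 2 * ?w\<^sup>2)"
    by (simp add: exp_add[symmetric] algebra_simps)
  also have "\<dots> \<le> A * exp ((B + \<alpha> * R + 1)\<^sup>2 / (2 * \<alpha>) - ?w)"
  proof -
    have "\<alpha> * cmod z * ?w \<le> \<alpha> * R * ?w" using \<alpha> z by (intro mult_right_mono mult_left_mono) auto
    then have "B * ?w + \<alpha> * cmod z * ?w - \<alpha> / 2 * ?w\<^sup>2 \<le> (B + \<alpha> * R) * ?w - \<alpha> / 2 * ?w\<^sup>2"
      by (simp add: distrib_right)
    also have "\<dots> \<le> (B + \<alpha> * R + 1)\<^sup>2 / (2 * \<alpha>) - ?w" by (rule gauss_le_exp[OF \<alpha>])
    finally show ?thesis using A by (intro mult_left_mono) auto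
  qed
  also have "\<dots> = A * (exp X * exp (- ?w))"
    unfolding X_def by (simp only: exp_add[symmetric] diff_conv_add_uminus)
  finally show ?thesis unfolding X_def by (simp only: mult.assoc diff_0 norm_minus_cancel)
qed

text \<open>Stated for coefficients of exponential growth. This covers \<open>seq_space\<close> as
  well as the samples of functions in \<open>growth\<close>, to which the iteration applies before
  any mixed norm is available.\<close>

lemma synth_converges:
  assumes \<alpha>: "\<alpha> > 0" and A: "A \<ge> 0"
    and c: "\<And>Q. Q \<in> pockets \<delta> \<Longrightarrow> cmod (c Q) \<le> A * exp (B * cmod (center \<delta> Q))"
  shows "abs_loc_unif_summable (synth_term \<alpha> \<delta> c) (pockets \<delta>)"
    and "synth \<alpha> \<delta> c holomorphic_on UNIV"
    and "((\<lambda>Q. synth_term \<alpha> \<delta> c Q z) has_sum synth \<alpha> \<delta> c z) (pockets \<delta>)"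
proof -
  define M where "M R Q = A * exp ((B + \<alpha> * R + 1)\<^sup>2 / (2 * \<alpha>)) * exp (- cmod (0 - center \<delta> Q))" for R Q
  have M: "cmod (synth_term \<alpha> \<delta> c Q z) \<le> M R Q" if "Q \<in> pockets \<delta>" "cmod z \<le> R" for Q z R
    unfolding M_def by (rule synth_term_le[where A=A and B=B and R=R and c=c, OF \<alpha> c[OF that(1)] A that(2)])
  have Ms: "M R summable_on pockets \<delta>" for R
    unfolding M_def[abs_def] by (intro summable_on_cmult_right summable_exp_center)
  have abs: "(\<lambda>Q. cmod (synth_term \<alpha> \<delta> c Q z)) summable_on pockets \<delta>" for z
    using M[of _ z "cmod z"] Ms[of "cmod z"] by (intro summable_on_comparison_test[OF Ms[of "cmod z"]]) auto
  have unif: "uniform_limit K (\<lambda>F z. \<Sum>Q\<in>F. synth_term \<alpha> \<delta> c Q z) (synth \<alpha> \<delta> c) (finite_subsets_at_top (pockets \<delta>))"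
    if "K \<subseteq> cball 0 R" for K R
    unfolding synth_def[abs_def] using that
    by (intro Weierstrass_m_test_general[OF _ Ms[of R]]) (auto intro!: M)
  show "abs_loc_unif_summable (synth_term \<alpha> \<delta> c) (pockets \<delta>)"
    unfolding abs_loc_unif_summable_def
  proof (intro conjI allI impI abs)
    fix K :: "complex set" assume "compact K"
    then have "bounded K" by (rule compact_imp_bounded)
    then obtain R where "\<forall>x\<in>K. cmod x \<le> R" unfolding bounded_iff by blast
    then have "K \<subseteq> cball 0 R" by auto
    then show "uniform_limit K (\<lambda>F z. \<Sum>i\<in>F. synth_term \<alpha> \<delta> c i z) (\<lambda>z. \<Sum>\<^sub>\<infinity>i\<in>pockets \<delta>. synth_term \<alpha> \<delta> c i z) (finite_subsets_at_top (pockets \<delta>))"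
      using unif unfolding synth_def[abs_def] by blast
  qed
  show "((\<lambda>Q. synth_term \<alpha> \<delta> c Q z) has_sum synth \<alpha> \<delta> c z) (pockets \<delta>)"
    unfolding synth_def by (intro has_sum_infsum abs_summable_summable[OF abs])
  have hol: "synth \<alpha> \<delta> c holomorphic_on ball 0 R" if "R > 0" for R
  proof -
    have t: "(\<lambda>z. \<Sum>Q\<in>F. synth_term \<alpha> \<delta> c Q z) holomorphic_on S" for F S
      unfolding synth_term_def fock_kernel_def by (intro holomorphic_intros)
    have "continuous_on (cball 0 R) (synth \<alpha> \<delta> c) \<and> synth \<alpha> \<delta> c holomorphic_on ball 0 R"
      by (rule holomorphic_uniform_limit[OF _ unif[OF order_refl, of R]])
        (auto intro!: always_eventually t holomorphic_on_imp_continuous_on)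
    then show ?thesis by simp
  qed
  have "synth \<alpha> \<delta> c field_differentiable at w" for w
  proof -
    have "w \<in> ball 0 (cmod w + 1)" by simp
    then show ?thesis
      using hol[of "cmod w + 1"] holomorphic_on_imp_differentiable_at[of _ "ball 0 (cmod w + 1)" w]
      by (simp add: add_nonneg_pos)
  qed
  then show "synth \<alpha> \<delta> c holomorphic_on UNIV"
    by (simp add: holomorphic_on_def field_differentiable_at_within)
qed

text \<open>Turns a coefficient family into the step function \<open>c (pocket_of w)\<close> on the
  plane, on which means and \<open>kern\<close> can act.\<close>

definition pocket_of :: "complex \<Rightarrow> complex set" where
  "pocket_of z = (THE Q. Q \<in> pockets \<delta> \<and> z \<in> Q)"

lemma pocket_of_eq: "Q \<in> pockets \<delta> \<Longrightarrow> z \<in> Q \<Longrightarrow> pocket_of z = Q"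
  unfolding pocket_of_def using pockets_disjoint by (intro the_equality) auto

lemma pocket_of: "pocket_of z \<in> pockets \<delta>" "z \<in> pocket_of z"
  using pockets_cover[of z] pocket_of_eq by auto

lemma borel_measurable_pocket_of [measurable]:
  fixes f :: "complex set \<Rightarrow> real"
  shows "(\<lambda>z. f (pocket_of z)) \<in> borel_measurable borel"
proof (rule measurableI)
  fix A :: "real set"
  have "(\<lambda>z. f (pocket_of z)) -` A \<inter> space borel = (\<Union>Q\<in>{Q \<in> pockets \<delta>. f Q \<in> A}. Q)"
    using pocket_of pocket_of_eq by auto
  also have "\<dots> \<in> sets borel"
    using countable_pockets sets_pockets by (intro sets.countable_UN'') (auto intro: countable_subset)
  finally show "(\<lambda>z. f (pocket_of z)) -` A \<inter> space borel \<in> sets borel" .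
qed simp

text \<open>Finite partial sums satisfy the bound uniformly, since subadditivity of t^s is applied
  there and the averages over disjoint pockets add up to at most one integral. The limit inherits it
  by continuity.\<close>

lemma synth_kern_bound:
  assumes \<alpha>: "\<alpha> > 0" and s: "0 < s" "s \<le> 1" and A: "A \<ge> 0"
    and c: "\<And>Q. Q \<in> pockets \<delta> \<Longrightarrow> cmod (c Q) \<le> A * exp (B * cmod (center \<delta> Q))"
  shows "ennreal (fock_mod \<alpha> (synth \<alpha> \<delta> c) z powr s) \<le>
    ennreal (exp (1 / (2 * \<alpha>)) powr s * (N\<^sup>2 / pi * exp s)) * kern s (\<lambda>w. ennreal (cmod (c (pocket_of w)) powr s)) z"
    (is "_ \<le> ennreal (?K * ?D) * ?k")
proof -
  let ?P = "\<lambda>F z. \<Sum>Q\<in>F. synth_term \<alpha> \<delta> c Q z"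
  let ?J = "\<lambda>Q. \<integral>\<^sup>+ w \<in> Q. ennreal (exp (- s * cmod (z - w))) \<partial>lborel"
  have fin: "ennreal (fock_mod \<alpha> (?P F) z powr s) \<le> ennreal (?K * ?D) * ?k"
    if F: "finite F" "F \<subseteq> pockets \<delta>" for F
  proof -
    have "fock_mod \<alpha> (?P F) z \<le>
        (\<Sum>Q\<in>F. cmod (synth_term \<alpha> \<delta> c Q z)) * exp (- (\<alpha> / 2) * (cmod z)\<^sup>2)"
      unfolding fock_mod_def by (intro mult_right_mono norm_sum) simp
    also have "\<dots> = (\<Sum>Q\<in>F. cmod (c Q) * fock_mod \<alpha> (fock_kernel \<alpha> (center \<delta> Q)) z)"
      by (simp add: sum_distrib_right fock_mod_def synth_term_def norm_mult mult.assoc)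
    also have "\<dots> \<le> (\<Sum>Q\<in>F. cmod (c Q) * (exp (1 / (2 * \<alpha>)) * exp (- cmod (z - center \<delta> Q))))"
      by (intro sum_mono mult_left_mono fock_mod_kernel_le \<alpha>) simp
    finally have "fock_mod \<alpha> (?P F) z powr s \<le> \<dots> powr s"
      using s by (intro powr_mono2) auto
    also have "\<dots> \<le> (\<Sum>Q\<in>F. (cmod (c Q) * (exp (1 / (2 * \<alpha>)) * exp (- cmod (z - center \<delta> Q)))) powr s)"
      using s F by (intro powr_sum_le) auto
    also have "\<dots> = (\<Sum>Q\<in>F. ?K * (cmod (c Q) powr s * exp (- s * cmod (z - center \<delta> Q))))"
      by (intro sum.cong refl) (simp add: powr_mult exp_powr_real mult_ac)
    finally have "ennreal (fock_mod \<alpha> (?P F) z powr s) \<le>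
       ennreal (\<Sum>Q\<in>F. ?K * (cmod (c Q) powr s * exp (- s * cmod (z - center \<delta> Q))))"
      by (rule ennreal_leI)
    also have "\<dots> = ennreal ?K * (\<Sum>Q\<in>F. ennreal (cmod (c Q) powr s) * ennreal (exp (- s * cmod (z - center \<delta> Q))))"
      by (simp add: sum_distrib_left sum_ennreal[symmetric] ennreal_mult)
    also have "\<dots> \<le> ennreal ?K * (\<Sum>Q\<in>F. ennreal (cmod (c Q) powr s) * (ennreal ?D * ?J Q))"
      using F s by (intro mult_left_mono sum_mono exp_center_le) auto
    also have "\<dots> = ennreal (?K * ?D) * (\<Sum>Q\<in>F. ennreal (cmod (c Q) powr s) * ?J Q)"
    proof -
      have KD: "ennreal (?K * ?D) = ennreal ?K * ennreal ?D" by (rule ennreal_mult) auto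
      show ?thesis unfolding KD by (simp only: sum_distrib_left mult_ac)
    qed
    also have "(\<Sum>Q\<in>F. ennreal (cmod (c Q) powr s) * ?J Q) =
        (\<Sum>Q\<in>F. \<integral>\<^sup>+ w \<in> Q. ennreal (cmod (c (pocket_of w)) powr s) * ennreal (exp (- s * cmod (z - w))) \<partial>lborel)"
    proof (rule sum.cong[OF refl])
      fix Q assume "Q \<in> F"
      then have Q: "Q \<in> pockets \<delta>" using F by auto
      note [measurable] = sets_pockets[OF Q]
      have "ennreal (cmod (c Q) powr s) * ?J Q =
          (\<integral>\<^sup>+ w. ennreal (cmod (c Q) powr s) * (ennreal (exp (- s * cmod (z - w))) * indicator Q w) \<partial>lborel)"
        by (rule nn_integral_cmult[symmetric]) measurable
      also have "\<dots> = (\<integral>\<^sup>+ w \<in> Q. ennreal (cmod (c (pocket_of w)) powr s) * ennreal (exp (- s * cmod (z - w))) \<partial>lborel)"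
        by (intro nn_integral_cong) (auto simp: indicator_def pocket_of_eq[OF Q])
      finally show "ennreal (cmod (c Q) powr s) * ?J Q = \<dots>" .
    qed
    also have "\<dots> \<le> ?k"
      unfolding kern_def using F by (intro sum_nn_integral_pockets_le) measurable
    finally show ?thesis by (simp add: mult_left_mono)
  qed
  have "((\<lambda>F. fock_mod \<alpha> (?P F) z powr s) \<longlongrightarrow> fock_mod \<alpha> (synth \<alpha> \<delta> c) z powr s)
      (finite_subsets_at_top (pockets \<delta>))"
    using synth_converges(3)[OF \<alpha> A c, of z] s unfolding has_sum_def fock_mod_def
    by (intro tendsto_powr2 tendsto_intros) (auto intro!: always_eventually)
  then have "((\<lambda>F. ennreal (fock_mod \<alpha> (?P F) z powr s)) \<longlongrightarrow> ennreal (fock_mod \<alpha> (synth \<alpha> \<delta> c) z powr s))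
      (finite_subsets_at_top (pockets \<delta>))"
    by (rule tendsto_ennrealI)
  then show ?thesis
    by (rule tendsto_upperbound) (intro eventually_finite_subsets_at_top_weakI fin finite_subsets_at_top_neq_bot; assumption)+
qed

end

section \<open>The coefficient space\<close>

lemma enn2real_inverse: "0 < p \<Longrightarrow> p \<noteq> \<infinity> \<Longrightarrow> enn2real (inverse p) = 1 / enn2real p"
  using enn2real_pos[of p] by (cases p) (auto simp: inverse_ennreal divide_inverse)

text \<open>The crude x + y \<le> 2 max x y treats exponents below and above 1 alike.\<close>

lemma epowr_add_le: "0 < a \<Longrightarrow> epowr (x + y) a \<le> ennreal (2 powr a) * (epowr x a + epowr y a)"
proof -
  assume a: "0 < a"
  have *: "epowr (u + v) a \<le> ennreal (2 powr a) * (epowr u a + epowr v a)" if "u \<le> v" for u v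
  proof -
    have "epowr (u + v) a \<le> epowr (ennreal 2 * v) a"
      using that a by (intro epowr_mono) (auto simp: mult_2 add_right_mono)
    also have "\<dots> = ennreal (2 powr a) * epowr v a"
      using a by (subst epowr_mult) (simp_all del: ennreal_numeral)
    also have "\<dots> \<le> ennreal (2 powr a) * (epowr u a + epowr v a)" by (intro mult_left_mono) auto
    finally show ?thesis .
  qed
  show ?thesis using *[of x y] *[of y x] by (cases "x \<le> y") (auto simp: add.commute)
qed

lemma suminf_term_le:
  fixes f :: "nat \<Rightarrow> ennreal"
  shows "f k \<le> (\<Sum>k. f k)"
  using sum_le_suminf[of f "{k}"] by simp

lemma weight_pos: "weight p q k > 0"
  by (simp add: weight_def)

text \<open>Separates the radial mass 1 + k of the annulus from the angular normalisation (1 + k)^(-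
  q/p).\<close>

lemma epowr_weight:
  assumes "0 < q" "q \<noteq> \<infinity>"
  shows "weight p q k powr enn2real q = (1 + real k) * ((1 + real k) powr (- enn2real (inverse p))) powr enn2real q"
proof -
  have Q: "enn2real q > 0" using enn2real_pos assms by blast
  have "weight p q k powr enn2real q = (1 + real k) powr ((1 / enn2real q - enn2real (inverse p)) * enn2real q)"
    using assms by (simp add: weight_def enn2real_inverse powr_powr)
  also have "(1 / enn2real q - enn2real (inverse p)) * enn2real q = 1 + - enn2real (inverse p) * enn2real q"
    using Q by (simp add: algebra_simps)
  also have "(1 + real k) powr \<dots> = (1 + real k) * ((1 + real k) powr (- enn2real (inverse p))) powr enn2real q"
    by (simp only: powr_add powr_powr) simp
  finally show ?thesis .
qed

context small_tiling
begin

lemma sum_pockets_in: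
  "(\<Sum>Q\<in>pockets_in \<delta> k. f Q) = (\<Sum>\<nu><N_rad \<delta>. \<Sum>\<mu><N_ang \<delta> k \<nu>. f (pocket \<delta> k \<nu> \<mu>))"
proof -
  have "inj_on (\<lambda>(\<nu>, \<mu>). pocket \<delta> k \<nu> \<mu>) (SIGMA \<nu>:{..<N_rad \<delta>}. {..<N_ang \<delta> k \<nu>})"
  proof (rule inj_onI, clarify)
    fix \<nu> \<mu> \<nu>' \<mu>'
    assume "\<nu> < N_rad \<delta>" "\<mu> < N_ang \<delta> k \<nu>" "\<nu>' < N_rad \<delta>" "\<mu>' < N_ang \<delta> k \<nu>'"
      and eq: "pocket \<delta> k \<nu> \<mu> = pocket \<delta> k \<nu>' \<mu>'"
    then have "(k, \<nu>, \<mu>) \<in> pocket_indices \<delta>" "(k, \<nu>', \<mu>') \<in> pocket_indices \<delta>"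
      by (auto simp: pocket_indices_def)
    note i = this
    have z: "pocket_center \<delta> k \<nu> \<mu> \<in> pocket \<delta> k \<nu> \<mu>" by (rule pocket_center_in_pocket(1)[OF \<delta>_pos])
    then have "pocket_center \<delta> k \<nu> \<mu> \<in> pocket \<delta> k \<nu>' \<mu>'" unfolding eq .
    with pocket_index_unique'[OF \<delta>_pos i z] show "\<nu> = \<nu>' \<and> \<mu> = \<mu>'" by simp
  qed
  then show ?thesis
    unfolding pockets_in_eq[OF \<delta>_pos] by (subst sum.reindex) (auto simp: sum.Sigma split_def)
qed

lemma coeff_le_block:
  assumes p: "0 < p" and Q: "Q \<in> pockets_in \<delta> k"
  shows "ennreal (cmod (c Q)) \<le> block_norm \<delta> p c k"
proof (cases "p = \<infinity>")
  case True
  then show ?thesis using Q by (auto simp: block_norm_def intro: SUP_upper)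
next
  case False
  then have P: "enn2real p > 0" using p enn2real_pos by blast
  have "ennreal (cmod (c Q) powr enn2real p) \<le> (\<Sum>Q\<in>pockets_in \<delta> k. ennreal (cmod (c Q) powr enn2real p))"
    using Q finite_pockets_in[OF \<delta>_pos] by (intro member_le_sum) auto
  then show ?thesis using False P by (simp add: block_norm_def epowr_le_swap)
qed

lemma weighted_block_le:
  assumes q: "0 < q"
  shows "ennreal (weight p q k) * block_norm \<delta> p c k \<le> seq_norm \<delta> p q c"
proof (cases "q = \<infinity>")
  case True
  then show ?thesis by (auto simp: seq_norm_def intro: SUP_upper)
next
  case False
  then have "enn2real q > 0" using q enn2real_pos by blast
  then show ?thesis using False
    by (simp add: seq_norm_def epowr_le_swap suminf_term_le[of "\<lambda>k. epowr (ennreal (weight p q k) * block_norm \<delta> p c k) (enn2real q)"])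
qed

lemma block_norm_finite:
  assumes "0 < q" "c \<in> seq_space \<delta> p q"
  shows "block_norm \<delta> p c k < \<infinity>"
proof -
  have "ennreal (weight p q k) * block_norm \<delta> p c k < \<infinity>"
    using weighted_block_le[OF assms(1), of p k c] assms(2) by (simp add: seq_space_def le_less_trans)
  then show ?thesis using weight_pos[of p q k]
    by (auto simp: ennreal_mult_less_top)
qed

text \<open>A single coefficient is at most the norm divided by the weight, hence of polynomial size
  in k, and ln (1 + k) \<le> k \<le> |centre|. The exponential form is the one
  \<open>synth_converges\<close> takes.\<close>

lemma seq_space_growth:
  assumes p: "0 < p" and q: "0 < q" and c: "c \<in> seq_space \<delta> p q"
  obtains A B where "A \<ge> 0" "\<And>Q. Q \<in> pockets \<delta> \<Longrightarrow> cmod (c Q) \<le> A * exp (B * cmod (center \<delta> Q))"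
proof -
  obtain S where S: "seq_norm \<delta> p q c = ennreal S" "S \<ge> 0"
    using c by (cases "seq_norm \<delta> p q c") (auto simp: seq_space_def)
  define a where "a = enn2real (inverse q) - enn2real (inverse p)"
  have "cmod (c Q) \<le> S * exp (\<bar>a\<bar> * cmod (center \<delta> Q))" if "Q \<in> pockets \<delta>" for Q
  proof -
    from that obtain k where k: "Q \<in> pockets_in \<delta> k" using pockets_eq_UN by auto
    have "ennreal (weight p q k) * ennreal (cmod (c Q)) \<le> ennreal S"
      using mult_left_mono[OF coeff_le_block[OF p k, of c], of "ennreal (weight p q k)"] weighted_block_le[OF q, of p k c] S
      by simp
    then have "weight p q k * cmod (c Q) \<le> S"
      using S weight_pos[of p q k] by (simp add: ennreal_mult[symmetric])
    then have "cmod (c Q) \<le> S * (1 + real k) powr (- a)"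
      using weight_pos[of p q k] by (simp add: weight_def a_def[symmetric] powr_minus field_simps)
    also have "(1 + real k) powr (- a) \<le> (1 + real k) powr \<bar>a\<bar>" by (intro powr_mono) auto
    also have "\<dots> = exp (\<bar>a\<bar> * ln (1 + real k))" by (simp add: powr_def)
    also have "\<dots> \<le> exp (\<bar>a\<bar> * cmod (center \<delta> Q))"
      using ln_add_one_self_le_self[of "real k"] center_annulus[OF k] by (auto intro!: mult_left_mono)
    finally show ?thesis using S by (simp add: mult_left_mono)
  qed
  then show thesis using that S by blast
qed

lemma emeasure_sector:
  "emeasure lborel {pocket_angle \<delta> k \<nu> \<mu> ..< pocket_angle \<delta> k \<nu> (\<mu> + 1)} = ennreal (2 * pi / real (N_ang \<delta> k \<nu>))"
  using pocket_angle_less[OF \<delta>_pos, of k \<nu> \<mu>] pocket_angle_diff[of \<delta> k \<nu> \<mu>] by simp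

lemma seq_space_converges:
  assumes "\<alpha> > 0" "0 < p" "0 < q" "c \<in> seq_space \<delta> p q"
  shows "abs_loc_unif_summable (synth_term \<alpha> \<delta> c) (pockets \<delta>)"
    and "synth \<alpha> \<delta> c holomorphic_on UNIV"
    and "((\<lambda>Q. synth_term \<alpha> \<delta> c Q z) has_sum synth \<alpha> \<delta> c z) (pockets \<delta>)"
proof -
  obtain A B where "A \<ge> 0" "\<And>Q. Q \<in> pockets \<delta> \<Longrightarrow> cmod (c Q) \<le> A * exp (B * cmod (center \<delta> Q))"
    using seq_space_growth[OF assms(2-4)] by blast
  note conv = synth_converges[OF assms(1) this]
  show "abs_loc_unif_summable (synth_term \<alpha> \<delta> c) (pockets \<delta>)" by (rule conv(1))
  show "synth \<alpha> \<delta> c holomorphic_on UNIV" by (rule conv(2))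
  show "((\<lambda>Q. synth_term \<alpha> \<delta> c Q z) has_sum synth \<alpha> \<delta> c z) (pockets \<delta>)" by (rule conv(3))
qed

section \<open>From coefficients to mixed norms of step functions\<close>

text \<open>A circle of radius r meets the pockets of a single ring, each along an angle 2 pi / n.
  With n \<ge> 1 + k, and the ring sum bounded by the block sum, the normalised mean gains the
  factor (1 + k)^(- 1/p).\<close>

lemma mean_step_le:
  assumes p: "0 < p" and r: "r \<ge> 0" and k: "k = nat \<lfloor>r\<rfloor>"
  shows "mean p (\<lambda>z. ennreal (cmod (c (pocket_of z)))) r \<le>
    ennreal ((1 + real k) powr (- enn2real (inverse p))) * block_norm \<delta> p c k"
proof -
  have rk: "real k \<le> r" "r < real k + 1" using r k by (auto simp: of_nat_floor)
  have in_k: "pocket_of z \<in> pockets_in \<delta> k" if "cmod z = r" for z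
  proof -
    obtain k' where k': "pocket_of z \<in> pockets_in \<delta> k'" using pocket_of(1)[of z] unfolding pockets_eq_UN by blast
    then have "z \<in> annulus k'" using pocket_of(2)[of z] by (auto simp: pockets_in_def)
    then have "k' = k" using that rk by (auto simp: annulus_def)
    with k' show ?thesis by simp
  qed
  show ?thesis
  proof (cases "p = \<infinity>")
    case True
    have "ennreal (cmod (c (pocket_of (of_real r * cis \<theta>)))) \<le> block_norm \<delta> p c k" for \<theta>
      by (intro coeff_le_block p in_k) (use r in \<open>simp add: norm_mult\<close>)
    then show ?thesis using True by (auto simp: mean_def intro!: SUP_least)
  next
    case False
    define P where "P = enn2real p"
    have P: "P > 0" using False p by (simp add: P_def enn2real_pos)
  let ?I = "(\<integral>\<^sup>+ \<theta> \<in> {0..2 * pi}. epowr (ennreal (cmod (c (pocket_of (of_real r * cis \<theta>))))) P \<partial>lborel)"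
  let ?B = "(\<Sum>Q\<in>pockets_in \<delta> k. ennreal (cmod (c Q) powr P))"
    obtain k' \<nu> \<mu>0 where i: "(k', \<nu>, \<mu>0) \<in> pocket_indices \<delta>" "pocket_of (of_real r) = pocket \<delta> k' \<nu> \<mu>0"
      using pocket_of(1) by (rule pocketsE)
    have "of_real r \<in> pocket \<delta> k' \<nu> \<mu>0" using pocket_of(2)[of "of_real r"] i by simp
    moreover have "k' = k"
    proof -
      have "of_real r \<in> annulus k'" using calculation pocket_subset_annulus[OF \<delta>_pos] i by (auto simp: pocket_indices_def)
      then show ?thesis using rk r by (auto simp: annulus_def)
    qed
    ultimately have rad: "pocket_radius \<delta> k \<nu> \<le> r" "r < pocket_radius \<delta> k (\<nu> + 1)"
      using r by (auto simp: pocket_def dest!: arg_cong[of "of_real r" _ cmod] simp: norm_mult)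
       (smt (verit, best) pocket_radius_nonneg)+
    have \<nu>: "\<nu> < N_rad \<delta>" using i by (simp add: pocket_indices_def)
    define n where "n = N_ang \<delta> k \<nu>"
    have n: "0 < n" by (simp add: n_def N_ang_pos[OF \<delta>_pos])
    have kn: "1 + real k \<le> real n"
    proof (cases "k = 0")
      case False
      have "Suc k \<le> (2 * k + 1) * 1" by simp
      also have "\<dots> \<le> (2 * k + 1) * N_rad \<delta>" using N_rad_pos[OF \<delta>_pos] by (intro mult_left_mono) auto
      finally have "Suc k \<le> n" using False by (simp add: n_def N_ang_def)
      then show ?thesis by simp
    qed (use n in simp)
    let ?S = "\<lambda>\<mu>. {pocket_angle \<delta> k \<nu> \<mu> ..< pocket_angle \<delta> k \<nu> (\<mu> + 1)}"
    let ?f = "\<lambda>\<mu>. ennreal (cmod (c (pocket \<delta> k \<nu> \<mu>)) powr P)"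
    \<comment> \<open>Almost everywhere only: the half-open sectors omit the angle 2 pi.\<close>
    have "?I \<le>
        (\<integral>\<^sup>+ \<theta>. (\<Sum>\<mu><n. ?f \<mu> * indicator (?S \<mu>) \<theta>) \<partial>lborel)"
    proof (rule nn_integral_mono_AE, rule AE_I[where N="{2 * pi}"], rule subsetI, rule ccontr)
      fix \<theta> assume \<theta>: "\<theta> \<in> {x \<in> space lborel. \<not> epowr (ennreal (cmod (c (pocket_of (of_real r * cis x))))) P * indicator {0..2 * pi} x \<le>
          (\<Sum>\<mu><n. ?f \<mu> * indicator (?S \<mu>) x)}" "\<theta> \<notin> {2 * pi}"
      have "\<theta> \<in> {0..2 * pi}"
      proof (rule ccontr)
        assume "\<theta> \<notin> {0..2 * pi}"
        then have "indicator {0..2 * pi} \<theta> = (0 :: ennreal)" by (rule indicator_simps(2))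
        with \<theta>(1) show False by (simp only: mem_Collect_eq mult_zero_right zero_le not_True_eq_False simp_thms)
      qed
      with \<theta>(2) have t: "0 \<le> \<theta>" "\<theta> < 2 * pi" by auto
      obtain \<mu> where \<mu>: "\<mu> < n" and in_S: "\<theta> \<in> ?S \<mu>"
        using pocket_angle_cover[OF \<delta>_pos t] unfolding n_def by blast
      have "of_real r * cis \<theta> \<in> pocket \<delta> k \<nu> \<mu>"
        unfolding pocket_def mem_Collect_eq using rad in_S by (intro exI[of _ r] exI[of _ \<theta>]) auto
      moreover have "pocket \<delta> k \<nu> \<mu> \<in> pockets \<delta>"
        using \<mu> \<nu> by (auto simp: pockets_def pocket_indices_def n_def)
      ultimately have "pocket_of (of_real r * cis \<theta>) = pocket \<delta> k \<nu> \<mu>" by (intro pocket_of_eq)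
      then have "epowr (ennreal (cmod (c (pocket_of (of_real r * cis \<theta>))))) P * indicator {0..2 * pi} \<theta> = ?f \<mu> * indicator (?S \<mu>) \<theta>"
        using t in_S by simp
      also have "\<dots> \<le> (\<Sum>\<mu><n. ?f \<mu> * indicator (?S \<mu>) \<theta>)"
        using \<mu> by (intro member_le_sum) auto
      finally show False using \<theta>(1) by simp
    qed simp_all
    also have "\<dots> = (\<Sum>\<mu><n. \<integral>\<^sup>+ \<theta>. ?f \<mu> * indicator (?S \<mu>) \<theta> \<partial>lborel)"
      by (rule nn_integral_sum) simp
    also have "\<dots> = (\<Sum>\<mu><n. ?f \<mu> * ennreal (2 * pi / real n))"
    proof (rule sum.cong[OF refl])
      fix \<mu>
      have "emeasure lborel (?S \<mu>) = ennreal (2 * pi / real n)"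
        unfolding n_def by (rule emeasure_sector)
      then show "(\<integral>\<^sup>+ \<theta>. ?f \<mu> * indicator (?S \<mu>) \<theta> \<partial>lborel) = ?f \<mu> * ennreal (2 * pi / real n)"
        by (subst nn_integral_cmult_indicator) auto
    qed
    also have "\<dots> = (\<Sum>\<mu><n. ?f \<mu>) * ennreal (2 * pi / real n)" by (rule sum_distrib_right[symmetric])
    also have "\<dots> \<le> ?B * ennreal (2 * pi / (1 + real k))"
    proof (rule mult_mono)
      show "(\<Sum>\<mu><n. ?f \<mu>) \<le> ?B"
        unfolding sum_pockets_in n_def
        using \<nu> member_le_sum[of \<nu> "{..<N_rad \<delta>}" "\<lambda>\<nu>. \<Sum>\<mu><N_ang \<delta> k \<nu>. ennreal (cmod (c (pocket \<delta> k \<nu> \<mu>)) powr P)"] by auto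
      show "ennreal (2 * pi / real n) \<le> ennreal (2 * pi / (1 + real k))"
        using kn by (intro ennreal_leI divide_left_mono) auto
    qed auto
    finally have "ennreal (1 / (2 * pi)) * ?I \<le>
        ennreal (1 / (2 * pi)) * (?B * ennreal (2 * pi / (1 + real k)))"
      by (rule mult_left_mono) simp
    also have "\<dots> = (ennreal (1 / (2 * pi)) * ennreal (2 * pi / (1 + real k))) * ?B"
      by (simp only: mult_ac)
    also have "ennreal (1 / (2 * pi)) * ennreal (2 * pi / (1 + real k)) = ennreal (1 / (1 + real k))"
      by (subst ennreal_mult[symmetric]) auto
    finally have le: "ennreal (1 / (2 * pi)) * ?I \<le>
      ennreal (1 / (1 + real k)) * ?B" .
    have "mean p (\<lambda>z. ennreal (cmod (c (pocket_of z)))) r \<le>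
        epowr (ennreal (1 / (1 + real k)) * ?B) (1 / P)"
      unfolding mean_def P_def[symmetric] using False P by (simp only: if_False) (intro epowr_mono le, simp)
    also have "\<dots> = ennreal ((1 / (1 + real k)) powr (1 / P)) * block_norm \<delta> p c k"
      using P False by (simp add: epowr_mult block_norm_def P_def[symmetric])
    also have "(1 / (1 + real k)) powr (1 / P) = (1 + real k) powr (- enn2real (inverse p))"
      using p False by (simp add: enn2real_inverse P_def powr_minus_divide powr_divide)
    finally show ?thesis .
  qed
qed

lemma nn_integral_Ico_sum:
  fixes h :: "real \<Rightarrow> ennreal"
  assumes [measurable]: "h \<in> borel_measurable borel"
  shows "(\<integral>\<^sup>+ r \<in> {0..}. h r \<partial>lborel) = (\<Sum>k. \<integral>\<^sup>+ r \<in> {real k..<real k + 1}. h r \<partial>lborel)"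
proof -
  have U: "{0..} = (\<Union>k. {real k..<real k + 1})"
  proof (intro equalityI subsetI)
    fix x :: real assume "x \<in> {0..}"
    then have "x \<in> {real (nat \<lfloor>x\<rfloor>)..<real (nat \<lfloor>x\<rfloor>) + 1}" by (auto simp: of_nat_floor)
    then show "x \<in> (\<Union>k. {real k..<real k + 1})" by blast
  qed auto
  have "disjoint_family (\<lambda>k. {real k..<real k + 1})"
    by (auto simp: disjoint_family_on_def)
  then show ?thesis unfolding U by (intro nn_integral_disjoint_family) auto
qed

text \<open>On [k, k + 1) the density r is at most 1 + k, exactly the part of the weight isolated by
  \<open>epowr_weight\<close>.\<close>

lemma mixed_step_le:
  assumes p: "0 < p" and q: "0 < q"
  shows "mixed q (\<lambda>r. ennreal ((1 + real (nat \<lfloor>r\<rfloor>)) powr (- enn2real (inverse p))) * block_norm \<delta> p c (nat \<lfloor>r\<rfloor>))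
    \<le> seq_norm \<delta> p q c"
proof (cases "q = \<infinity>")
  case True
  then have "weight p q k = (1 + real k) powr (- enn2real (inverse p))" for k
    by (simp add: weight_def)
  then have "ennreal ((1 + real k) powr (- enn2real (inverse p))) * block_norm \<delta> p c k \<le> seq_norm \<delta> p q c" for k
    using weighted_block_le[OF q, of p k c] by simp
  then show ?thesis unfolding mixed_def using True by (simp only: if_True refl) (intro SUP_least)
next
  case False
  define Q where "Q = enn2real q"
  have Q: "Q > 0" using False q by (simp add: Q_def enn2real_pos)
  define g where "g k = ennreal ((1 + real k) powr (- enn2real (inverse p))) * block_norm \<delta> p c k" for k
  have [measurable]: "(\<lambda>r::real. g (nat \<lfloor>r\<rfloor>)) \<in> borel_measurable borel"
    by (rule measurable_compose[of _ _ "count_space UNIV"]) auto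
  have "(\<integral>\<^sup>+ r \<in> {0..}. epowr (g (nat \<lfloor>r\<rfloor>)) Q * ennreal r \<partial>lborel) =
      (\<Sum>k. \<integral>\<^sup>+ r \<in> {real k..<real k + 1}. epowr (g (nat \<lfloor>r\<rfloor>)) Q * ennreal r \<partial>lborel)"
    by (rule nn_integral_Ico_sum) measurable
  also have "\<dots> \<le> (\<Sum>k. epowr (ennreal (weight p q k) * block_norm \<delta> p c k) Q)"
  proof (rule suminf_le)
    fix k :: nat
    have "(\<integral>\<^sup>+ r \<in> {real k..<real k + 1}. epowr (g (nat \<lfloor>r\<rfloor>)) Q * ennreal r \<partial>lborel) \<le>
        (\<integral>\<^sup>+ r \<in> {real k..<real k + 1}. epowr (g k) Q * ennreal (1 + real k) \<partial>lborel)"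
    proof (rule nn_integral_mono)
      fix r :: real
      have *: "nat \<lfloor>r\<rfloor> = k" "ennreal r \<le> ennreal (1 + real k)" if "r \<in> {real k..<real k + 1}"
      proof -
        have "\<lfloor>r\<rfloor> = int k" using that by (intro floor_unique) auto
        then show "nat \<lfloor>r\<rfloor> = k" by simp
        show "ennreal r \<le> ennreal (1 + real k)" using that by (intro ennreal_leI) auto
      qed
      show "epowr (g (nat \<lfloor>r\<rfloor>)) Q * ennreal r * indicator {real k..<real k + 1} r \<le>
          epowr (g k) Q * ennreal (1 + real k) * indicator {real k..<real k + 1} r"
      proof (cases "r \<in> {real k..<real k + 1}")
        case True
        show ?thesis unfolding *(1)[OF True] by (intro mult_right_mono mult_left_mono *(2)[OF True]) auto
      qed simp
    qed
    also have "\<dots> = epowr (g k) Q * ennreal (1 + real k)"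
      by (subst nn_integral_cmult_indicator) auto
    also have "\<dots> = epowr (ennreal (weight p q k) * block_norm \<delta> p c k) Q"
      using Q epowr_weight[OF q False, of p k] weight_pos[of p q k]
      by (simp add: g_def epowr_mult Q_def[symmetric] ennreal_mult mult_ac)
    finally show "(\<integral>\<^sup>+ r \<in> {real k..<real k + 1}. epowr (g (nat \<lfloor>r\<rfloor>)) Q * ennreal r \<partial>lborel) \<le>
      epowr (ennreal (weight p q k) * block_norm \<delta> p c k) Q" .
  qed auto
  finally show ?thesis using False Q
    unfolding mixed_def seq_norm_def Q_def[symmetric] g_def[symmetric] by (simp add: epowr_mono)
qed

section \<open>From means over circles to coefficients\<close>

text \<open>Converse direction to \<open>mean_step_le\<close>. The hypothesis compares a coefficient
  with G throughout its sector, so for each ring the sectors together make up the full circle of any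
  radius r in the annulus. There are N rings of at most 2 N (1 + k) pockets each.\<close>

lemma block_le_mean:
  assumes p: "0 < p" and D: "D > 0" and [measurable]: "G \<in> borel_measurable borel"
    and le: "\<And>k \<nu> \<mu> r \<theta>. (k, \<nu>, \<mu>) \<in> pocket_indices \<delta> \<Longrightarrow> real k \<le> r \<Longrightarrow> r < real k + 1 \<Longrightarrow>
      pocket_angle \<delta> k \<nu> \<mu> \<le> \<theta> \<Longrightarrow> \<theta> < pocket_angle \<delta> k \<nu> (\<mu> + 1) \<Longrightarrow>
      ennreal (cmod (c (pocket \<delta> k \<nu> \<mu>))) \<le> ennreal D * G (of_real r * cis \<theta>)"
    and r: "real k \<le> r" "r < real k + 1"
  shows "block_norm \<delta> p c k \<le>
    ennreal (D * (2 * N\<^sup>2) powr enn2real (inverse p) * (1 + real k) powr enn2real (inverse p)) * mean p G r"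
proof (cases "p = \<infinity>")
  case True
  have "ennreal (cmod (c Q)) \<le> ennreal D * mean p G r" if "Q \<in> pockets_in \<delta> k" for Q
  proof -
    from that obtain \<nu> \<mu> where Q: "Q = pocket \<delta> k \<nu> \<mu>" "(k, \<nu>, \<mu>) \<in> pocket_indices \<delta>"
      unfolding pockets_in_eq[OF \<delta>_pos] by (auto simp: pocket_indices_def)
    have "ennreal (cmod (c Q)) \<le> ennreal D * G (of_real r * cis (pocket_angle \<delta> k \<nu> \<mu>))"
      unfolding Q(1) using pocket_angle_less[OF \<delta>_pos, of k \<nu> \<mu>] by (intro le Q r) auto
    also have "\<dots> \<le> ennreal D * mean p G r"
      using True by (intro mult_left_mono) (auto simp: mean_def intro: SUP_upper)
    finally show ?thesis .
  qed
  then show ?thesis using True N_pos by (auto simp: block_norm_def intro!: SUP_least)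
next
  case False
  define P where "P = enn2real p"
  have P: "P > 0" using False p by (simp add: P_def enn2real_pos)
  have "(\<lambda>x. of_real r * cis x) \<in> borel_measurable borel"
    by (intro borel_measurable_continuous_onI continuous_intros)
  then have Gm: "(\<lambda>x. G (of_real r * cis x)) \<in> borel_measurable lborel"
    unfolding measurable_lborel1 measurable_lborel2 by (rule measurable_compose[OF _ assms(3)])
  define X where "X = ennreal (D powr P) * epowr (mean p G r) P"
  let ?f = "\<lambda>\<nu> \<mu>. ennreal (cmod (c (pocket \<delta> k \<nu> \<mu>)) powr P)"
  have ring: "(\<Sum>\<mu><N_ang \<delta> k \<nu>. ?f \<nu> \<mu>) \<le> ennreal (real (N_ang \<delta> k \<nu>)) * X" if \<nu>: "\<nu> < N_rad \<delta>" for \<nu>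
  proof -
    define n where "n = N_ang \<delta> k \<nu>"
    have n: "0 < n" by (simp add: n_def N_ang_pos[OF \<delta>_pos])
    let ?S = "\<lambda>\<mu>. {pocket_angle \<delta> k \<nu> \<mu> ..< pocket_angle \<delta> k \<nu> (\<mu> + 1)}"
    let ?g = "\<lambda>\<theta>. ennreal (D powr P) * epowr (G (of_real r * cis \<theta>)) P"
    have "(\<Sum>\<mu><n. ?f \<nu> \<mu>) * ennreal (2 * pi / real n) = (\<Sum>\<mu><n. \<integral>\<^sup>+ \<theta>. ?f \<nu> \<mu> * indicator (?S \<mu>) \<theta> \<partial>lborel)"
      unfolding sum_distrib_right
    proof (rule sum.cong[OF refl])
      fix \<mu>
      have "emeasure lborel (?S \<mu>) = ennreal (2 * pi / real n)"
        unfolding n_def by (rule emeasure_sector)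
      then show "?f \<nu> \<mu> * ennreal (2 * pi / real n) = (\<integral>\<^sup>+ \<theta>. ?f \<nu> \<mu> * indicator (?S \<mu>) \<theta> \<partial>lborel)"
        by (subst nn_integral_cmult_indicator) auto
    qed
    also have "\<dots> \<le> (\<Sum>\<mu><n. \<integral>\<^sup>+ \<theta>. ?g \<theta> * indicator (?S \<mu>) \<theta> \<partial>lborel)"
    proof (intro sum_mono nn_integral_mono)
      fix \<mu> \<theta> assume "\<mu> \<in> {..<n}"
      then have i: "(k, \<nu>, \<mu>) \<in> pocket_indices \<delta>" using \<nu> by (simp add: pocket_indices_def n_def)
      have "?f \<nu> \<mu> \<le> ?g \<theta>" if "\<theta> \<in> ?S \<mu>"
      proof -
        have "epowr (ennreal (cmod (c (pocket \<delta> k \<nu> \<mu>)))) P \<le> epowr (ennreal D * G (of_real r * cis \<theta>)) P"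
          using that P by (intro epowr_mono le i r) auto
        then show ?thesis using P D by (simp add: epowr_mult)
      qed
      then show "?f \<nu> \<mu> * indicator (?S \<mu>) \<theta> \<le> ?g \<theta> * indicator (?S \<mu>) \<theta>"
        by (auto simp: indicator_def)
    qed
    also have "\<dots> = (\<integral>\<^sup>+ \<theta>. (\<Sum>\<mu><n. ?g \<theta> * indicator (?S \<mu>) \<theta>) \<partial>lborel)"
      by (intro nn_integral_sum[symmetric] borel_measurable_times_ennreal borel_measurable_epowr borel_measurable_indicator Gm) simp_all
    also have "\<dots> \<le> (\<integral>\<^sup>+ \<theta> \<in> {0..2 * pi}. ?g \<theta> \<partial>lborel)"
    proof (rule nn_integral_mono)
      fix \<theta> :: real
      have dis: "disjoint_family_on ?S {..<n}"
        unfolding disjoint_family_on_def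
      proof (intro ballI impI)
        fix m m' :: nat assume "m \<noteq> m'"
        then consider "m + 1 \<le> m'" | "m' + 1 \<le> m" by linarith
        then show "?S m \<inter> ?S m' = {}"
          using pocket_angle_mono[of "m + 1" m' \<delta> k \<nu>] pocket_angle_mono[of "m' + 1" m \<delta> k \<nu>] by cases auto
      qed
      have "(\<Sum>\<mu><n. indicator (?S \<mu>) \<theta>) = (indicator (\<Union>\<mu><n. ?S \<mu>) \<theta> :: ennreal)"
        by (rule indicator_UN_disjoint[OF _ dis, symmetric]) simp
      also have "\<dots> \<le> indicator {0..2 * pi} \<theta>"
      proof -
        have "?S \<mu> \<subseteq> {0..2 * pi}" if "\<mu> < n" for \<mu>
          using that pocket_angle_bounds[OF \<delta>_pos, of \<mu> k \<nu>] pocket_angle_bounds[OF \<delta>_pos, of "\<mu> + 1" k \<nu>]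
          by (auto simp: n_def)
        then have "(\<Union>\<mu><n. ?S \<mu>) \<subseteq> {0..2 * pi}" by blast
        moreover have "indicator U \<theta> \<le> (indicator V \<theta> :: ennreal)" if "U \<subseteq> V" for U V :: "real set"
          using that by (auto simp: indicator_def)
        ultimately show ?thesis by blast
      qed
      finally show "(\<Sum>\<mu><n. ?g \<theta> * indicator (?S \<mu>) \<theta>) \<le> ?g \<theta> * indicator {0..2 * pi} \<theta>"
        by (simp only: sum_distrib_left[symmetric] mult_left_mono zero_le)
    qed
    also have "\<dots> = (\<integral>\<^sup>+ \<theta>. ennreal (D powr P) * (epowr (G (of_real r * cis \<theta>)) P * indicator {0..2 * pi} \<theta>) \<partial>lborel)"
      by (simp add: mult.assoc)
    also have "\<dots> = ennreal (D powr P) * (\<integral>\<^sup>+ \<theta> \<in> {0..2 * pi}. epowr (G (of_real r * cis \<theta>)) P \<partial>lborel)"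
      by (intro nn_integral_cmult borel_measurable_times_ennreal borel_measurable_epowr borel_measurable_indicator Gm) simp_all
    also have "\<dots> = ennreal (2 * pi) * X"
    proof -
      have "ennreal (2 * pi) * epowr (mean p G r) P =
          (ennreal (2 * pi) * ennreal (1 / (2 * pi))) * (\<integral>\<^sup>+ \<theta> \<in> {0..2 * pi}. epowr (G (of_real r * cis \<theta>)) P \<partial>lborel)"
        using False P unfolding mean_def P_def[symmetric] by (simp add: epowr_inverse mult.assoc)
      also have "ennreal (2 * pi) * ennreal (1 / (2 * pi)) = 1" by (subst ennreal_mult[symmetric]) auto
      finally show ?thesis unfolding X_def by (simp only: mult_1 mult.left_commute)
    qed
    finally have "ennreal (real n / (2 * pi)) * ((\<Sum>\<mu><n. ?f \<nu> \<mu>) * ennreal (2 * pi / real n)) \<le> ennreal (real n / (2 * pi)) * (ennreal (2 * pi) * X)"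
      by (rule mult_left_mono) simp
    also have "ennreal (real n / (2 * pi)) * (ennreal (2 * pi) * X) = (ennreal (real n / (2 * pi)) * ennreal (2 * pi)) * X"
      by (simp only: mult.assoc)
    also have "ennreal (real n / (2 * pi)) * ennreal (2 * pi) = ennreal (real n)"
      by (subst ennreal_mult[symmetric]) auto
    also have "ennreal (real n / (2 * pi)) * ((\<Sum>\<mu><n. ?f \<nu> \<mu>) * ennreal (2 * pi / real n)) =
        (ennreal (real n / (2 * pi)) * ennreal (2 * pi / real n)) * (\<Sum>\<mu><n. ?f \<nu> \<mu>)"
      by (simp only: mult_ac)
    also have "ennreal (real n / (2 * pi)) * ennreal (2 * pi / real n) = 1"
      using n by (subst ennreal_mult[symmetric]) auto
    finally show ?thesis by (simp add: n_def)
  qed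
  have "(\<Sum>Q\<in>pockets_in \<delta> k. ennreal (cmod (c Q) powr P)) \<le> (\<Sum>\<nu><N_rad \<delta>. ennreal (2 * N * (1 + real k)) * X)"
    unfolding sum_pockets_in
  proof (rule sum_mono)
    fix \<nu> assume \<nu>: "\<nu> \<in> {..<N_rad \<delta>}"
    \<comment> \<open>Holds for k = 0 too, since 2 \<nu> + 1 < 2 N for \<nu> < N.\<close>
    have "real (N_ang \<delta> k \<nu>) \<le> 2 * N * (1 + real k)"
    proof -
      have "N_ang \<delta> k \<nu> \<le> 2 * N_rad \<delta> * (1 + k)"
        using \<nu> by (auto simp: N_ang_def algebra_simps)
      then have "real (N_ang \<delta> k \<nu>) \<le> real (2 * N_rad \<delta> * (1 + k))" by (simp only: of_nat_le_iff)
      then show ?thesis by (simp add: distrib_left)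
    qed
    then have "ennreal (real (N_ang \<delta> k \<nu>)) * X \<le> ennreal (2 * N * (1 + real k)) * X"
      by (intro mult_right_mono ennreal_leI) auto
    with ring[of \<nu>] \<nu> show "(\<Sum>\<mu><N_ang \<delta> k \<nu>. ?f \<nu> \<mu>) \<le> ennreal (2 * N * (1 + real k)) * X" by auto
  qed
  also have "\<dots> = ennreal (2 * N\<^sup>2 * (1 + real k)) * X"
  proof -
    have "(\<Sum>\<nu><N_rad \<delta>. ennreal (2 * N * (1 + real k)) * X) = (ennreal N * ennreal (2 * N * (1 + real k))) * X"
      by (simp add: ennreal_of_nat_eq_real_of_nat mult.assoc)
    also have "ennreal N * ennreal (2 * N * (1 + real k)) = ennreal (2 * N\<^sup>2 * (1 + real k))"
      by (subst ennreal_mult[symmetric]) (auto simp: power2_eq_square mult_ac)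
    finally show ?thesis .
  qed
  finally have "block_norm \<delta> p c k \<le> epowr (ennreal (2 * N\<^sup>2 * (1 + real k)) * X) (1 / P)"
    using False P by (simp add: block_norm_def P_def[symmetric] epowr_mono)
  also have "\<dots> = ennreal ((2 * N\<^sup>2 * (1 + real k)) powr (1 / P)) * (ennreal D * mean p G r)"
    unfolding X_def using P D N_pos by (simp add: epowr_mult epowr_inverse powr_powr)
  also have "\<dots> = ennreal (D * (2 * N\<^sup>2) powr enn2real (inverse p) * (1 + real k) powr enn2real (inverse p)) * mean p G r"
    using P D N_pos p False
    by (simp add: enn2real_inverse P_def powr_mult ennreal_mult mult_ac)
  finally show ?thesis .
qed

text \<open>The block bound holds for every radius in the annulus, so it can be averaged in
  r.\<close>

lemma seq_norm_le_mixed: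
  assumes p: "0 < p" and q: "0 < q" and K: "K > 0" and [measurable]: "m \<in> borel_measurable borel"
    and le: "\<And>k r. real k \<le> r \<Longrightarrow> r < real k + 1 \<Longrightarrow>
      block_norm \<delta> p c k \<le> ennreal (K * (1 + real k) powr enn2real (inverse p)) * m r"
  shows "seq_norm \<delta> p q c \<le> ennreal (K * 4 powr enn2real (inverse q)) * mixed q m"
proof -
  define v where "v k = (1 + real k) powr (- enn2real (inverse p))" for k
  have le': "ennreal (v k) * block_norm \<delta> p c k \<le> ennreal K * m r" if "real k \<le> r" "r < real k + 1" for k r
  proof -
    have "ennreal (v k) * block_norm \<delta> p c k \<le> ennreal (v k) * (ennreal (K * (1 + real k) powr enn2real (inverse p)) * m r)"
      by (intro mult_left_mono le that) simp
    also have "\<dots> = (ennreal (v k) * ennreal (K * (1 + real k) powr enn2real (inverse p))) * m r"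
      by (simp only: mult.assoc)
    also have "ennreal (v k) * ennreal (K * (1 + real k) powr enn2real (inverse p)) = ennreal K"
      using K by (subst ennreal_mult[symmetric]) (auto simp: v_def powr_minus field_simps)
    finally show ?thesis .
  qed
  show ?thesis
  proof (cases "q = \<infinity>")
    case True
    have "ennreal (weight p q k) * block_norm \<delta> p c k \<le> ennreal K * mixed q m" for k
    proof -
      have "ennreal (weight p q k) * block_norm \<delta> p c k \<le> ennreal K * m (real k)"
        using le'[of k "real k"] True by (simp add: weight_def v_def)
      also have "\<dots> \<le> ennreal K * mixed q m"
        using True by (intro mult_left_mono) (auto simp: mixed_def intro: SUP_upper)
      finally show ?thesis .
    qed
    then show ?thesis using True by (auto simp: seq_norm_def intro!: SUP_least)
  next
    case False
    define Q where "Q = enn2real q"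
    have Q: "Q > 0" using False q by (simp add: Q_def enn2real_pos)
    let ?h = "\<lambda>r. ennreal (4 * K powr Q) * (epowr (m r) Q * ennreal r)"
    have "(\<Sum>k. epowr (ennreal (weight p q k) * block_norm \<delta> p c k) Q) \<le>
        (\<Sum>k. \<integral>\<^sup>+ r \<in> {real k..<real k + 1}. ?h r \<partial>lborel)"
    proof (rule suminf_le)
      fix k :: nat
      \<comment> \<open>Averaging over the outer half avoids the degeneration of r dr at r = 0.
        There 1 + k \<le> 2 r, also for k = 0; with the length 1/2 this gives the constant
        4.\<close>
      let ?J = "{real k + 1 / 2..<real k + 1}"
      let ?b = "epowr (ennreal (weight p q k) * block_norm \<delta> p c k) Q"
      have b: "?b = ennreal (1 + real k) * epowr (ennreal (v k) * block_norm \<delta> p c k) Q"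
        using Q epowr_weight[OF q False, of p k] weight_pos[of p q k]
        by (simp add: epowr_mult Q_def[symmetric] v_def ennreal_mult mult_ac)
      have "?b = ennreal 2 * ?b * emeasure lborel ?J"
      proof -
        have "ennreal 2 * ?b * emeasure lborel ?J = (ennreal 2 * ennreal (1 / 2)) * ?b" by (simp add: mult_ac)
        also have "ennreal 2 * ennreal (1 / 2) = 1" by (subst ennreal_mult[symmetric]) auto
        finally show ?thesis by simp
      qed
      also have "\<dots> = (\<integral>\<^sup>+ r \<in> ?J. ennreal 2 * ?b \<partial>lborel)"
        by (subst nn_integral_cmult_indicator) auto
      also have "\<dots> \<le> (\<integral>\<^sup>+ r \<in> {real k..<real k + 1}. ?h r \<partial>lborel)"
      proof (rule nn_integral_mono)
        fix r :: real
        have "ennreal 2 * ?b \<le> ?h r" if r: "r \<in> ?J"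
        proof -
          have "ennreal 2 * ?b \<le> ennreal 2 * (ennreal (2 * r) * epowr (ennreal K * m r) Q)"
            unfolding b using r Q by (intro mult_left_mono mult_mono epowr_mono le' ennreal_leI) auto
          also have "\<dots> = ?h r"
            using Q K r by (simp add: epowr_mult ennreal_mult mult_ac)
          finally show ?thesis .
        qed
        then show "ennreal 2 * ?b * indicator ?J r \<le> ?h r * indicator {real k..<real k + 1} r"
          by (cases "r \<in> ?J") (auto simp: indicator_def)
      qed
      finally show "?b \<le> (\<integral>\<^sup>+ r \<in> {real k..<real k + 1}. ?h r \<partial>lborel)" .
    qed auto
    also have "\<dots> = (\<integral>\<^sup>+ r \<in> {0..}. ?h r \<partial>lborel)"
      by (rule nn_integral_Ico_sum[symmetric]) measurable
    also have "\<dots> = (\<integral>\<^sup>+ r. ennreal (4 * K powr Q) * (epowr (m r) Q * ennreal r * indicator {0..} r) \<partial>lborel)"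
      by (simp add: mult.assoc)
    also have "\<dots> = ennreal (4 * K powr Q) * (\<integral>\<^sup>+ r \<in> {0..}. epowr (m r) Q * ennreal r \<partial>lborel)"
      by (rule nn_integral_cmult) measurable
    finally have "seq_norm \<delta> p q c \<le> epowr (ennreal (4 * K powr Q) * (\<integral>\<^sup>+ r \<in> {0..}. epowr (m r) Q * ennreal r \<partial>lborel)) (1 / Q)"
      unfolding seq_norm_def Q_def[symmetric] using False Q by (simp add: epowr_mono)
    also have "\<dots> = ennreal ((4 * K powr Q) powr (1 / Q)) * mixed q m"
      using False Q K by (simp add: epowr_mult mixed_def Q_def[symmetric])
    also have "(4 * K powr Q) powr (1 / Q) = K * 4 powr enn2real (inverse q)"
      using False q Q K by (simp add: powr_mult powr_powr enn2real_inverse Q_def mult.commute)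
    finally show ?thesis .
  qed
qed

text \<open>K must not depend on k, so that the bound can be summed over the blocks. The factor 2
  appears once inside the p-th power and once for the outer root.\<close>

lemma block_norm_lincomb:
  assumes p: "0 < p"
  shows "\<exists>K. \<forall>k. block_norm \<delta> p (\<lambda>Q. a * c Q + b * d Q) k \<le> ennreal K * (block_norm \<delta> p c k + block_norm \<delta> p d k)"
proof (cases "p = \<infinity>")
  case True
  define K where "K = max (cmod a) (cmod b)"
  have K: "K \<ge> 0" by (simp add: K_def le_max_iff_disj)
  have "ennreal (cmod (a * c Q + b * d Q)) \<le> ennreal K * (block_norm \<delta> p c k + block_norm \<delta> p d k)"
    if Q: "Q \<in> pockets_in \<delta> k" for Q k
  proof -
    have "cmod (a * c Q + b * d Q) \<le> cmod a * cmod (c Q) + cmod b * cmod (d Q)"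
      by (metis norm_mult norm_triangle_ineq)
    also have "\<dots> \<le> K * cmod (c Q) + K * cmod (d Q)"
      by (intro add_mono mult_right_mono) (auto simp: K_def)
    finally have "ennreal (cmod (a * c Q + b * d Q)) \<le> ennreal (K * (cmod (c Q) + cmod (d Q)))"
      by (intro ennreal_leI) (simp add: distrib_left)
    also have "\<dots> = ennreal K * (ennreal (cmod (c Q)) + ennreal (cmod (d Q)))"
      using K by (simp add: ennreal_mult)
    also have "\<dots> \<le> ennreal K * (block_norm \<delta> p c k + block_norm \<delta> p d k)"
      by (intro mult_left_mono add_mono coeff_le_block p Q) simp
    finally show ?thesis .
  qed
  then show ?thesis using True by (intro exI[of _ K] allI) (subst block_norm_def, auto intro!: SUP_least)
next
  case False
  define P where "P = enn2real p"
  have P: "P > 0" using False p by (simp add: P_def enn2real_pos)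
  define L where "L = max (cmod a) (cmod b)"
  have L: "L \<ge> 0" by (simp add: L_def le_max_iff_disj)
  let ?S = "\<lambda>c k. \<Sum>Q\<in>pockets_in \<delta> k. ennreal (cmod (c Q) powr P)"
  have "block_norm \<delta> p (\<lambda>Q. a * c Q + b * d Q) k \<le> ennreal (L * 2 * 2 powr (1 / P)) * (block_norm \<delta> p c k + block_norm \<delta> p d k)" for k
  proof -
    have "?S (\<lambda>Q. a * c Q + b * d Q) k \<le> (\<Sum>Q\<in>pockets_in \<delta> k. ennreal ((L * 2) powr P) * (ennreal (cmod (c Q) powr P) + ennreal (cmod (d Q) powr P)))"
    proof (rule sum_mono)
      fix Q
      have "cmod (a * c Q + b * d Q) \<le> cmod a * cmod (c Q) + cmod b * cmod (d Q)"
        by (metis norm_mult norm_triangle_ineq)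
      also have "\<dots> \<le> L * cmod (c Q) + L * cmod (d Q)"
        by (intro add_mono mult_right_mono) (auto simp: L_def)
      finally have "ennreal (cmod (a * c Q + b * d Q)) \<le> ennreal L * (ennreal (cmod (c Q)) + ennreal (cmod (d Q)))"
        using L by (simp add: ennreal_mult[symmetric] distrib_left[symmetric] ennreal_plus[symmetric] ennreal_leI del: ennreal_plus)
      then have "epowr (ennreal (cmod (a * c Q + b * d Q))) P \<le> epowr (ennreal L * (ennreal (cmod (c Q)) + ennreal (cmod (d Q)))) P"
        using P by (intro epowr_mono) auto
      also have "\<dots> = ennreal (L powr P) * epowr (ennreal (cmod (c Q)) + ennreal (cmod (d Q))) P"
        using P L by (simp add: epowr_mult)
      also have "\<dots> \<le> ennreal (L powr P) * (ennreal (2 powr P) * (epowr (ennreal (cmod (c Q))) P + epowr (ennreal (cmod (d Q))) P))"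
        using P by (intro mult_left_mono epowr_add_le) auto
      finally show "ennreal (cmod (a * c Q + b * d Q) powr P) \<le> ennreal ((L * 2) powr P) * (ennreal (cmod (c Q) powr P) + ennreal (cmod (d Q) powr P))"
        using L by (simp add: powr_mult ennreal_mult mult.assoc)
    qed
    also have "\<dots> = ennreal ((L * 2) powr P) * (?S c k + ?S d k)"
      by (simp only: sum_distrib_left[symmetric] sum.distrib)
    finally have "epowr (?S (\<lambda>Q. a * c Q + b * d Q) k) (1 / P) \<le> epowr (ennreal ((L * 2) powr P) * (?S c k + ?S d k)) (1 / P)"
      using P by (intro epowr_mono) auto
    also have "\<dots> = ennreal (L * 2) * epowr (?S c k + ?S d k) (1 / P)"
      using P L by (simp add: epowr_mult powr_powr)
    also have "\<dots> \<le> ennreal (L * 2) * (ennreal (2 powr (1 / P)) * (epowr (?S c k) (1 / P) + epowr (?S d k) (1 / P)))"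
      using P by (intro mult_left_mono epowr_add_le) auto
    finally show ?thesis using False L by (simp add: block_norm_def P_def[symmetric] ennreal_mult mult.assoc)
  qed
  then show ?thesis by blast
qed

lemma seq_space_lincomb:
  assumes p: "0 < p" and q: "0 < q" and c: "c \<in> seq_space \<delta> p q" and d: "d \<in> seq_space \<delta> p q"
  shows "(\<lambda>Q. a * c Q + b * d Q) \<in> seq_space \<delta> p q"
proof -
  let ?e = "\<lambda>Q. a * c Q + b * d Q"
  obtain K where K: "\<And>k. block_norm \<delta> p ?e k \<le> ennreal K * (block_norm \<delta> p c k + block_norm \<delta> p d k)"
    using block_norm_lincomb[OF p, of a c b d] by blast
  let ?w = "\<lambda>c k. ennreal (weight p q k) * block_norm \<delta> p c k"
  have w: "?w ?e k \<le> ennreal K * (?w c k + ?w d k)" for k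
    using mult_left_mono[OF K[of k], of "ennreal (weight p q k)"] by (simp add: distrib_left mult_ac)
  have "seq_norm \<delta> p q ?e < \<infinity>"
  proof (cases "q = \<infinity>")
    case True
    have "?w ?e k \<le> ennreal K * (seq_norm \<delta> p q c + seq_norm \<delta> p q d)" for k
      by (rule order_trans[OF w]) (intro mult_left_mono add_mono weighted_block_le q, simp)
    then have "seq_norm \<delta> p q ?e \<le> ennreal K * (seq_norm \<delta> p q c + seq_norm \<delta> p q d)"
      using True by (subst seq_norm_def) (auto intro!: SUP_least)
    also have "\<dots> < \<infinity>" using c d by (simp add: seq_space_def ennreal_mult_less_top)
    finally show ?thesis .
  next
    case False
    define Q where "Q = enn2real q"
    have Q: "Q > 0" using False q by (simp add: Q_def enn2real_pos)
    have fin: "(\<Sum>k. epowr (?w c k) Q) < top" if "c \<in> seq_space \<delta> p q" for c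
      using that False by (simp add: seq_space_def seq_norm_def Q_def[symmetric])
    have "(\<Sum>k. epowr (?w ?e k) Q) \<le> (\<Sum>k. (epowr (ennreal K) Q * ennreal (2 powr Q)) * (epowr (?w c k) Q + epowr (?w d k) Q))"
    proof (rule suminf_le)
      fix k
      have "epowr (?w ?e k) Q \<le> epowr (ennreal K * (?w c k + ?w d k)) Q" using Q by (intro epowr_mono w) auto
      also have "\<dots> = epowr (ennreal K) Q * epowr (?w c k + ?w d k) Q" using Q by (rule epowr_mult)
      also have "\<dots> \<le> epowr (ennreal K) Q * (ennreal (2 powr Q) * (epowr (?w c k) Q + epowr (?w d k) Q))"
        using Q by (intro mult_left_mono epowr_add_le) auto
      finally show "epowr (?w ?e k) Q \<le> (epowr (ennreal K) Q * ennreal (2 powr Q)) * (epowr (?w c k) Q + epowr (?w d k) Q)"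
        by (simp only: mult.assoc)
    qed auto
    also have "\<dots> = (epowr (ennreal K) Q * ennreal (2 powr Q)) * ((\<Sum>k. epowr (?w c k) Q) + (\<Sum>k. epowr (?w d k) Q))"
      by (simp add: ennreal_suminf_cmult suminf_add[symmetric])
    also have "\<dots> < top" using fin[OF c] fin[OF d] by (simp add: ennreal_mult_less_top)
    finally show ?thesis using False by (simp add: seq_norm_def Q_def[symmetric])
  qed
  then show ?thesis by (simp add: seq_space_def)
qed

end

section \<open>Reproducing formula and iteration\<close>

lemma has_sum_norm_le:
  fixes f :: "'a \<Rightarrow> 'b :: real_normed_vector"
  assumes "(f has_sum S) A" "\<And>F. finite F \<Longrightarrow> F \<subseteq> A \<Longrightarrow> (\<Sum>x\<in>F. norm (f x)) \<le> B"
  shows "norm S \<le> B"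
proof (rule tendsto_upperbound)
  show "((\<lambda>F. norm (sum f F)) \<longlongrightarrow> norm S) (finite_subsets_at_top A)"
    using assms(1) unfolding has_sum_def by (rule tendsto_norm)
  show "\<forall>\<^sub>F F in finite_subsets_at_top A. norm (sum f F) \<le> B"
    by (rule eventually_finite_subsets_at_top_weakI) (rule order_trans[OF norm_sum assms(2)])
qed simp

text \<open>Along an enumeration of P the integrals form an absolutely convergent series, so the sum
  does not depend on the order. The unordered form matches that of \<open>synth\<close>.\<close>

lemma has_sum_set_integral:
  fixes f :: "'a \<Rightarrow> 'b :: {banach, second_countable_topology}"
  assumes P: "countable P" "infinite P" "\<And>A. A \<in> P \<Longrightarrow> A \<in> sets M"
    and disj: "\<And>A B. A \<in> P \<Longrightarrow> B \<in> P \<Longrightarrow> A \<noteq> B \<Longrightarrow> A \<inter> B = {}"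
    and un: "\<Union>P = space M" and f: "integrable M f"
  shows "((\<lambda>A. LINT w:A|M. f w) has_sum (\<integral>w. f w \<partial>M)) P"
proof -
  define e where "e = from_nat_into P"
  have bij: "bij_betw e UNIV P" unfolding e_def using P by (intro bij_betw_from_nat_into)
  have eP: "e n \<in> P" for n using bij by (auto simp: bij_betw_def)
  have sets [measurable]: "e n \<in> sets M" for n by (intro P eP)
  have ed: "e i \<inter> e j = {}" if "i \<noteq> j" for i j
  proof (rule disj[OF eP eP])
    show "e i \<noteq> e j" using bij that by (auto simp: bij_betw_def inj_on_def)
  qed
  have df: "disjoint_family e" using ed by (auto simp: disjoint_family_on_def)
  have U: "(\<Union>i. e i) = space M" using bij un by (auto simp: bij_betw_def)
  have int: "set_integrable M (e n) f" for n
    unfolding set_integrable_def using f by (intro integrable_mult_indicator) auto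
  have nn: "ennreal (norm (LINT w:e n|M. f w)) \<le> (\<integral>\<^sup>+ w \<in> e n. ennreal (norm (f w)) \<partial>M)" for n
  proof -
    have "ennreal (norm (LINT w:e n|M. f w)) \<le> (\<integral>\<^sup>+ w. ennreal (norm (indicator (e n) w *\<^sub>R f w)) \<partial>M)"
      unfolding set_lebesgue_integral_def using int[of n] unfolding set_integrable_def
      by (rule integral_norm_bound_ennreal)
    also have "\<dots> = (\<integral>\<^sup>+ w \<in> e n. ennreal (norm (f w)) \<partial>M)"
      by (intro nn_integral_cong) (auto simp: indicator_def)
    finally show ?thesis .
  qed
  have [measurable]: "f \<in> borel_measurable M" using f by simp
  have "(\<Sum>n. ennreal (norm (LINT w:e n|M. f w))) \<le> (\<Sum>n. \<integral>\<^sup>+ w \<in> e n. ennreal (norm (f w)) \<partial>M)"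
    by (intro suminf_le nn) auto
  also have "\<dots> = (\<integral>\<^sup>+ w \<in> (\<Union>n. e n). ennreal (norm (f w)) \<partial>M)"
    by (intro nn_integral_disjoint_family[symmetric] df) auto
  also have "\<dots> \<le> (\<integral>\<^sup>+ w. ennreal (norm (f w)) \<partial>M)"
    by (intro nn_integral_mono) (auto simp: indicator_def)
  also have "\<dots> < \<infinity>" using f by (simp add: integrable_iff_bounded)
  finally have sm: "summable (\<lambda>n. norm (LINT w:e n|M. f w))"
    by (intro summable_suminf_not_top) auto
  have "set_integrable M (\<Union>i. e i) f"
    unfolding set_integrable_def U using f by (intro integrable_mult_indicator) auto
  then have "(LINT w:(\<Union>i. e i)|M. f w) = (\<Sum>i. LINT w:e i|M. f w)"
    by (intro lebesgue_integral_countable_add ed) auto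
  moreover have "(LINT w:(\<Union>i. e i)|M. f w) = (\<integral>w. f w \<partial>M)"
    unfolding U by (rule set_integral_space[OF f])
  ultimately have "(\<lambda>n. LINT w:e n|M. f w) sums (\<integral>w. f w \<partial>M)"
    using summable_norm_cancel[OF sm] by (simp add: sums_iff)
  then have "((\<lambda>n. LINT w:e n|M. f w) has_sum (\<integral>w. f w \<partial>M)) UNIV"
    by (rule norm_summable_imp_has_sum[OF sm])
  then show ?thesis
    using has_sum_reindex_bij_betw[OF bij, of "\<lambda>A. LINT w:A|M. f w"] by simp
qed

lemma cmod_exp_minus_1_le: "cmod (exp x - 1) \<le> exp (cmod x) * cmod x"
proof -
  have "cmod (exp x - exp 0) \<le> exp (cmod x) * cmod (x - 0)"
  proof (rule field_differentiable_bound[of "cball 0 (cmod x)" exp exp])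
    fix z :: complex assume z: "z \<in> cball 0 (cmod x)"
    show "(exp has_field_derivative exp z) (at z within cball 0 (cmod x))"
      by (rule DERIV_subset[OF DERIV_exp]) simp
    have "Re z \<le> cmod x" using complex_Re_le_cmod[of z] z by simp
    then show "cmod (exp z) \<le> exp (cmod x)" by simp
  qed auto
  then show ?thesis by simp
qed

text \<open>Cauchy's inequality on circles of radius 1 about points of the unit disc, which is why
  the bound on g reaches to radius 2.\<close>

lemma holomorphic_diff_le:
  assumes g: "g holomorphic_on UNIV" and M: "\<And>x. cmod x \<le> 2 \<Longrightarrow> cmod (g x) \<le> M" and u: "cmod u \<le> 1"
  shows "cmod (g u - g 0) \<le> M * cmod u"
proof -
  have "cmod (g u - g 0) \<le> M * cmod (u - 0)"
  proof (rule field_differentiable_bound[of "cball 0 1" g "deriv g"])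
    fix z :: complex assume z: "z \<in> cball 0 1"
    show "(g has_field_derivative deriv g z) (at z within cball 0 1)"
      using holomorphic_derivI[OF g, of z] by (auto intro: DERIV_subset)
    have "cmod ((deriv ^^ 1) g z) \<le> fact 1 * M / 1 ^ 1"
    proof (rule Cauchy_inequality)
      fix x assume "cmod (z - x) = 1"
      then have "cmod x \<le> 2" using norm_triangle_ineq2[of x z] z by (simp add: norm_minus_commute)
      then show "cmod (g x) \<le> M" by (rule M)
    qed (auto intro: holomorphic_on_subset[OF g] continuous_on_subset[OF holomorphic_on_imp_continuous_on[OF g]])
    then show "cmod (deriv g z) \<le> M" by simp
  qed (use u in auto)
  then show ?thesis by simp
qed

section \<open>The growth class and the oscillation of the reproducing integrand\<close>

text \<open>Stand-in for the norm in the iteration. The base point is part of the class, so one and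
  the same iteration yields a separate bound around each point of the plane.\<close>

definition growth :: "real \<Rightarrow> (complex \<Rightarrow> complex) \<Rightarrow> complex \<Rightarrow> real \<Rightarrow> bool" where
  "growth \<alpha> f z0 A \<longleftrightarrow> (\<forall>x. fock_mod \<alpha> f x \<le> A * exp (cmod (z0 - x)))"

text \<open>The integrand of the reproducing formula \<open>f z = \<alpha>/\<pi> \<integral> f w exp (\<alpha> z w\<^sup>* - \<alpha> |w|\<^sup>2) dw\<close>.\<close>

definition repr :: "real \<Rightarrow> (complex \<Rightarrow> complex) \<Rightarrow> complex \<Rightarrow> complex \<Rightarrow> complex" where
  "repr \<alpha> f z w = f w * exp (of_real \<alpha> * z * cnj w - of_real (\<alpha> * (cmod w)\<^sup>2))"

lemma growth_nonneg:
  assumes "growth \<alpha> f z0 A" shows "A \<ge> 0"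
proof -
  have "fock_mod \<alpha> f z0 \<le> A * exp (cmod (z0 - z0))" using assms unfolding growth_def by blast
  then show ?thesis using order_trans[OF fock_mod_nonneg] by simp
qed

lemma cmod_repr: "cmod (repr \<alpha> f z w) = fock_mod \<alpha> f w * exp (\<alpha> / 2 * (cmod z)\<^sup>2 - \<alpha> / 2 * (cmod (z - w))\<^sup>2)"
proof -
  have *: "(cmod (z - w))\<^sup>2 = (cmod z)\<^sup>2 + (cmod w)\<^sup>2 - 2 * Re (z * cnj w)"
    unfolding cmod_power2 by (simp add: power2_eq_square algebra_simps)
  show ?thesis
    unfolding * by (simp add: repr_def fock_mod_def norm_mult mult.assoc exp_add[symmetric] algebra_simps)
qed

lemma borel_measurable_repr [measurable]:
  assumes [measurable]: "f \<in> borel_measurable borel"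
  shows "repr \<alpha> f z \<in> borel_measurable borel"
proof -
  have "(\<lambda>w. exp (of_real \<alpha> * z * cnj w - of_real (\<alpha> * (cmod w)\<^sup>2))) \<in> borel_measurable borel"
    by (intro borel_measurable_continuous_onI continuous_intros)
  then show ?thesis unfolding repr_def[abs_def] by measurable
qed

lemma cmod_repr_le:
  assumes "growth \<alpha> f z0 A" "\<alpha> > 0"
  shows "cmod (repr \<alpha> f z w) \<le> A * exp (cmod (z0 - z) + \<alpha> / 2 * (cmod z)\<^sup>2 + 2 / \<alpha>) * exp (- cmod (z - w))"
proof -
  have A: "A \<ge> 0" by (rule growth_nonneg[OF assms(1)])
  have "fock_mod \<alpha> f w \<le> A * exp (cmod (z0 - w))" using assms(1) by (simp add: growth_def)
  then have "cmod (repr \<alpha> f z w) \<le> A * exp (cmod (z0 - w)) * exp (\<alpha> / 2 * (cmod z)\<^sup>2 - \<alpha> / 2 * (cmod (z - w))\<^sup>2)"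
    unfolding cmod_repr by (intro mult_right_mono) auto
  also have "\<dots> = A * exp (cmod (z0 - w) + (\<alpha> / 2 * (cmod z)\<^sup>2 - \<alpha> / 2 * (cmod (z - w))\<^sup>2))"
    by (simp only: mult.assoc exp_add)
  also have "\<dots> \<le> A * exp (cmod (z0 - z) + \<alpha> / 2 * (cmod z)\<^sup>2 + 2 / \<alpha> - cmod (z - w))"
  proof -
    have "cmod (z0 - w) \<le> cmod (z0 - z) + cmod (z - w)" using norm_triangle_ineq[of "z0 - z" "z - w"] by simp
    \<comment> \<open>B = 1 absorbs the factor exp |z - w| caused by comparing with z instead of w,
      and (B + 1)^2 / (2 \<alpha>) = 2 / \<alpha>.\<close>
    moreover have "cmod (z - w) - \<alpha> / 2 * (cmod (z - w))\<^sup>2 \<le> 2 / \<alpha> - cmod (z - w)"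
      using gauss_le_exp[OF assms(2), of 1 "cmod (z - w)"] by simp
    ultimately show ?thesis using A by (intro mult_left_mono) auto
  qed
  also have "\<dots> = A * exp (cmod (z0 - z) + \<alpha> / 2 * (cmod z)\<^sup>2 + 2 / \<alpha>) * exp (- cmod (z - w))"
    by (simp only: mult.assoc exp_add[symmetric] diff_conv_add_uminus)
  finally show ?thesis .
qed

lemma integrable_exp_norm: "integrable lborel (\<lambda>w::complex. exp (- cmod (z - w)))"
proof (rule integrableI_bounded)
  show "(\<integral>\<^sup>+ w. ennreal (norm (exp (- cmod (z - w)))) \<partial>lborel) < \<infinity>"
    using kern_const_le(1)[of 1 z] by (simp add: le_less_trans)
qed simp

lemma nn_integral_gauss:
  assumes "\<alpha> > 0"
  shows "(\<integral>\<^sup>+(u::complex). ennreal (exp (- \<alpha> * (cmod u)\<^sup>2)) \<partial>lborel) = ennreal (pi / \<alpha>)"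
proof -
  have "(\<integral>\<^sup>+(u::complex). ennreal (exp (- \<alpha> * (cmod u)\<^sup>2)) \<partial>lborel) =
      (\<integral>\<^sup>+ r \<in> {0..}. ennreal (exp (- \<alpha> * r\<^sup>2)) * ennreal (2 * pi * r) \<partial>lborel)"
    by (rule nn_integral_radial[of "\<lambda>r. ennreal (exp (- \<alpha> * r\<^sup>2))"]) simp
  also have "\<dots> = (\<integral>\<^sup>+ r. ennreal (exp (- \<alpha> * r\<^sup>2) * (2 * pi * r)) * indicator {0..} r \<partial>lborel)"
    by (intro nn_integral_cong) (auto simp: indicator_def ennreal_mult[symmetric])
  also have "\<dots> = ennreal (0 - (- (pi / \<alpha>) * exp (- \<alpha> * 0\<^sup>2)))"
  proof (rule nn_integral_FTC_atLeast[where F="\<lambda>r. - (pi / \<alpha>) * exp (- \<alpha> * r\<^sup>2)"])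
    show "((\<lambda>r. - (pi / \<alpha>) * exp (- \<alpha> * r\<^sup>2)) has_real_derivative exp (- \<alpha> * x\<^sup>2) * (2 * pi * x)) (at x)" for x
      using assms by (auto intro!: derivative_eq_intros simp: field_simps)
    have "filterlim (\<lambda>r. \<alpha> * r\<^sup>2) at_top at_top"
      using assms by (intro filterlim_tendsto_pos_mult_at_top[OF tendsto_const] filterlim_pow_at_top filterlim_ident) auto
    then have "((\<lambda>r. exp (- (\<alpha> * r\<^sup>2))) \<longlongrightarrow> 0) at_top"
      by (intro filterlim_compose[OF exp_at_bot] filterlim_compose[OF filterlim_uminus_at_bot_at_top])
    then show "((\<lambda>r. - (pi / \<alpha>) * exp (- \<alpha> * r\<^sup>2)) \<longlongrightarrow> 0) at_top"
      using tendsto_mult_right_zero[of _ at_top "- (pi / \<alpha>)"] by simp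
  qed auto
  finally show ?thesis by simp
qed

text \<open>With w = z + u the integrand is exp(- \<alpha> |u|^2) times an entire g with g 0 = f z,
  so the radial mean value formula evaluates the integral as (pi / \<alpha>) g 0.\<close>

lemma reproducing:
  assumes f: "f holomorphic_on UNIV" and \<alpha>: "\<alpha> > 0" and gr: "growth \<alpha> f z0 A"
  shows "integrable lborel (repr \<alpha> f z)" and "f z = of_real (\<alpha> / pi) * (\<integral>w. repr \<alpha> f z w \<partial>lborel)"
proof -
  note [measurable] = borel_measurable_holomorphic_UNIV[OF f]
  show int: "integrable lborel (repr \<alpha> f z)"
  proof (rule Bochner_Integration.integrable_bound)
    show "integrable lborel (\<lambda>w. A * exp (cmod (z0 - z) + \<alpha> / 2 * (cmod z)\<^sup>2 + 2 / \<alpha>) * exp (- cmod (z - w)))"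
      by (intro integrable_mult_right integrable_exp_norm)
    show "AE w in lborel. norm (repr \<alpha> f z w) \<le> norm (A * exp (cmod (z0 - z) + \<alpha> / 2 * (cmod z)\<^sup>2 + 2 / \<alpha>) * exp (- cmod (z - w)))"
      using cmod_repr_le[OF gr \<alpha>, of z] growth_nonneg[OF gr] by (intro AE_I2) (simp add: abs_mult)
  qed simp
  define g where "g = (\<lambda>u. f (z + u) * exp (- of_real \<alpha> * cnj z * u))"
  define wt where "wt = (\<lambda>r::real. exp (- \<alpha> * r\<^sup>2))"
  have "(\<lambda>u. f (z + u)) holomorphic_on UNIV"
    by (rule holomorphic_on_UNIV_shift[OF f])
  then have g: "g holomorphic_on UNIV" unfolding g_def by (intro holomorphic_intros)
  have eq: "repr \<alpha> f z (z + u) = wt (cmod u) *\<^sub>R g u" for u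
  proof -
    have "of_real ((cmod (z + u))\<^sup>2) = (z + u) * cnj (z + u)" "of_real ((cmod u)\<^sup>2) = u * cnj u"
      by (simp_all only: complex_norm_square)
    then have "of_real \<alpha> * z * cnj (z + u) - of_real (\<alpha> * (cmod (z + u))\<^sup>2) =
        of_real (- \<alpha> * (cmod u)\<^sup>2) + (- of_real \<alpha> * cnj z * u)"
      by (simp only: of_real_mult of_real_minus complex_cnj_add) (simp add: algebra_simps)
    then have "repr \<alpha> f z (z + u) = f (z + u) * exp (of_real (- \<alpha> * (cmod u)\<^sup>2) + (- of_real \<alpha> * cnj z * u))"
      by (simp only: repr_def)
    then show ?thesis
      by (simp only: g_def wt_def exp_add scaleR_conv_of_real exp_of_real mult_ac)
  qed
  have [measurable]: "wt \<in> borel_measurable borel" unfolding wt_def by measurable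
  have sh: "lborel = distr lborel borel (\<lambda>u::complex. z + u)" by (rule lborel_distr_plus[symmetric])
  have "integrable (distr lborel borel (\<lambda>u. z + u)) (repr \<alpha> f z)" using int by (simp only: sh[symmetric])
  then have int': "integrable lborel (\<lambda>u. wt (cmod u) *\<^sub>R g u)"
    by (subst (asm) integrable_distr_eq) (auto simp: eq)
  have nn: "(\<integral>\<^sup>+(u::complex). ennreal (wt (cmod u)) \<partial>lborel) = ennreal (pi / \<alpha>)"
    unfolding wt_def by (rule nn_integral_gauss[OF \<alpha>])
  have int0: "integrable lborel (\<lambda>u::complex. wt (cmod u))"
    by (rule integrableI_nonneg) (auto simp: nn, simp add: wt_def)
  have val: "(\<integral>(u::complex). wt (cmod u) \<partial>lborel) = pi / \<alpha>"
    using \<alpha> by (subst integral_eq_nn_integral) (auto simp: nn, simp add: wt_def)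
  have "(\<integral>w. repr \<alpha> f z w \<partial>lborel) = (\<integral>u. repr \<alpha> f z (z + u) \<partial>lborel)"
    by (subst sh, subst integral_distr) auto
  also have "\<dots> = (\<integral>u. wt (cmod u) *\<^sub>R g u \<partial>lborel)" by (simp only: eq)
  also have "\<dots> = (pi / \<alpha>) *\<^sub>R g 0" unfolding val[symmetric] by (rule plane_mean[OF g _ int' int0]) measurable
  finally show "f z = of_real (\<alpha> / pi) * (\<integral>w. repr \<alpha> f z w \<partial>lborel)"
    using \<alpha> by (simp add: g_def scaleR_conv_of_real field_simps)
qed

text \<open>In \<open>repr_oscillation\<close>, with y = z - v: the bound of g on |u| \<le> 2 gives
  2 + 2 \<alpha>, the two factors exp(\<alpha> (|y| + 1)) give another 2 \<alpha>, replacing |y| by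
  |z - w| gives 1, and \<open>gauss_le_exp\<close> with B = 1 + 2 \<alpha> the last term.\<close>

definition osc_const :: "real \<Rightarrow> real" where
  "osc_const \<alpha> = exp (3 + 4 * \<alpha> + (2 + 2 * \<alpha>)\<^sup>2 / (2 * \<alpha>))"

text \<open>After the Weyl translation by \<open>v\<close>, the integrand is a holomorphic function of \<open>u = w - v\<close> times
  \<open>exp (\<alpha> (z - v) u\<^sup>* - \<alpha> |u|\<^sup>2)\<close>, and both factors vary little for small \<open>u\<close>.\<close>

lemma repr_oscillation:
  assumes f: "f holomorphic_on UNIV" and \<alpha>: "\<alpha> > 0" and gr: "growth \<alpha> f z0 A" and u: "cmod (w - v) \<le> 1"
  shows "cmod (repr \<alpha> f z w - repr \<alpha> f z v) \<le>
    cmod (w - v) * A * osc_const \<alpha> * exp (\<alpha> / 2 * (cmod z)\<^sup>2 + cmod (z0 - z)) * exp (- cmod (z - w))"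
proof -
  define y where "y = z - v"
  define x where "x = w - v"
  have A: "A \<ge> 0" by (rule growth_nonneg[OF gr])
  have x: "cmod x \<le> 1" using u by (simp add: x_def)
  define g where "g = (\<lambda>u. f (v + u) * exp (- of_real \<alpha> * cnj v * u))"
  have "(\<lambda>u. f (v + u)) holomorphic_on UNIV"
    by (rule holomorphic_on_UNIV_shift[OF f])
  then have g: "g holomorphic_on UNIV" unfolding g_def by (intro holomorphic_intros)
  define X where "X = of_real \<alpha> * y * cnj x - of_real (\<alpha> * (cmod x)\<^sup>2)"
  define E where "E = exp (of_real \<alpha> * y * cnj v)"
  have eq: "repr \<alpha> f z (v + u) = E * (g u * exp (of_real \<alpha> * y * cnj u - of_real (\<alpha> * (cmod u)\<^sup>2)))" for u
  proof -
    have "of_real ((cmod (v + u))\<^sup>2) = (v + u) * cnj (v + u)" "of_real ((cmod u)\<^sup>2) = u * cnj u"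
      by (simp_all only: complex_norm_square)
    then have "of_real \<alpha> * z * cnj (v + u) - of_real (\<alpha> * (cmod (v + u))\<^sup>2) =
        of_real \<alpha> * y * cnj v + (- of_real \<alpha> * cnj v * u) + (of_real \<alpha> * y * cnj u - of_real (\<alpha> * (cmod u)\<^sup>2))"
      by (simp only: of_real_mult of_real_minus complex_cnj_add) (simp add: y_def algebra_simps)
    then have "repr \<alpha> f z (v + u) = f (v + u) * exp (of_real \<alpha> * y * cnj v + (- of_real \<alpha> * cnj v * u) +
        (of_real \<alpha> * y * cnj u - of_real (\<alpha> * (cmod u)\<^sup>2)))"
      by (simp only: repr_def)
    then show ?thesis unfolding g_def E_def exp_add by (simp only: mult_ac)
  qed
  have w: "repr \<alpha> f z w = E * (g x * exp X)" using eq[of x] by (simp add: x_def X_def)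
  have v: "repr \<alpha> f z v = E * g 0" using eq[of 0] by simp
  \<comment> \<open>A bound for g on |u| \<le> 2: the base point is z0, and the way from z0 to v + u
    passes through z, at the cost of |y| + 2.\<close>
  define M where "M = A * exp (cmod (z0 - z) + cmod y + 2) * exp (\<alpha> / 2 * (cmod v)\<^sup>2 + 2 * \<alpha>)"
  have M0: "M \<ge> 0" using A by (simp add: M_def)
  have M: "cmod (g u) \<le> M" if "cmod u \<le> 2" for u
  proof -
    have "cmod (z0 - (v + u)) \<le> cmod (z0 - z) + cmod (y - u)"
      using norm_triangle_ineq[of "z0 - z" "y - u"] by (simp add: y_def algebra_simps)
    also have "cmod (y - u) \<le> cmod y + 2" using norm_triangle_ineq4[of y u] that by simp
    finally have "exp (cmod (z0 - (v + u))) \<le> exp (cmod (z0 - z) + cmod y + 2)" by simp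
    moreover have "fock_mod \<alpha> f (v + u) \<le> A * exp (cmod (z0 - (v + u)))" using gr by (simp add: growth_def)
    ultimately have 1: "fock_mod \<alpha> f (v + u) \<le> A * exp (cmod (z0 - z) + cmod y + 2)"
      using A by (meson mult_left_mono order_trans)
    have "(cmod u)\<^sup>2 \<le> 2\<^sup>2" using that by (intro power_mono) auto
    then have 2: "exp (\<alpha> / 2 * ((cmod v)\<^sup>2 + (cmod u)\<^sup>2)) \<le> exp (\<alpha> / 2 * (cmod v)\<^sup>2 + 2 * \<alpha>)"
      using \<alpha> by (simp add: distrib_left)
    show ?thesis unfolding g_def fock_mod_translate M_def using 1 2 A by (intro mult_mono) auto
  qed
  have d1: "cmod (g x - g 0) \<le> M * cmod x" by (rule holomorphic_diff_le[OF g M x])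
  have X: "cmod X \<le> cmod x * (\<alpha> * (cmod y + 1))" "cmod X \<le> \<alpha> * (cmod y + 1)"
  proof -
    have "cmod X \<le> \<alpha> * cmod y * cmod x + \<alpha> * (cmod x)\<^sup>2"
      unfolding X_def using \<alpha> by (intro norm_triangle_le_diff) (simp add: norm_mult norm_power)
    also have "\<dots> \<le> \<alpha> * cmod y * cmod x + \<alpha> * cmod x"
      using \<alpha> x by (intro add_left_mono mult_left_mono) (auto simp: power2_eq_square mult_left_le)
    finally show 1: "cmod X \<le> cmod x * (\<alpha> * (cmod y + 1))" by (simp add: algebra_simps)
    also have "\<dots> \<le> 1 * (\<alpha> * (cmod y + 1))" using x \<alpha> by (intro mult_right_mono) auto
    finally show "cmod X \<le> \<alpha> * (cmod y + 1)" by simp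
  qed
  define T where "T = \<alpha> * (cmod y + 1)"
  have T: "T \<ge> 0" using \<alpha> by (simp add: T_def)
  have eX: "exp (cmod X) \<le> exp T" using X by (simp add: T_def)
  have "g x * exp X - g 0 = (g x - g 0) * exp X + g 0 * (exp X - 1)" by (simp add: algebra_simps)
  then have "cmod (g x * exp X - g 0) \<le> cmod (g x - g 0) * cmod (exp X) + cmod (g 0) * cmod (exp X - 1)"
    by (simp only: norm_mult[symmetric] norm_triangle_ineq)
  also have "\<dots> \<le> (M * cmod x) * exp T + M * (exp T * (cmod x * T))"
  proof (intro add_mono mult_mono d1 M)
    have "Re X \<le> cmod X" by (rule complex_Re_le_cmod)
    then show "cmod (exp X) \<le> exp T" using X by (simp add: T_def)
    have "cmod (exp X - 1) \<le> exp (cmod X) * cmod X" by (rule cmod_exp_minus_1_le)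
    also have "\<dots> \<le> exp T * (cmod x * T)" using eX X by (intro mult_mono) (auto simp: T_def)
    finally show "cmod (exp X - 1) \<le> exp T * (cmod x * T)" .
  qed (use M0 in auto)
  also have "\<dots> = cmod x * M * (exp T * (1 + T))" by (simp add: algebra_simps)
  \<comment> \<open>The linear factor 1 + T is absorbed into a second exponential, so that only |y|
    in an exponent is left for the Gaussian to beat.\<close>
  also have "\<dots> \<le> cmod x * M * (exp T * exp T)" using M0 by (intro mult_left_mono exp_ge_add_one_self) auto
  finally have d: "cmod (g x * exp X - g 0) \<le> cmod x * M * (exp T * exp T)" .
  have E: "cmod E = exp (\<alpha> / 2 * ((cmod z)\<^sup>2 - (cmod y)\<^sup>2 - (cmod v)\<^sup>2))"
  proof -
    have *: "(cmod z)\<^sup>2 - (cmod y)\<^sup>2 - (cmod v)\<^sup>2 = 2 * Re (y * cnj v)"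
      unfolding y_def cmod_power2 by (simp add: power2_eq_square algebra_simps)
    have "\<alpha> / 2 * ((cmod z)\<^sup>2 - (cmod y)\<^sup>2 - (cmod v)\<^sup>2) = Re (of_real \<alpha> * y * cnj v)"
      unfolding * by (simp add: algebra_simps)
    then show ?thesis unfolding E_def by (simp only: norm_exp_eq_Re)
  qed
  have "cmod (repr \<alpha> f z w - repr \<alpha> f z v) = cmod E * cmod (g x * exp X - g 0)"
    unfolding w v by (simp add: right_diff_distrib[symmetric] norm_mult)
  also have "\<dots> \<le> cmod E * (cmod x * M * (exp T * exp T))" by (intro mult_left_mono d) simp
  also have "\<dots> = cmod x * A * exp ((\<alpha> / 2 * (cmod z)\<^sup>2 + cmod (z0 - z)) +
      (2 + 4 * \<alpha> + ((1 + 2 * \<alpha>) * cmod y - \<alpha> / 2 * (cmod y)\<^sup>2)))"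
    unfolding E M_def T_def by (simp add: mult_exp_exp mult_ac algebra_simps)
  also have "\<dots> \<le> cmod x * A * exp ((\<alpha> / 2 * (cmod z)\<^sup>2 + cmod (z0 - z)) +
      (3 + 4 * \<alpha> + (2 + 2 * \<alpha>)\<^sup>2 / (2 * \<alpha>) + - cmod (z - w)))"
  proof -
    have "cmod (z - w) \<le> cmod y + cmod x" using norm_triangle_ineq4[of y x] by (simp add: y_def x_def)
    then have "cmod (z - w) \<le> cmod y + 1" using x by simp
    moreover have "(1 + 2 * \<alpha>) * cmod y - \<alpha> / 2 * (cmod y)\<^sup>2 \<le> (2 + 2 * \<alpha>)\<^sup>2 / (2 * \<alpha>) - cmod y"
      using gauss_le_exp[OF \<alpha>, of "1 + 2 * \<alpha>" "cmod y"] by simp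
    ultimately show ?thesis using A by (intro mult_left_mono) auto
  qed
  also have "\<dots> = cmod (w - v) * A * osc_const \<alpha> * exp (\<alpha> / 2 * (cmod z)\<^sup>2 + cmod (z0 - z)) * exp (- cmod (z - w))"
    unfolding exp_add osc_const_def x_def by (simp only: mult_ac)
  finally show ?thesis .
qed

text \<open>\<alpha> / pi is the factor of the reproducing formula, 9 comes from
  \<open>pockets_diam\<close>, and \<open>kconst 1\<close> bounds the integral of exp(- |z -
  w|).\<close>

definition err_const :: "real \<Rightarrow> real" where
  "err_const \<alpha> = \<alpha> / pi * 9 * osc_const \<alpha> * kconst 1"

context small_tiling
begin

section \<open>Sampling, its error operator and the iterated coefficients\<close>

text \<open>One-point quadrature of the reproducing formula: \<alpha> / N^2 is \<alpha> / pi times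
  the common pocket area pi / N^2. Half of the Gaussian sits in the normalised kernel, the other
  half appears here.\<close>

definition samp :: "real \<Rightarrow> (complex \<Rightarrow> complex) \<Rightarrow> complex set \<Rightarrow> complex" where
  "samp \<alpha> f Q = of_real (\<alpha> / N\<^sup>2 * exp (- (\<alpha> / 2) * (cmod (center \<delta> Q))\<^sup>2)) * f (center \<delta> Q)"

definition errop :: "real \<Rightarrow> (complex \<Rightarrow> complex) \<Rightarrow> complex \<Rightarrow> complex" where
  "errop \<alpha> f z = f z - synth \<alpha> \<delta> (samp \<alpha> f) z"

lemma cmod_samp: "\<alpha> > 0 \<Longrightarrow> cmod (samp \<alpha> f Q) = \<alpha> / N\<^sup>2 * fock_mod \<alpha> f (center \<delta> Q)"
  unfolding samp_def norm_mult norm_of_real by (simp add: fock_mod_def)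

lemma cmod_samp_le:
  assumes "\<alpha> > 0" "growth \<alpha> f z0 A"
  shows "cmod (samp \<alpha> f Q) \<le> \<alpha> / N\<^sup>2 * A * exp (cmod z0) * exp (1 * cmod (center \<delta> Q))"
proof -
  have "fock_mod \<alpha> f (center \<delta> Q) \<le> A * exp (cmod (z0 - center \<delta> Q))" using assms(2) by (simp add: growth_def)
  also have "\<dots> \<le> A * exp (cmod z0 + cmod (center \<delta> Q))"
    using growth_nonneg[OF assms(2)] by (intro mult_left_mono) (auto intro: norm_triangle_ineq4)
  finally show ?thesis
    using assms(1) unfolding cmod_samp[OF assms(1)] by (simp add: exp_add mult.assoc divide_right_mono)
qed

text \<open>Finitely many pockets of finite area cannot cover the plane.\<close>

lemma infinite_pockets: "infinite (pockets \<delta>)"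
proof
  assume fin: "finite (pockets \<delta>)"
  have "UNIV = (\<Union>Q\<in>pockets \<delta>. Q)" using pockets_cover by auto
  then have "emeasure lborel (UNIV :: complex set) \<le> (\<Sum>Q\<in>pockets \<delta>. emeasure lborel Q)"
    using emeasure_subadditive_finite[OF fin, of "\<lambda>Q. Q" lborel] sets_pockets by auto
  also have "\<dots> = (\<Sum>Q\<in>pockets \<delta>. ennreal (pi / N\<^sup>2))" by (intro sum.cong refl emeasure_pockets)
  also have "\<dots> < \<infinity>" by (simp add: ennreal_mult_less_top of_nat_less_top)
  finally show False by simp
qed

text \<open>The two halves of the Gaussian recombine, so the synthesised samples are literally the
  quadrature sum of the reproducing integral.\<close>

lemma synth_samp_term:
  "synth_term \<alpha> \<delta> (samp \<alpha> f) Q z = of_real (\<alpha> / N\<^sup>2) * repr \<alpha> f z (center \<delta> Q)"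
proof -
  let ?w = "center \<delta> Q"
  have "of_real (exp (- (\<alpha> / 2) * (cmod ?w)\<^sup>2)) * exp (of_real \<alpha> * cnj ?w * z - of_real (\<alpha> / 2 * (cmod ?w)\<^sup>2)) =
     exp (of_real (- (\<alpha> / 2) * (cmod ?w)\<^sup>2) + (of_real \<alpha> * cnj ?w * z - of_real (\<alpha> / 2 * (cmod ?w)\<^sup>2)))"
    by (simp only: exp_add exp_of_real)
  also have "of_real (- (\<alpha> / 2) * (cmod ?w)\<^sup>2) + (of_real \<alpha> * cnj ?w * z - of_real (\<alpha> / 2 * (cmod ?w)\<^sup>2)) =
     of_real \<alpha> * z * cnj ?w - of_real (\<alpha> * (cmod ?w)\<^sup>2)"
    by (simp add: algebra_simps)
  finally show ?thesis
    by (simp add: synth_term_def samp_def fock_kernel_def repr_def mult_ac)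
qed

lemma samp_converges:
  assumes "\<alpha> > 0" "growth \<alpha> f z0 A"
  shows "synth \<alpha> \<delta> (samp \<alpha> f) holomorphic_on UNIV"
    and "((\<lambda>Q. synth_term \<alpha> \<delta> (samp \<alpha> f) Q z) has_sum synth \<alpha> \<delta> (samp \<alpha> f) z) (pockets \<delta>)"
proof -
  have A: "0 \<le> \<alpha> / N\<^sup>2 * A * exp (cmod z0)" using assms growth_nonneg[OF assms(2)] by simp
  show "synth \<alpha> \<delta> (samp \<alpha> f) holomorphic_on UNIV"
    by (rule synth_converges(2)[OF assms(1) A cmod_samp_le[OF assms]])
  show "((\<lambda>Q. synth_term \<alpha> \<delta> (samp \<alpha> f) Q z) has_sum synth \<alpha> \<delta> (samp \<alpha> f) z) (pockets \<delta>)"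
    by (rule synth_converges(3)[OF assms(1) A cmod_samp_le[OF assms]])
qed

lemma errop_holomorphic:
  assumes "\<alpha> > 0" "growth \<alpha> f z0 A" "f holomorphic_on UNIV"
  shows "errop \<alpha> f holomorphic_on UNIV"
  unfolding errop_def[abs_def] by (intro holomorphic_intros assms samp_converges(1)[OF assms(1,2)])

text \<open>The contraction. On each pocket the quadrature error is bounded by the oscillation of
  \<open>repr\<close>, of order \<delta> A. Summed over the pockets it becomes an integral of exp(-
  |z - w|), bounded in z, while exp |z0 - z| is carried along: the base point stays the
  same.\<close>

lemma errop_growth:
  assumes f: "f holomorphic_on UNIV" and \<alpha>: "\<alpha> > 0" and gr: "growth \<alpha> f z0 A"
  shows "growth \<alpha> (errop \<alpha> f) z0 (err_const \<alpha> * \<delta> * A)"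
  unfolding growth_def
proof
  fix z
  note [measurable] = borel_measurable_holomorphic_UNIV[OF f]
  have A: "A \<ge> 0" by (rule growth_nonneg[OF gr])
  define L where "L = 9 * \<delta> * A * osc_const \<alpha> * exp (\<alpha> / 2 * (cmod z)\<^sup>2 + cmod (z0 - z))"
  have L: "L \<ge> 0" using A \<delta>_pos by (simp add: L_def osc_const_def)
  define d where "d Q = (LINT w:Q|lborel. repr \<alpha> f z w) - of_real (pi / N\<^sup>2) * repr \<alpha> f z (center \<delta> Q)" for Q
  have int: "integrable lborel (repr \<alpha> f z)" by (rule reproducing(1)[OF f \<alpha> gr])
  have "((\<lambda>Q. LINT w:Q|lborel. repr \<alpha> f z w) has_sum (\<integral>w. repr \<alpha> f z w \<partial>lborel)) (pockets \<delta>)"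
  proof (intro has_sum_set_integral int countable_pockets infinite_pockets)
    show "A \<in> sets lborel" if "A \<in> pockets \<delta>" for A using sets_pockets[OF that] by simp
    show "A \<inter> B = {}" if "A \<in> pockets \<delta>" "B \<in> pockets \<delta>" "A \<noteq> B" for A B
      using pockets_disjoint that by blast
    show "\<Union> (pockets \<delta>) = space lborel" using pockets_cover by auto
  qed
  from has_sum_cmult_right[OF this, of "of_real (\<alpha> / pi)"]
  have s1: "((\<lambda>Q. of_real (\<alpha> / pi) * (LINT w:Q|lborel. repr \<alpha> f z w)) has_sum f z) (pockets \<delta>)"
    by (simp only: reproducing(2)[OF f \<alpha> gr, symmetric])
  have "((\<lambda>Q. of_real (\<alpha> / pi) * (LINT w:Q|lborel. repr \<alpha> f z w) - synth_term \<alpha> \<delta> (samp \<alpha> f) Q z) has_sum errop \<alpha> f z) (pockets \<delta>)"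
    using has_sum_add[OF s1 has_sum_cmult_right[OF samp_converges(2)[OF \<alpha> gr, of z], of "- 1"]]
    by (simp add: errop_def)
  moreover have "of_real (\<alpha> / pi) * (LINT w:Q|lborel. repr \<alpha> f z w) - synth_term \<alpha> \<delta> (samp \<alpha> f) Q z = of_real (\<alpha> / pi) * d Q" for Q
    unfolding synth_samp_term d_def by (simp add: right_diff_distrib)
  ultimately have s2: "((\<lambda>Q. of_real (\<alpha> / pi) * d Q) has_sum errop \<alpha> f z) (pockets \<delta>)" by simp
  have dQ: "ennreal (cmod (d Q)) \<le> (\<integral>\<^sup>+ w \<in> Q. ennreal (L * exp (- cmod (z - w))) \<partial>lborel)" if Q: "Q \<in> pockets \<delta>" for Q
  proof -
    note [measurable] = sets_pockets[OF Q]
    have i1: "set_integrable lborel Q (repr \<alpha> f z)"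
      unfolding set_integrable_def by (intro integrable_mult_indicator int) simp
    have i2: "set_integrable lborel Q (\<lambda>w. repr \<alpha> f z (center \<delta> Q))"
      unfolding set_integrable_def using emeasure_pockets[OF Q] by (intro integrable_scaleR_left integrable_real_indicator) auto
    have i3: "set_integrable lborel Q (\<lambda>w. repr \<alpha> f z w - repr \<alpha> f z (center \<delta> Q))" by (rule set_integral_diff(1)[OF i1 i2])
    have "(LINT w:Q|lborel. repr \<alpha> f z (center \<delta> Q)) = of_real (pi / N\<^sup>2) * repr \<alpha> f z (center \<delta> Q)"
      using emeasure_pockets[OF Q] by (simp add: set_lebesgue_integral_def measure_def scaleR_conv_of_real)
    then have "d Q = (LINT w:Q|lborel. repr \<alpha> f z w - repr \<alpha> f z (center \<delta> Q))"
      unfolding d_def using set_integral_diff(2)[OF i1 i2] by simp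
    also have "ennreal (cmod \<dots>) \<le> (\<integral>\<^sup>+ w. ennreal (norm (indicator Q w *\<^sub>R (repr \<alpha> f z w - repr \<alpha> f z (center \<delta> Q)))) \<partial>lborel)"
      unfolding set_lebesgue_integral_def using i3 unfolding set_integrable_def by (rule integral_norm_bound_ennreal)
    also have "\<dots> \<le> (\<integral>\<^sup>+ w \<in> Q. ennreal (L * exp (- cmod (z - w))) \<partial>lborel)"
    proof (rule nn_integral_mono)
      fix w
      have "cmod (repr \<alpha> f z w - repr \<alpha> f z (center \<delta> Q)) \<le> L * exp (- cmod (z - w))" if w: "w \<in> Q"
      proof -
        have "cmod (repr \<alpha> f z w - repr \<alpha> f z (center \<delta> Q)) \<le> cmod (w - center \<delta> Q) * A * osc_const \<alpha> *
            exp (\<alpha> / 2 * (cmod z)\<^sup>2 + cmod (z0 - z)) * exp (- cmod (z - w))"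
          by (rule repr_oscillation[OF f \<alpha> gr pockets_diam1[OF Q w]])
        also have "\<dots> \<le> L * exp (- cmod (z - w))"
          unfolding L_def using pockets_diam[OF Q w] A by (intro mult_right_mono) (auto simp: osc_const_def)
        finally show ?thesis .
      qed
      then show "ennreal (norm (indicator Q w *\<^sub>R (repr \<alpha> f z w - repr \<alpha> f z (center \<delta> Q)))) \<le>
          ennreal (L * exp (- cmod (z - w))) * indicator Q w"
        by (auto simp: indicator_def intro!: ennreal_leI)
    qed
    finally show ?thesis .
  qed
  have fin: "(\<Sum>Q\<in>F. cmod (d Q)) \<le> L * kconst 1" if F: "finite F" "F \<subseteq> pockets \<delta>" for F
  proof -
    have "ennreal (\<Sum>Q\<in>F. cmod (d Q)) = (\<Sum>Q\<in>F. ennreal (cmod (d Q)))" by (simp add: sum_ennreal)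
    also have "\<dots> \<le> (\<Sum>Q\<in>F. \<integral>\<^sup>+ w \<in> Q. ennreal (L * exp (- cmod (z - w))) \<partial>lborel)"
      using F by (intro sum_mono dQ) auto
    also have "\<dots> \<le> (\<integral>\<^sup>+ w. ennreal (L * exp (- cmod (z - w))) \<partial>lborel)"
      using F by (intro sum_nn_integral_pockets_le) auto
    also have "\<dots> = ennreal L * (\<integral>\<^sup>+ w. ennreal (exp (- 1 * cmod (z - w))) \<partial>lborel)"
      using L by (subst nn_integral_cmult[symmetric]) (auto simp: ennreal_mult)
    also have "\<dots> \<le> ennreal L * ennreal (kconst 1)" by (intro mult_left_mono kern_const_le) auto
    also have "\<dots> = ennreal (L * kconst 1)" using L kconst_pos[of 1] by (intro ennreal_mult[symmetric]) auto
    finally show ?thesis using L kconst_pos[of 1] by (subst (asm) ennreal_le_iff) auto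
  qed
  have "cmod (errop \<alpha> f z) \<le> \<alpha> / pi * (L * kconst 1)"
  proof (rule has_sum_norm_le[OF s2])
    fix F assume F: "finite F" "F \<subseteq> pockets \<delta>"
    have "(\<Sum>Q\<in>F. norm (of_real (\<alpha> / pi) * d Q)) = \<alpha> / pi * (\<Sum>Q\<in>F. cmod (d Q))"
      using \<alpha> by (simp add: sum_distrib_left norm_mult norm_divide)
    also have "\<dots> \<le> \<alpha> / pi * (L * kconst 1)" using \<alpha> by (intro mult_left_mono fin F) auto
    finally show "(\<Sum>Q\<in>F. norm (of_real (\<alpha> / pi) * d Q)) \<le> \<alpha> / pi * (L * kconst 1)" .
  qed
  then have "fock_mod \<alpha> (errop \<alpha> f) z \<le> \<alpha> / pi * (L * kconst 1) * exp (- (\<alpha> / 2) * (cmod z)\<^sup>2)"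
    unfolding fock_mod_def by (rule mult_right_mono) simp
  also have "\<dots> = err_const \<alpha> * \<delta> * A * (exp (\<alpha> / 2 * (cmod z)\<^sup>2 + cmod (z0 - z)) * exp (- (\<alpha> / 2) * (cmod z)\<^sup>2))"
    unfolding L_def err_const_def by (simp only: mult_ac times_divide_eq_left times_divide_eq_right)
  also have "exp (\<alpha> / 2 * (cmod z)\<^sup>2 + cmod (z0 - z)) * exp (- (\<alpha> / 2) * (cmod z)\<^sup>2) = exp (cmod (z0 - z))"
    unfolding exp_add[symmetric] by simp
  finally show "fock_mod \<alpha> (errop \<alpha> f) z \<le> err_const \<alpha> * \<delta> * A * exp (cmod (z0 - z))" .
qed

text \<open>The Neumann series for the inverse of 1 - \<open>errop\<close>, sampled term by term:
  each coefficient is a numerical series, so no convergence in a function space is involved.\<close>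

definition recov :: "real \<Rightarrow> (complex \<Rightarrow> complex) \<Rightarrow> complex set \<Rightarrow> complex" where
  "recov \<alpha> f Q = (\<Sum>n. samp \<alpha> ((errop \<alpha> ^^ n) f) Q)"

lemma errop_iter:
  assumes f: "f holomorphic_on UNIV" and \<alpha>: "\<alpha> > 0" and \<delta>: "err_const \<alpha> * \<delta> \<le> 1 / 2"
    and gr: "growth \<alpha> f z0 A"
  shows "(errop \<alpha> ^^ n) f holomorphic_on UNIV \<and> growth \<alpha> ((errop \<alpha> ^^ n) f) z0 (A * (1 / 2) ^ n)"
proof (induction n)
  case 0
  then show ?case using f gr by simp
next
  case (Suc n)
  then have h: "(errop \<alpha> ^^ n) f holomorphic_on UNIV" and g: "growth \<alpha> ((errop \<alpha> ^^ n) f) z0 (A * (1 / 2) ^ n)" by auto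
  have "growth \<alpha> ((errop \<alpha> ^^ Suc n) f) z0 (err_const \<alpha> * \<delta> * (A * (1 / 2) ^ n))"
    using errop_growth[OF h \<alpha> g] by simp
  moreover have "err_const \<alpha> * \<delta> * (A * (1 / 2) ^ n) \<le> A * (1 / 2) ^ Suc n"
    using mult_right_mono[OF \<delta> growth_nonneg[OF g]] by simp
  ultimately have "growth \<alpha> ((errop \<alpha> ^^ Suc n) f) z0 (A * (1 / 2) ^ Suc n)"
    unfolding growth_def by (meson mult_right_mono order_trans exp_ge_zero)
  then show ?case using errop_holomorphic[OF \<alpha> g h] by simp
qed

text \<open>The base point is free while the coefficient is fixed. Taking it to be the centre of Q
  later removes the exponential and leaves a bound by the growth constant at the centre.\<close>

lemma recov_bound:
  assumes f: "f holomorphic_on UNIV" and \<alpha>: "\<alpha> > 0" and \<delta>: "err_const \<alpha> * \<delta> \<le> 1 / 2"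
    and gr: "growth \<alpha> f z0 A"
  shows "summable (\<lambda>n. samp \<alpha> ((errop \<alpha> ^^ n) f) Q)"
    and "cmod (recov \<alpha> f Q) \<le> 2 * \<alpha> / N\<^sup>2 * A * exp (cmod (z0 - center \<delta> Q))"
proof -
  let ?B = "\<alpha> / N\<^sup>2 * A * exp (cmod (z0 - center \<delta> Q))"
  have le: "cmod (samp \<alpha> ((errop \<alpha> ^^ n) f) Q) \<le> ?B * (1 / 2) ^ n" for n
  proof -
    have "fock_mod \<alpha> ((errop \<alpha> ^^ n) f) (center \<delta> Q) \<le> A * (1 / 2) ^ n * exp (cmod (z0 - center \<delta> Q))"
      using errop_iter[OF assms, of n] by (simp only: growth_def)
    then have "\<alpha> / N\<^sup>2 * fock_mod \<alpha> ((errop \<alpha> ^^ n) f) (center \<delta> Q) \<le> \<alpha> / N\<^sup>2 * (A * (1 / 2) ^ n * exp (cmod (z0 - center \<delta> Q)))"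
      using \<alpha> by (intro mult_left_mono) auto
    then show ?thesis unfolding cmod_samp[OF \<alpha>] by (simp only: mult_ac)
  qed
  have geo: "(\<lambda>n. ?B * (1 / 2) ^ n) sums (?B * 2)"
    using sums_mult[OF geometric_sums[of "1 / 2 :: real"], of ?B] by simp
  have sn: "summable (\<lambda>n. cmod (samp \<alpha> ((errop \<alpha> ^^ n) f) Q))"
    by (rule summable_comparison_test'[OF sums_summable[OF geo], of 0]) (use le in simp)
  then show "summable (\<lambda>n. samp \<alpha> ((errop \<alpha> ^^ n) f) Q)" by (rule summable_norm_cancel)
  have "cmod (recov \<alpha> f Q) \<le> (\<Sum>n. cmod (samp \<alpha> ((errop \<alpha> ^^ n) f) Q))"
    unfolding recov_def by (rule summable_norm[OF sn])
  also have "\<dots> \<le> (\<Sum>n. ?B * (1 / 2) ^ n)"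
    by (intro suminf_le le sn sums_summable[OF geo])
  also have "\<dots> = ?B * 2" using geo by (rule sums_unique[symmetric])
  finally show "cmod (recov \<alpha> f Q) \<le> 2 * \<alpha> / N\<^sup>2 * A * exp (cmod (z0 - center \<delta> Q))" by (simp add: mult_ac)
qed

text \<open>The coefficients satisfy \<open>recov f = samp f + recov (errop f)\<close>, so that the error
  \<open>f - synth (recov f)\<close> is the same for \<open>f\<close> and \<open>errop f\<close>, hence for all iterates.\<close>

lemma synth_recov:
  assumes f: "f holomorphic_on UNIV" and \<alpha>: "\<alpha> > 0" and \<delta>: "err_const \<alpha> * \<delta> \<le> 1 / 2"
    and gr: "growth \<alpha> f z0 A"
  shows "synth \<alpha> \<delta> (recov \<alpha> f) z = f z"
proof -
  define D where "D f = f z - synth \<alpha> \<delta> (recov \<alpha> f) z" for f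
  have bound: "cmod (recov \<alpha> g Q) \<le> 2 * \<alpha> / N\<^sup>2 * B * exp (cmod z0) * exp (1 * cmod (center \<delta> Q))"
    if "g holomorphic_on UNIV" "growth \<alpha> g z0 B" for g B Q
  proof -
    have "cmod (recov \<alpha> g Q) \<le> 2 * \<alpha> / N\<^sup>2 * B * exp (cmod (z0 - center \<delta> Q))"
      by (rule recov_bound(2)[OF that(1) \<alpha> \<delta> that(2)])
    also have "\<dots> \<le> 2 * \<alpha> / N\<^sup>2 * B * exp (cmod z0 + cmod (center \<delta> Q))"
      using growth_nonneg[OF that(2)] \<alpha> by (intro mult_left_mono) (auto intro: norm_triangle_ineq4)
    finally show ?thesis by (simp add: exp_add mult.assoc)
  qed
  have B0: "0 \<le> 2 * \<alpha> / N\<^sup>2 * B * exp (cmod z0)" if "growth \<alpha> g z0 B" for g B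
    using growth_nonneg[OF that] \<alpha> by simp
  have conv: "((\<lambda>Q. synth_term \<alpha> \<delta> (recov \<alpha> g) Q z) has_sum synth \<alpha> \<delta> (recov \<alpha> g) z) (pockets \<delta>)"
    if "g holomorphic_on UNIV" "growth \<alpha> g z0 B" for g B
    by (rule synth_converges(3)[OF \<alpha> B0[OF that(2)] bound[OF that]])
  have step: "D g = D (errop \<alpha> g)" if g: "g holomorphic_on UNIV" "growth \<alpha> g z0 B" for g B
  proof -
    have rec: "recov \<alpha> g Q = samp \<alpha> g Q + recov \<alpha> (errop \<alpha> g) Q" for Q
      unfolding recov_def using suminf_split_head[OF recov_bound(1)[OF g(1) \<alpha> \<delta> g(2)], of Q]
      by (simp add: funpow_swap1)
    have g': "errop \<alpha> g holomorphic_on UNIV" "growth \<alpha> (errop \<alpha> g) z0 (B * (1 / 2))"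
      using errop_iter[OF g(1) \<alpha> \<delta> g(2), of 1] by simp_all
    have "((\<lambda>Q. synth_term \<alpha> \<delta> (samp \<alpha> g) Q z + synth_term \<alpha> \<delta> (recov \<alpha> (errop \<alpha> g)) Q z) has_sum
        (synth \<alpha> \<delta> (samp \<alpha> g) z + synth \<alpha> \<delta> (recov \<alpha> (errop \<alpha> g)) z)) (pockets \<delta>)"
      by (intro has_sum_add samp_converges(2)[OF \<alpha> g(2)] conv[OF g'])
    moreover have "synth_term \<alpha> \<delta> (samp \<alpha> g) Q z + synth_term \<alpha> \<delta> (recov \<alpha> (errop \<alpha> g)) Q z = synth_term \<alpha> \<delta> (recov \<alpha> g) Q z" for Q
      by (simp add: synth_term_def rec distrib_right)
    ultimately have "synth \<alpha> \<delta> (recov \<alpha> g) z = synth \<alpha> \<delta> (samp \<alpha> g) z + synth \<alpha> \<delta> (recov \<alpha> (errop \<alpha> g)) z"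
      using conv[OF g] by (simp add: has_sum_unique)
    then show ?thesis by (simp add: D_def errop_def)
  qed
  have iter: "D f = D ((errop \<alpha> ^^ n) f)" for n
  proof (induction n)
    case (Suc n)
    then show ?case using errop_iter[OF assms, of n] step[of "(errop \<alpha> ^^ n) f"] by auto
  qed simp
  \<comment> \<open>Independent of the growth constant B, so that the bound B S on the error is
    linear in B. Along the iterates B = A / 2^n, which forces the error to be 0.\<close>
  define S where "S = exp (cmod (z0 - z)) * exp (\<alpha> / 2 * (cmod z)\<^sup>2) + 2 * \<alpha> / N\<^sup>2 * exp (cmod z0) * exp ((1 + \<alpha> * cmod z + 1)\<^sup>2 / (2 * \<alpha>)) * (N\<^sup>2 / pi * exp 1 * kconst 1)"
  have Dle: "cmod (D g) \<le> B * S" if g: "g holomorphic_on UNIV" "growth \<alpha> g z0 B" for g B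
  proof -
    have "cmod (g z) = fock_mod \<alpha> g z * exp (\<alpha> / 2 * (cmod z)\<^sup>2)"
      unfolding fock_mod_def mult.assoc exp_add[symmetric] by simp
    also have "\<dots> \<le> B * exp (cmod (z0 - z)) * exp (\<alpha> / 2 * (cmod z)\<^sup>2)"
      using g(2) by (intro mult_right_mono) (auto simp: growth_def)
    finally have 1: "cmod (g z) \<le> B * (exp (cmod (z0 - z)) * exp (\<alpha> / 2 * (cmod z)\<^sup>2))" by (simp only: mult.assoc)
    let ?K = "2 * \<alpha> / N\<^sup>2 * B * exp (cmod z0) * exp ((1 + \<alpha> * cmod z + 1)\<^sup>2 / (2 * \<alpha>))"
    have "cmod (synth \<alpha> \<delta> (recov \<alpha> g) z) \<le> ?K * (N\<^sup>2 / pi * exp 1 * kconst 1)"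
    proof (rule has_sum_norm_le[OF conv[OF g]])
      fix F assume F: "finite F" "F \<subseteq> pockets \<delta>"
      have "(\<Sum>Q\<in>F. cmod (synth_term \<alpha> \<delta> (recov \<alpha> g) Q z)) \<le> (\<Sum>Q\<in>F. ?K * exp (- cmod (0 - center \<delta> Q)))"
        using F by (intro sum_mono synth_term_le[OF \<alpha> bound[OF g] B0[OF g(2)]]) auto
      also have "\<dots> = ?K * (\<Sum>Q\<in>F. exp (- cmod (0 - center \<delta> Q)))" by (rule sum_distrib_left[symmetric])
      also have "\<dots> \<le> ?K * (N\<^sup>2 / pi * exp 1 * kconst 1)"
        using growth_nonneg[OF g(2)] \<alpha> by (intro mult_left_mono sum_exp_center_le F) auto
      finally show "(\<Sum>Q\<in>F. cmod (synth_term \<alpha> \<delta> (recov \<alpha> g) Q z)) \<le> ?K * (N\<^sup>2 / pi * exp 1 * kconst 1)" .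
    qed
    with 1 have "cmod (D g) \<le> B * (exp (cmod (z0 - z)) * exp (\<alpha> / 2 * (cmod z)\<^sup>2)) + ?K * (N\<^sup>2 / pi * exp 1 * kconst 1)"
      unfolding D_def by (intro norm_triangle_le_diff add_mono)
    also have "\<dots> = B * S"
      unfolding S_def distrib_left by (simp only: mult_ac times_divide_eq_left times_divide_eq_right)
    finally show ?thesis .
  qed
  have "cmod (D f) \<le> A * (1 / 2) ^ n * S" for n
    using iter[of n] Dle errop_iter[OF assms, of n] by auto
  moreover have "(\<lambda>n. A * (1 / 2) ^ n * S) \<longlonglongrightarrow> A * 0 * S"
    by (intro tendsto_intros LIMSEQ_power_zero) auto
  ultimately have "cmod (D f) \<le> A * 0 * S"
    by (intro LIMSEQ_le_const) auto
  then show ?thesis by (simp add: D_def)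
qed

end

section \<open>The main theorem\<close>

text \<open>A Harnack inequality from the triangle inequality in the exponent. It moves values of
  \<open>kern\<close> from a centre to its sector, and spreads an infinite value over the whole
  plane.\<close>

lemma kern_harnack:
  assumes s: "s \<ge> 0" and [measurable]: "b \<in> borel_measurable borel"
  shows "kern s b z \<le> ennreal (exp (s * cmod (z - z'))) * kern s b z'"
proof -
  have "kern s b z \<le> (\<integral>\<^sup>+ u. ennreal (exp (s * cmod (z - z'))) * (b u * ennreal (exp (- s * cmod (z' - u)))) \<partial>lborel)"
    unfolding kern_def
  proof (rule nn_integral_mono)
    fix u
    have "cmod (z' - u) \<le> cmod (z - z') + cmod (z - u)"
      using norm_triangle_ineq4[of "z - u" "z - z'"] by simp
    then have "s * cmod (z' - u) \<le> s * (cmod (z - z') + cmod (z - u))" using s by (rule mult_left_mono)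
    then have "exp (- s * cmod (z - u)) \<le> exp (s * cmod (z - z')) * exp (- s * cmod (z' - u))"
      unfolding exp_add[symmetric] by (simp add: distrib_left)
    then have "b u * ennreal (exp (- s * cmod (z - u))) \<le> b u * (ennreal (exp (s * cmod (z - z'))) * ennreal (exp (- s * cmod (z' - u))))"
      by (intro mult_left_mono) (auto simp: ennreal_mult[symmetric] intro!: ennreal_leI)
    then show "b u * ennreal (exp (- s * cmod (z - u))) \<le> ennreal (exp (s * cmod (z - z'))) * (b u * ennreal (exp (- s * cmod (z' - u))))"
      by (simp only: mult.left_commute)
  qed
  also have "\<dots> = ennreal (exp (s * cmod (z - z'))) * kern s b z'"
    unfolding kern_def by (rule nn_integral_cmult) measurable
  finally show ?thesis .
qed

lemma common_exponent:
  fixes p q :: ennreal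
  assumes "p > 0" "q > 0"
  obtains s :: real where "0 < s" "s \<le> 1" "ennreal s \<le> p" "ennreal s \<le> q"
proof -
  define t where "t = min 1 (min p q)"
  have t: "t > 0" "t \<le> 1" "t \<le> p" "t \<le> q" using assms by (auto simp: t_def min_le_iff_disj)
  then obtain s where s: "t = ennreal s" "s \<ge> 0" by (cases t) (auto simp: top_unique)
  show thesis
  proof (rule that[of s])
    show "0 < s" "s \<le> 1" "ennreal s \<le> p" "ennreal s \<le> q" using s t by auto
  qed
qed

lemma osc_const_pos: "osc_const \<alpha> > 0"
  by (simp add: osc_const_def)

lemma err_const_pos: "\<alpha> > 0 \<Longrightarrow> err_const \<alpha> > 0"
  using osc_const_pos[of \<alpha>] kconst_pos[of 1] by (simp add: err_const_def)

context small_tiling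
begin

lemma fock_norm_synth_le:
  assumes \<alpha>: "\<alpha> > 0" and p: "p > 0" and q: "q > 0"
    and s: "0 < s" "s \<le> 1" "ennreal s \<le> p" "ennreal s \<le> q" and c: "c \<in> seq_space \<delta> p q"
  defines "C \<equiv> exp (1 / (2 * \<alpha>)) powr s * (N\<^sup>2 / pi * exp s)"
  shows "fock_norm \<alpha> p q (synth \<alpha> \<delta> c) \<le> ennreal (fock_const \<alpha> q * (C powr (1 / s) * kconst s powr (1 / s))) * seq_norm \<delta> p q c"
proof -
  obtain A B where A: "A \<ge> 0" and gr: "\<And>Q. Q \<in> pockets \<delta> \<Longrightarrow> cmod (c Q) \<le> A * exp (B * cmod (center \<delta> Q))"
    using seq_space_growth[OF p q c] by blast
  have hol: "synth \<alpha> \<delta> c holomorphic_on UNIV" by (rule synth_converges(2)[OF \<alpha> A gr])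
  have C: "C \<ge> 0" by (simp add: C_def)
  \<comment> \<open>\<open>mean_kern_le\<close> takes a real-valued majorant; \<open>gm\<close>
    shows that nothing is lost, because the block norms are finite.\<close>
  define g where "g k = (1 + real k) powr (- enn2real (inverse p)) * enn2real (block_norm \<delta> p c k)" for k
  define m where "m r = g (nat \<lfloor>r\<rfloor>)" for r :: real
  have [measurable]: "m \<in> borel_measurable borel"
    unfolding m_def[abs_def] by (rule measurable_compose[of _ _ "count_space UNIV"]) auto
  have m0: "m r \<ge> 0" for r by (simp add: m_def g_def)
  have gm: "ennreal (m r) = ennreal ((1 + real (nat \<lfloor>r\<rfloor>)) powr (- enn2real (inverse p))) * block_norm \<delta> p c (nat \<lfloor>r\<rfloor>)" for r
    using block_norm_finite[OF q c] by (simp add: m_def g_def ennreal_mult less_top[symmetric])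
  let ?G = "\<lambda>z. ennreal (fock_mod \<alpha> (synth \<alpha> \<delta> c) z)"
  have le: "mean p ?G r \<le> epowr (ennreal C) (1 / s) * radial_kern s m r" if r: "r \<ge> 0" for r
  proof (rule mean_kern_le[OF p s(1,3), where b="\<lambda>z. cmod (c (pocket_of z))"])
    show "epowr (?G z) s \<le> ennreal C * kern s (\<lambda>u. ennreal (cmod (c (pocket_of u)) powr s)) z" for z
      using synth_kern_bound[OF \<alpha> s(1,2) A gr, of z] by (simp add: C_def)
    show "mean p (\<lambda>z. ennreal (cmod (c (pocket_of z)))) r \<le> ennreal (m r)" if "r \<ge> 0" for r
      unfolding gm by (rule mean_step_le[OF p that refl])
  qed (use m0 r in \<open>auto intro: borel_measurable_pocket_of[of "\<lambda>Q. cmod (c Q)"]\<close>)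
  have "mixed q (mean p ?G) \<le> mixed q (\<lambda>r. ennreal (C powr (1 / s)) * radial_kern s m r)"
    using le C by (intro mixed_mono) simp
  also have "\<dots> = ennreal (C powr (1 / s)) * mixed q (radial_kern s m)"
    by (rule mixed_cmult[OF _ q]) measurable
  also have "\<dots> \<le> ennreal (C powr (1 / s)) * (ennreal (kconst s powr (1 / s)) * mixed q (\<lambda>r. ennreal (m r)))"
    by (intro mult_left_mono mixed_radial_kern_le q s m0) auto
  also have "\<dots> \<le> ennreal (C powr (1 / s)) * (ennreal (kconst s powr (1 / s)) * seq_norm \<delta> p q c)"
    unfolding gm by (intro mult_left_mono mixed_step_le p q) auto
  finally have "mixed q (mean p ?G) \<le> ennreal (C powr (1 / s)) * (ennreal (kconst s powr (1 / s)) * seq_norm \<delta> p q c)" .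
  then have "fock_norm \<alpha> p q (synth \<alpha> \<delta> c) \<le> ennreal (fock_const \<alpha> q) * (ennreal (C powr (1 / s)) * (ennreal (kconst s powr (1 / s)) * seq_norm \<delta> p q c))"
    unfolding fock_norm_eq_mixed[OF hol p q \<alpha>] by (rule mult_left_mono) simp
  then show ?thesis
    using fock_const_pos[OF \<alpha> q] by (simp add: ennreal_mult mult.assoc)
qed

text \<open>The function G is the growth constant at each point up to the factor C^(1/s). A
  coefficient is thus bounded by G at its centre, by Harnack also by G throughout its sector, and
  the passage from means to coefficients applies to G.\<close>

lemma recov_seq_norm_le:
  assumes \<alpha>: "\<alpha> > 0" and p: "p > 0" and q: "q > 0"
    and s: "0 < s" "s \<le> 1" "ennreal s \<le> p" "ennreal s \<le> q"
    and small: "err_const \<alpha> * \<delta> \<le> 1 / 2" and f: "f \<in> fock_space \<alpha> p q"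
  defines "C \<equiv> 2 powr (2 * (1 - s) / s) * 4 / pi * exp (\<alpha> * s / 2) * exp s"
  defines "D \<equiv> 2 * \<alpha> / N\<^sup>2 * (C powr (1 / s) * exp 9)"
  shows "seq_norm \<delta> p q (recov \<alpha> f) \<le>
      ennreal (D * (2 * N\<^sup>2) powr enn2real (inverse p) * 4 powr enn2real (inverse q) *
        (kconst s powr (1 / s) / fock_const \<alpha> q)) * fock_norm \<alpha> p q f"
    and "synth \<alpha> \<delta> (recov \<alpha> f) = f"
proof -
  have hol: "f holomorphic_on UNIV" and fin: "fock_norm \<alpha> p q f < \<infinity>"
    using f by (auto simp: fock_space_def)
  note cont = continuous_on_fock_mod[OF hol, of \<alpha>]
  note [measurable] = borel_measurable_holomorphic_UNIV[OF hol]
  have C: "C > 0" by (simp add: C_def)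
  have D: "D > 0" using C \<alpha> N_pos by (simp add: D_def)
  define b where "b u = ennreal (fock_mod \<alpha> f u powr s)" for u
  have [measurable]: "b \<in> borel_measurable borel" unfolding b_def[abs_def] by measurable
  let ?F = "\<lambda>z. ennreal (fock_mod \<alpha> f z)"
  define m where "m r = enn2real (mean p ?F r)" for r
  have [measurable]: "mean p ?F \<in> borel_measurable borel" by (rule borel_measurable_mean[OF cont])
  have [measurable]: "m \<in> borel_measurable borel" unfolding m_def[abs_def] by measurable
  have m: "ennreal (m r) = mean p ?F r" for r
    using mean_finite[OF cont p] by (simp add: m_def less_top[symmetric])
  have m0: "m r \<ge> 0" for r by (simp add: m_def)
  define G where "G z = epowr (kern s b z) (1 / s)" for z
  have [measurable]: "G \<in> borel_measurable borel" unfolding G_def[abs_def] by measurable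
  define M where "M = radial_kern s m"
  have [measurable]: "M \<in> borel_measurable borel" unfolding M_def by measurable
  have GM: "mean p G r \<le> M r" if r: "r \<ge> 0" for r
  proof -
    have "mean p G r \<le> epowr 1 (1 / s) * radial_kern s m r"
    proof (rule mean_kern_le[OF p s(1,3), where b="fock_mod \<alpha> f"])
      show "epowr (G z) s \<le> 1 * kern s (\<lambda>u. ennreal (fock_mod \<alpha> f u powr s)) z" for z
        using s by (simp add: G_def epowr_inverse b_def[abs_def])
    qed (use m0 m r in auto)
    then show ?thesis by (simp add: M_def)
  qed
  have mixM: "mixed q M \<le> ennreal (kconst s powr (1 / s) / fock_const \<alpha> q) * fock_norm \<alpha> p q f"
  proof -
    have "mixed q M \<le> ennreal (kconst s powr (1 / s)) * mixed q (mean p ?F)"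
      using mixed_radial_kern_le[OF q s(1,4) _ m0] unfolding M_def m by simp
    also have "\<dots> = ennreal (kconst s powr (1 / s) / fock_const \<alpha> q) * fock_norm \<alpha> p q f"
      using fock_const_pos[OF \<alpha> q]
      by (simp add: fock_norm_eq_mixed[OF hol p q \<alpha>] mult.assoc[symmetric] ennreal_mult[symmetric])
    finally show ?thesis .
  qed
  then have mixM_fin: "mixed q M < \<infinity>" using fin by (auto simp: ennreal_mult_less_top elim: le_less_trans)
  have seq_le: "seq_norm \<delta> p q c \<le> ennreal (E * (2 * N\<^sup>2) powr enn2real (inverse p) * 4 powr enn2real (inverse q)) * mixed q M"
    if E: "E > 0" and le: "\<And>k \<nu> \<mu> r \<theta>. (k, \<nu>, \<mu>) \<in> pocket_indices \<delta> \<Longrightarrow> real k \<le> r \<Longrightarrow> r < real k + 1 \<Longrightarrow>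
      pocket_angle \<delta> k \<nu> \<mu> \<le> \<theta> \<Longrightarrow> \<theta> < pocket_angle \<delta> k \<nu> (\<mu> + 1) \<Longrightarrow>
      ennreal (cmod (c (pocket \<delta> k \<nu> \<mu>))) \<le> ennreal E * G (of_real r * cis \<theta>)" for E c
  proof (rule seq_norm_le_mixed[OF p q])
    show "0 < E * (2 * N\<^sup>2) powr enn2real (inverse p)" using E N_pos by simp
    fix k :: nat and r :: real assume r: "real k \<le> r" "r < real k + 1"
    have "block_norm \<delta> p c k \<le> ennreal (E * (2 * N\<^sup>2) powr enn2real (inverse p) * (1 + real k) powr enn2real (inverse p)) * mean p G r"
      by (rule block_le_mean[where G=G and c=c, OF p E _ _ r]) (measurable, rule le)
    also have "\<dots> \<le> ennreal (E * (2 * N\<^sup>2) powr enn2real (inverse p) * (1 + real k) powr enn2real (inverse p)) * M r"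
      using r by (intro mult_left_mono GM) auto
    finally show "block_norm \<delta> p c k \<le> ennreal (E * (2 * N\<^sup>2) powr enn2real (inverse p) * (1 + real k) powr enn2real (inverse p)) * M r" .
  qed simp
  \<comment> \<open>Finiteness is extracted from the discrete estimate. By Harnack, one infinite
    value would make G infinite everywhere; \<open>seq_le\<close> would then hold for constant
    coefficients of any size, with a fixed finite right-hand side.\<close>
  have kfin: "kern s b z < \<infinity>" for z
  proof (rule ccontr)
    assume "\<not> ?thesis"
    then have z: "kern s b z = top" by (simp add: less_top[symmetric])
    have top: "G w = top" for w
      using kern_harnack[of s b z w] s z
      by (auto simp: G_def top_unique ennreal_mult_eq_top_iff)
    define R where "R = ennreal (1 * (2 * N\<^sup>2) powr enn2real (inverse p) * 4 powr enn2real (inverse q)) * mixed q M"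
    have R: "R < top" using mixM_fin by (simp add: R_def ennreal_mult_less_top)
    \<comment> \<open>Exceeds R. The innermost pocket lies in block 0, where the weight is 1, so the
      constant family t has norm at least t.\<close>
    define t where "t = enn2real R + 1"
    have t: "t > 0" by (simp add: t_def add_nonneg_pos)
    have "pocket \<delta> 0 0 0 \<in> pockets_in \<delta> 0"
      unfolding pockets_in_eq[OF \<delta>_pos] using N_rad_pos[OF \<delta>_pos] N_ang_pos[OF \<delta>_pos] by force
    then have "ennreal t \<le> block_norm \<delta> p (\<lambda>_. of_real t) 0"
      using coeff_le_block[OF p, of "pocket \<delta> 0 0 0" 0 "\<lambda>_. of_real t"] t by simp
    also have "\<dots> \<le> seq_norm \<delta> p q (\<lambda>_. of_real t)"
      using weighted_block_le[OF q, of p 0 "\<lambda>_. of_real t"] by (simp add: weight_def)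
    also have "\<dots> \<le> R" unfolding R_def by (rule seq_le) (auto simp: top)
    also have "R < ennreal t" using R by (cases R) (auto simp: t_def ennreal_less_iff)
    finally show False by simp
  qed
  \<comment> \<open>The growth constant that \<open>kern_growth\<close> provides at base point z,
    real by \<open>kfin\<close>.\<close>
  define A where "A z = C powr (1 / s) * enn2real (G z)" for z
  have Afin: "ennreal (A z) = ennreal (C powr (1 / s)) * G z" for z
    using kfin[of z] by (simp add: A_def G_def ennreal_mult less_top[symmetric])
  have gr: "growth \<alpha> f z (A z)" for z
    unfolding growth_def
  proof
    fix v
    let ?x = "fock_mod \<alpha> f v * exp (- cmod (z - v))"
    have "epowr (ennreal ?x) s \<le> ennreal C * kern s b z"
      using kern_growth[OF hol s(1,2) \<alpha>, of v z] by (simp add: C_def b_def[abs_def])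
    then have "ennreal ?x \<le> epowr (ennreal C * kern s b z) (1 / s)" using s by (simp only: epowr_le_swap)
    also have "\<dots> = ennreal (A z)" using s C by (simp add: Afin G_def epowr_mult)
    finally have "?x \<le> A z" by (simp add: A_def)
    then have "?x * exp (cmod (z - v)) \<le> A z * exp (cmod (z - v))" by (rule mult_right_mono) simp
    then show "fock_mod \<alpha> f v \<le> A z * exp (cmod (z - v))"
      by (simp only: mult.assoc exp_add[symmetric]) simp
  qed
  show "synth \<alpha> \<delta> (recov \<alpha> f) = f"
    using synth_recov[OF hol \<alpha> small gr] by (rule ext)
  have "seq_norm \<delta> p q (recov \<alpha> f) \<le> ennreal (D * (2 * N\<^sup>2) powr enn2real (inverse p) * 4 powr enn2real (inverse q)) * mixed q M"
  proof (rule seq_le[OF D])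
    fix k \<nu> \<mu> and r \<theta> :: real
    assume i: "(k, \<nu>, \<mu>) \<in> pocket_indices \<delta>" and r: "real k \<le> r" "r < real k + 1"
      and t: "pocket_angle \<delta> k \<nu> \<mu> \<le> \<theta>" "\<theta> < pocket_angle \<delta> k \<nu> (\<mu> + 1)"
    let ?Q = "pocket \<delta> k \<nu> \<mu>" and ?z = "of_real r * cis \<theta>"
    let ?w = "pocket_center \<delta> k \<nu> \<mu>"
    have w: "center \<delta> ?Q = ?w" by (rule center_pocket[OF \<delta>_pos i])
    have "cmod (?z - ?w) \<le> 9"
      using \<delta>_small by (intro pocket_sector_dist[OF \<delta>_pos _ i r t]) simp
    then have d: "cmod (?w - ?z) \<le> 9" by (simp only: norm_minus_commute)
    have "kern s b ?w \<le> ennreal (exp (s * cmod (?w - ?z))) * kern s b ?z" using s by (intro kern_harnack) auto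
    \<comment> \<open>The distance 9 from \<open>pocket_sector_dist\<close> becomes exp 9 after the
      root 1/s.\<close>
    also have "\<dots> \<le> ennreal (exp (s * 9)) * kern s b ?z"
      using s d by (intro mult_right_mono ennreal_leI) auto
    finally have "G ?w \<le> epowr (ennreal (exp (s * 9)) * kern s b ?z) (1 / s)"
      unfolding G_def using s by (intro epowr_mono) auto
    also have "\<dots> = ennreal (exp 9) * G ?z" using s by (simp add: G_def epowr_mult exp_powr_real)
    finally have G9: "G ?w \<le> ennreal (exp 9) * G ?z" .
    have "cmod (recov \<alpha> f ?Q) \<le> 2 * \<alpha> / N\<^sup>2 * A ?w"
      using recov_bound(2)[OF hol \<alpha> small gr[of ?w], of ?Q] by (simp add: w)
    then have "ennreal (cmod (recov \<alpha> f ?Q)) \<le> ennreal (2 * \<alpha> / N\<^sup>2 * A ?w)" by (rule ennreal_leI)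
    also have "\<dots> = ennreal (2 * \<alpha> / N\<^sup>2) * (ennreal (C powr (1 / s)) * G ?w)"
      using \<alpha> by (subst ennreal_mult) (simp_all only: Afin, simp_all add: A_def)
    also have "\<dots> \<le> ennreal (2 * \<alpha> / N\<^sup>2) * (ennreal (C powr (1 / s)) * (ennreal (exp 9) * G ?z))"
      by (intro mult_left_mono G9) auto
    also have "\<dots> = ennreal D * G ?z"
    proof -
      have "ennreal D = ennreal (2 * \<alpha> / N\<^sup>2) * (ennreal (C powr (1 / s)) * ennreal (exp 9))"
        unfolding D_def using \<alpha> by (subst ennreal_mult, simp, simp, subst ennreal_mult) auto
      then show ?thesis by (simp only: mult.assoc)
    qed
    finally show "ennreal (cmod (recov \<alpha> f ?Q)) \<le> ennreal D * G ?z" .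
  qed
  also have "\<dots> \<le> ennreal (D * (2 * N\<^sup>2) powr enn2real (inverse p) * 4 powr enn2real (inverse q)) *
      (ennreal (kconst s powr (1 / s) / fock_const \<alpha> q) * fock_norm \<alpha> p q f)"
    by (intro mult_left_mono mixM) simp
  also have "\<dots> = ennreal (D * (2 * N\<^sup>2) powr enn2real (inverse p) * 4 powr enn2real (inverse q) *
        (kconst s powr (1 / s) / fock_const \<alpha> q)) * fock_norm \<alpha> p q f"
    unfolding mult.assoc[symmetric]
    by (rule arg_cong[where f="\<lambda>x. x * fock_norm \<alpha> p q f"], rule ennreal_mult[symmetric])
      (use D fock_const_pos[OF \<alpha> q] in auto)
  finally show "seq_norm \<delta> p q (recov \<alpha> f) \<le>
      ennreal (D * (2 * N\<^sup>2) powr enn2real (inverse p) * 4 powr enn2real (inverse q) *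
        (kconst s powr (1 / s) / fock_const \<alpha> q)) * fock_norm \<alpha> p q f" .
qed

lemma synth_lincomb:
  assumes \<alpha>: "\<alpha> > 0" and p: "p > 0" and q: "q > 0"
    and c: "c \<in> seq_space \<delta> p q" and d: "d \<in> seq_space \<delta> p q"
  shows "synth \<alpha> \<delta> (\<lambda>Q. a * c Q + b * d Q) = (\<lambda>z. a * synth \<alpha> \<delta> c z + b * synth \<alpha> \<delta> d z)"
proof
  fix z
  note conv = seq_space_converges(3)[OF \<alpha> p q]
  have "((\<lambda>Q. a * synth_term \<alpha> \<delta> c Q z + b * synth_term \<alpha> \<delta> d Q z) has_sum
      (a * synth \<alpha> \<delta> c z + b * synth \<alpha> \<delta> d z)) (pockets \<delta>)"
    by (intro has_sum_add has_sum_cmult_right conv c d)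
  moreover have "a * synth_term \<alpha> \<delta> c Q z + b * synth_term \<alpha> \<delta> d Q z = synth_term \<alpha> \<delta> (\<lambda>Q. a * c Q + b * d Q) Q z" for Q
    by (simp add: synth_term_def algebra_simps)
  ultimately show "synth \<alpha> \<delta> (\<lambda>Q. a * c Q + b * d Q) z = a * synth \<alpha> \<delta> c z + b * synth \<alpha> \<delta> d z"
    by (simp only: has_sum_unique[OF conv[OF seq_space_lincomb[OF p q c d]]])
qed

lemma fock_frame:
  assumes \<alpha>: "\<alpha> > 0" and p: "p > 0" and q: "q > 0" and small: "err_const \<alpha> * \<delta> \<le> 1 / 2"
  obtains C1 C2 :: real where "C1 > 0" "C2 > 0"
    "\<And>c. c \<in> seq_space \<delta> p q \<Longrightarrow> abs_loc_unif_summable (synth_term \<alpha> \<delta> c) (pockets \<delta>)"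
    "\<And>c. c \<in> seq_space \<delta> p q \<Longrightarrow> synth \<alpha> \<delta> c \<in> fock_space \<alpha> p q"
    "\<And>c. c \<in> seq_space \<delta> p q \<Longrightarrow> fock_norm \<alpha> p q (synth \<alpha> \<delta> c) \<le> ennreal C1 * seq_norm \<delta> p q c"
    "\<And>f. f \<in> fock_space \<alpha> p q \<Longrightarrow>
      \<exists>c\<in>seq_space \<delta> p q. f = synth \<alpha> \<delta> c \<and> seq_norm \<delta> p q c \<le> ennreal C2 * fock_norm \<alpha> p q f"
proof -
  obtain s :: real where s: "0 < s" "s \<le> 1" "ennreal s \<le> p" "ennreal s \<le> q"
    using common_exponent[OF p q] by blast
  define C1 where "C1 = fock_const \<alpha> q * ((exp (1 / (2 * \<alpha>)) powr s * (N\<^sup>2 / pi * exp s)) powr (1 / s) * kconst s powr (1 / s))"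
  have C1: "C1 > 0" using fock_const_pos[OF \<alpha> q] N_pos kconst_pos[of s] by (simp add: C1_def)
  define C2 where "C2 = 2 * \<alpha> / N\<^sup>2 * ((2 powr (2 * (1 - s) / s) * 4 / pi * exp (\<alpha> * s / 2) * exp s) powr (1 / s) * exp 9) *
    (2 * N\<^sup>2) powr enn2real (inverse p) * 4 powr enn2real (inverse q) * (kconst s powr (1 / s) / fock_const \<alpha> q)"
  have C2: "C2 > 0" using fock_const_pos[OF \<alpha> q] N_pos kconst_pos[of s] \<alpha> by (simp add: C2_def)
  have norm: "fock_norm \<alpha> p q (synth \<alpha> \<delta> c) \<le> ennreal C1 * seq_norm \<delta> p q c" if "c \<in> seq_space \<delta> p q" for c
    unfolding C1_def by (rule fock_norm_synth_le[OF \<alpha> p q s that])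
  show thesis
  proof (rule that[OF C1 C2])
    fix c assume c: "c \<in> seq_space \<delta> p q"
    show "abs_loc_unif_summable (synth_term \<alpha> \<delta> c) (pockets \<delta>)" by (rule seq_space_converges(1)[OF \<alpha> p q c])
    show "fock_norm \<alpha> p q (synth \<alpha> \<delta> c) \<le> ennreal C1 * seq_norm \<delta> p q c" by (rule norm[OF c])
    then have "fock_norm \<alpha> p q (synth \<alpha> \<delta> c) < \<infinity>"
      using c by (auto simp: seq_space_def ennreal_mult_less_top elim: le_less_trans)
    then show "synth \<alpha> \<delta> c \<in> fock_space \<alpha> p q" using seq_space_converges(2)[OF \<alpha> p q c] by (simp add: fock_space_def)
  next
    fix f assume f: "f \<in> fock_space \<alpha> p q"
    have le: "seq_norm \<delta> p q (recov \<alpha> f) \<le> ennreal C2 * fock_norm \<alpha> p q f"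
      unfolding C2_def by (rule recov_seq_norm_le(1)[OF \<alpha> p q s small f])
    then have "recov \<alpha> f \<in> seq_space \<delta> p q"
      using f by (auto simp: seq_space_def fock_space_def ennreal_mult_less_top elim: le_less_trans)
    with le show "\<exists>c\<in>seq_space \<delta> p q. f = synth \<alpha> \<delta> c \<and> seq_norm \<delta> p q c \<le> ennreal C2 * fock_norm \<alpha> p q f"
      using recov_seq_norm_le(2)[OF \<alpha> p q s small f] by (intro bexI[of _ "recov \<alpha> f"]) auto
  qed
qed

end

theorem theorem1p3:
  fixes \<alpha> :: real and p q :: ennreal
  assumes "\<alpha> > 0" and "p > 0" and "q > 0"
  shows "\<exists>\<delta>0::real. 0 < \<delta>0 \<and> \<delta>0 \<le> 1 / 2 \<and>
    (\<forall>\<delta>. 0 < \<delta> \<and> \<delta> < \<delta>0 \<longrightarrow>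
      \<comment> \<open>synthesis\<close>
      ((\<forall>c \<in> seq_space \<delta> p q.
          abs_loc_unif_summable (synth_term \<alpha> \<delta> c) (pockets \<delta>) \<and>
          synth \<alpha> \<delta> c \<in> fock_space \<alpha> p q) \<and>
       (\<forall>c \<in> seq_space \<delta> p q. \<forall>d \<in> seq_space \<delta> p q. \<forall>a b :: complex.
          (\<lambda>Q. a * c Q + b * d Q) \<in> seq_space \<delta> p q \<and>
          synth \<alpha> \<delta> (\<lambda>Q. a * c Q + b * d Q) = (\<lambda>z. a * synth \<alpha> \<delta> c z + b * synth \<alpha> \<delta> d z)) \<and>
       (\<exists>C::real. C > 0 \<and>
          (\<forall>c \<in> seq_space \<delta> p q.
             fock_norm \<alpha> p q (synth \<alpha> \<delta> c) \<le> ennreal C * seq_norm \<delta> p q c))) \<and>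
      \<comment> \<open>coefficient recovery and optimality\<close>
      (\<forall>f \<in> fock_space \<alpha> p q. \<exists>c \<in> seq_space \<delta> p q. f = synth \<alpha> \<delta> c) \<and>
      (\<exists>C::real. C \<ge> 1 \<and>
         (\<forall>f \<in> fock_space \<alpha> p q.
            ennreal (1 / C) * fock_norm \<alpha> p q f
              \<le> (INF c \<in> {c \<in> seq_space \<delta> p q. f = synth \<alpha> \<delta> c}. seq_norm \<delta> p q c) \<and>
            (INF c \<in> {c \<in> seq_space \<delta> p q. f = synth \<alpha> \<delta> c}. seq_norm \<delta> p q c)
              \<le> ennreal C * fock_norm \<alpha> p q f)))"
proof -
  \<comment> \<open>The bound 1/9 gives the locale assumption, the other makes the contraction
    factor at most 1/2. The exponents p, q do not enter, because the contraction takes place in the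
    growth class.\<close>
  define \<delta>0 where "\<delta>0 = min (1 / 9) (1 / (2 * err_const \<alpha>))"
  have e: "err_const \<alpha> > 0" by (rule err_const_pos[OF assms(1)])
  have \<delta>0: "0 < \<delta>0" "\<delta>0 \<le> 1 / 2" using e by (auto simp: \<delta>0_def min_def)
  show ?thesis
  proof (rule exI[of _ \<delta>0], intro conjI \<delta>0 allI impI)
    fix \<delta> :: real
    assume \<delta>: "0 < \<delta> \<and> \<delta> < \<delta>0"
    interpret small_tiling \<delta> by unfold_locales (use \<delta> in \<open>auto simp: \<delta>0_def\<close>)
    have "\<delta> \<le> 1 / (2 * err_const \<alpha>)" using \<delta> by (auto simp: \<delta>0_def)
    then have small: "err_const \<alpha> * \<delta> \<le> 1 / 2" using e by (simp add: field_simps)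
    obtain C1 C2 :: real where C: "C1 > 0" "C2 > 0"
      and conv: "\<And>c. c \<in> seq_space \<delta> p q \<Longrightarrow> abs_loc_unif_summable (synth_term \<alpha> \<delta> c) (pockets \<delta>)"
      and mem: "\<And>c. c \<in> seq_space \<delta> p q \<Longrightarrow> synth \<alpha> \<delta> c \<in> fock_space \<alpha> p q"
      and le1: "\<And>c. c \<in> seq_space \<delta> p q \<Longrightarrow> fock_norm \<alpha> p q (synth \<alpha> \<delta> c) \<le> ennreal C1 * seq_norm \<delta> p q c"
      and rec: "\<And>f. f \<in> fock_space \<alpha> p q \<Longrightarrow>
        \<exists>c\<in>seq_space \<delta> p q. f = synth \<alpha> \<delta> c \<and> seq_norm \<delta> p q c \<le> ennreal C2 * fock_norm \<alpha> p q f"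
      using fock_frame[OF assms small] by blast
    show "\<forall>c\<in>seq_space \<delta> p q. abs_loc_unif_summable (synth_term \<alpha> \<delta> c) (pockets \<delta>) \<and> synth \<alpha> \<delta> c \<in> fock_space \<alpha> p q"
      using conv mem by blast
    show "\<forall>c\<in>seq_space \<delta> p q. \<forall>d\<in>seq_space \<delta> p q. \<forall>a b. (\<lambda>Q. a * c Q + b * d Q) \<in> seq_space \<delta> p q \<and>
        synth \<alpha> \<delta> (\<lambda>Q. a * c Q + b * d Q) = (\<lambda>z. a * synth \<alpha> \<delta> c z + b * synth \<alpha> \<delta> d z)"
      using seq_space_lincomb[OF assms(2,3)] synth_lincomb[OF assms] by blast
    show "\<exists>C>0. \<forall>c\<in>seq_space \<delta> p q. fock_norm \<alpha> p q (synth \<alpha> \<delta> c) \<le> ennreal C * seq_norm \<delta> p q c"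
      using C le1 by blast
    show "\<forall>f\<in>fock_space \<alpha> p q. \<exists>c\<in>seq_space \<delta> p q. f = synth \<alpha> \<delta> c"
      using rec by blast
    let ?inf = "\<lambda>f. INF c \<in> {c \<in> seq_space \<delta> p q. f = synth \<alpha> \<delta> c}. seq_norm \<delta> p q c"
    \<comment> \<open>One constant for both sides: C1 bounds the norm of f by that of every
      representing family, hence by their infimum, and C2 comes from the particular family found by
      recovery.\<close>
    define C where "C = max 1 (max C1 C2)"
    show "\<exists>C\<ge>1. \<forall>f\<in>fock_space \<alpha> p q.
        ennreal (1 / C) * fock_norm \<alpha> p q f \<le> ?inf f \<and>
        ?inf f \<le> ennreal C * fock_norm \<alpha> p q f"
    proof (intro exI[of _ C] conjI ballI)
      show "C \<ge> 1" by (simp add: C_def)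
      fix f assume f: "f \<in> fock_space \<alpha> p q"
      show "ennreal (1 / C) * fock_norm \<alpha> p q f \<le> ?inf f"
      proof (rule INF_greatest)
        fix c assume "c \<in> {c \<in> seq_space \<delta> p q. f = synth \<alpha> \<delta> c}"
        then have "fock_norm \<alpha> p q f \<le> ennreal C1 * seq_norm \<delta> p q c" using le1 by auto
        also have "\<dots> \<le> ennreal C * seq_norm \<delta> p q c"
          by (intro mult_right_mono ennreal_leI) (auto simp: C_def)
        finally have "ennreal (1 / C) * fock_norm \<alpha> p q f \<le> ennreal (1 / C) * (ennreal C * seq_norm \<delta> p q c)"
          by (rule mult_left_mono) simp
        also have "\<dots> = (ennreal (1 / C) * ennreal C) * seq_norm \<delta> p q c" by (simp only: mult.assoc)
        also have "ennreal (1 / C) * ennreal C = 1"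
          using \<open>C \<ge> 1\<close> by (subst ennreal_mult[symmetric]) auto
        finally show "ennreal (1 / C) * fock_norm \<alpha> p q f \<le> seq_norm \<delta> p q c" by simp
      qed
      obtain c where c: "c \<in> seq_space \<delta> p q" "f = synth \<alpha> \<delta> c" "seq_norm \<delta> p q c \<le> ennreal C2 * fock_norm \<alpha> p q f"
        using rec[OF f] by blast
      have "?inf f \<le> seq_norm \<delta> p q c"
        using c by (intro INF_lower) auto
      also have "\<dots> \<le> ennreal C2 * fock_norm \<alpha> p q f" by (rule c(3))
      also have "\<dots> \<le> ennreal C * fock_norm \<alpha> p q f"
        by (intro mult_right_mono ennreal_leI) (auto simp: C_def)
      finally show "?inf f \<le> ennreal C * fock_norm \<alpha> p q f" .
    qed
  qed
qed

end
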